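(* Let $X$ be a Hausdorff topological space and $\mu$ a $\sigma$-finite Borel measure on $X$. Let $\mathcal E$ be a nonlinear order preserving form on $L^2(\mu)$ for which $\mathcal E_e$ exists; assume $\mathcal E$ is reflexive, subcritical and satisfies the $\Delta_2$-condition, and that there exists an $\mathcal E$-excessive function $h\in D(\mathcal E_e)$ with $h>0$ a.e. For $A\subseteq X$ the following are equivalent: (i) $A$ is $\mathcal E$-exceptional; (ii) for all $\mathcal E$-excessive $\tilde h\in D(\mathcal E_e)$ with $\tilde h>0$ a.e. we have $\mathrm{cap}_{\tilde h}(A)=0$. If moreover $Nh$ is $\mathcal E$-excessive for each $N\in\mathbb N$, then these are equivalent to (iii) $\mathrm{cap}_h(A)=0$.
   Context: $L^0(\mu)$ carries local convergence in measure. A nonlinear order preserving form is a lower semicontinuous convex $\mathcal E\colon L^2(\mu)\to[0,\infty]$ with $\mathcal E(-f)=\mathcal E(f)$, $\mathcal E(0)=0$ and $\mathcal E(f+|g|)+\mathcal E(f-|g|)\le\mathcal E(f+g)+\mathcal E(f-g)$. $M(\mathcal E)=\{f:\lim_{\lambda\to0+}\mathcal E(\lambda f)=0\}$, $\|f\|_L=\inf\{\lambda>0:\mathcal E(\lambda^{-1}f)\le1\}$; reflexive: image of $M(\mathcal E)$ dense in the bidual of $(M(\mathcal E),\|\cdot\|_L)$. $\Delta_2$-condition: $\mathcal E(2f)\le K\mathcal E(f)$ for some $K$ and all $f$. $\mathcal E_e$: lower semicontinuous relaxation on $L^0(\mu)$ (local convergence in measure) of $\mathcal E$ extended by $+\infty$;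 $M(\mathcal E_e)$, $\|\cdot\|_{L_e}$ its modular space and Luxemburg seminorm. Resolvent $G_\alpha f$ minimizes $g\mapsto\mathcal E(g)+\frac\alpha2\|g-\alpha^{-1}f\|_2^2$, extended to nonnegative functions by monotone limits; $Gf=\lim_{\alpha\to0+}G_\alpha f$; subcritical: $Gf<\infty$ a.e. for some measurable $f>0$. A measurable $\tilde h\ge0$ is $\mathcal E$-excessive if $G_\alpha(\alpha\tilde h)\le\tilde h$ for all $\alpha>0$; for such $\tilde h$, $\mathrm{cap}_{\tilde h}(A)=\inf\{\mathcal E_e(f): f\in L^0(\mu),\ f\ge\tilde h$ a.e. on an open neighborhood of $A\}$. For $G\subseteq X$ and $\mathcal F\subseteq L^0(\mu)$, $\mathcal F_G=\{f\in\mathcal F: f=0$ on an open neighborhood of $X\setminus G\}$. An increasing sequence $(F_n)$ of closed sets is an $\mathcal E$-nest if $\bigcup_nM(\mathcal E_e)_{F_n}$ is $\|\cdot\|_{L_e}$-dense in $M(\mathcal E_e)$. $A$ is $\mathcal E$-exceptional if there is an $\mathcal E$-nest $(F_n)$ with $A\subseteq\bigcap_n(X\setminus F_n)$. *)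

theory Defs
  imports "HOL-Analysis.Analysis" "HOL-Probability.Probability"
begin

text \<open>Functions are represented by real-valued functions on the carrier; all notions
below are invariant under equality almost everywhere.  A form on L2 is represented by
a map E into [0,\<infinity>] which is \<infinity> outside L2 (the extension by \<infinity>).\<close>

definition L2 :: "'a measure \<Rightarrow> ('a \<Rightarrow> real) set" where
  "L2 M = {f. f \<in> borel_measurable M \<and> integrable M (\<lambda>x. (f x)\<^sup>2)}"

definition nonlinear_order_preserving_form ::
  "'a measure \<Rightarrow> (('a \<Rightarrow> real) \<Rightarrow> ennreal) \<Rightarrow> bool" where
  "nonlinear_order_preserving_form M E \<longleftrightarrow>
     (\<forall>f. f \<notin> L2 M \<longrightarrow> E f = \<infinity>) \<and>
     (\<forall>f\<in>L2 M. \<forall>g\<in>L2 M. (AE x in M. f x = g x) \<longrightarrow> E f = E g) \<and>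
     (\<forall>f\<in>L2 M. \<forall>fs. (\<forall>n. fs n \<in> L2 M) \<and>
         (\<lambda>n. integral\<^sup>L M (\<lambda>x. (fs n x - f x)\<^sup>2)) \<longlonglongrightarrow> 0
         \<longrightarrow> E f \<le> liminf (\<lambda>n. E (fs n))) \<and>
     (\<forall>f\<in>L2 M. \<forall>g\<in>L2 M. \<forall>t::real. 0 \<le> t \<and> t \<le> 1 \<longrightarrow>
         E (\<lambda>x. t * f x + (1 - t) * g x) \<le> ennreal t * E f + ennreal (1 - t) * E g) \<and>
     (\<forall>f. E (\<lambda>x. - f x) = E f) \<and>
     E (\<lambda>x. 0) = 0 \<and>
     (\<forall>f\<in>L2 M. \<forall>g\<in>L2 M.
         E (\<lambda>x. f x + \<bar>g x\<bar>) + E (\<lambda>x. f x - \<bar>g x\<bar>) \<le> E (\<lambda>x. f x + g x) + E (\<lambda>x. f x - g x))"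

definition modular_space :: "(('a \<Rightarrow> real) \<Rightarrow> ennreal) \<Rightarrow> ('a \<Rightarrow> real) set" where
  "modular_space E = {f. ((\<lambda>t::real. E (\<lambda>x. t * f x)) \<longlongrightarrow> 0) (at_right 0)}"

definition luxemburg :: "(('a \<Rightarrow> real) \<Rightarrow> ennreal) \<Rightarrow> ('a \<Rightarrow> real) \<Rightarrow> ennreal" where
  "luxemburg E f = Inf {ennreal l | l. l > 0 \<and> E (\<lambda>x. f x / l) \<le> 1}"

definition dual_space :: "(('a \<Rightarrow> real) \<Rightarrow> ennreal) \<Rightarrow> (('a \<Rightarrow> real) \<Rightarrow> real) set" where
  "dual_space E = {\<phi>.
     (\<forall>f\<in>modular_space E. \<forall>g\<in>modular_space E. \<forall>a b.
        \<phi> (\<lambda>x. a * f x + b * g x) = a * \<phi> f + b * \<phi> g) \<and>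
     (\<exists>C. \<forall>f\<in>modular_space E. \<bar>\<phi> f\<bar> \<le> C * enn2real (luxemburg E f)) \<and>
     (\<forall>f. f \<notin> modular_space E \<longrightarrow> \<phi> f = 0)}"

definition dual_norm :: "(('a \<Rightarrow> real) \<Rightarrow> ennreal) \<Rightarrow> (('a \<Rightarrow> real) \<Rightarrow> real) \<Rightarrow> real" where
  "dual_norm E \<phi> = Sup {\<bar>\<phi> f\<bar> | f. f \<in> modular_space E \<and> luxemburg E f \<le> 1}"

definition bidual_space ::
  "(('a \<Rightarrow> real) \<Rightarrow> ennreal) \<Rightarrow> ((('a \<Rightarrow> real) \<Rightarrow> real) \<Rightarrow> real) set" where
  "bidual_space E = {\<Phi>.
     (\<forall>\<phi>\<in>dual_space E. \<forall>\<psi>\<in>dual_space E. \<forall>a b.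
        \<Phi> (\<lambda>f. a * \<phi> f + b * \<psi> f) = a * \<Phi> \<phi> + b * \<Phi> \<psi>) \<and>
     (\<exists>C. \<forall>\<phi>\<in>dual_space E. \<bar>\<Phi> \<phi>\<bar> \<le> C * dual_norm E \<phi>) \<and>
     (\<forall>\<phi>. \<phi> \<notin> dual_space E \<longrightarrow> \<Phi> \<phi> = 0)}"

definition reflexive_form :: "(('a \<Rightarrow> real) \<Rightarrow> ennreal) \<Rightarrow> bool" where
  "reflexive_form E \<longleftrightarrow>
     (\<forall>\<Phi>\<in>bidual_space E. \<forall>\<epsilon>>0. \<exists>f\<in>modular_space E.
        \<forall>\<phi>\<in>dual_space E. \<bar>\<Phi> \<phi> - \<phi> f\<bar> \<le> \<epsilon> * dual_norm E \<phi>)"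

definition delta2_condition :: "(('a \<Rightarrow> real) \<Rightarrow> ennreal) \<Rightarrow> bool" where
  "delta2_condition E \<longleftrightarrow> (\<exists>K::real. \<forall>f. E (\<lambda>x. 2 * f x) \<le> ennreal K * E f)"

definition loc_conv_in_measure ::
  "'a measure \<Rightarrow> (nat \<Rightarrow> 'a \<Rightarrow> real) \<Rightarrow> ('a \<Rightarrow> real) \<Rightarrow> bool" where
  "loc_conv_in_measure M gs f \<longleftrightarrow>
     (\<forall>A\<in>sets M. emeasure M A < \<infinity> \<longrightarrow> (\<forall>\<epsilon>>0.
        (\<lambda>n. emeasure M {x\<in>A. \<epsilon> < \<bar>gs n x - f x\<bar>}) \<longlonglongrightarrow> 0))"

text \<open>Lower semicontinuous relaxation on L0 (metrizable for sigma-finite M, hence given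
by the sequential formula).\<close>

definition E_ext :: "'a measure \<Rightarrow> (('a \<Rightarrow> real) \<Rightarrow> ennreal) \<Rightarrow> ('a \<Rightarrow> real) \<Rightarrow> ennreal" where
  "E_ext M E f = (if f \<in> borel_measurable M then
      Inf {liminf (\<lambda>n. E (gs n)) | gs. (\<forall>n. gs n \<in> borel_measurable M) \<and> loc_conv_in_measure M gs f}
    else \<infinity>)"

definition extended_form_exists :: "'a measure \<Rightarrow> (('a \<Rightarrow> real) \<Rightarrow> ennreal) \<Rightarrow> bool" where
  "extended_form_exists M E \<longleftrightarrow> (\<forall>f\<in>L2 M. E_ext M E f = E f)"

definition dom_ext :: "'a measure \<Rightarrow> (('a \<Rightarrow> real) \<Rightarrow> ennreal) \<Rightarrow> ('a \<Rightarrow> real) set" where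
  "dom_ext M E = {f. f \<in> borel_measurable M \<and> E_ext M E f < \<infinity>}"

definition is_resolvent ::
  "'a measure \<Rightarrow> (('a \<Rightarrow> real) \<Rightarrow> ennreal) \<Rightarrow> real \<Rightarrow> ('a \<Rightarrow> real) \<Rightarrow> ('a \<Rightarrow> real) \<Rightarrow> bool" where
  "is_resolvent M E \<alpha> f g \<longleftrightarrow> g \<in> L2 M \<and>
     (\<forall>u\<in>L2 M. E g + ennreal (\<alpha> / 2 * integral\<^sup>L M (\<lambda>x. (g x - f x / \<alpha>)\<^sup>2))
               \<le> E u + ennreal (\<alpha> / 2 * integral\<^sup>L M (\<lambda>x. (u x - f x / \<alpha>)\<^sup>2)))"

definition ext_resolvent ::
  "'a measure \<Rightarrow> (('a \<Rightarrow> real) \<Rightarrow> ennreal) \<Rightarrow> real \<Rightarrow> ('a \<Rightarrow> real) \<Rightarrow> 'a \<Rightarrow> ennreal" where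
  "ext_resolvent M E \<alpha> f = (SOME u. \<exists>fs gs.
      (\<forall>n. fs n \<in> L2 M \<and> (\<forall>x. 0 \<le> fs n x)) \<and>
      (AE x in M. incseq (\<lambda>n. fs n x) \<and> (\<lambda>n. fs n x) \<longlonglongrightarrow> f x) \<and>
      (\<forall>n. is_resolvent M E \<alpha> (fs n) (gs n)) \<and>
      u = (\<lambda>x. SUP n. ennreal (gs n x)))"

text \<open>G f = lim_{\<alpha>\<rightarrow>0+} G_\<alpha> f; since G_\<alpha> f is a.e. decreasing in \<alpha>, we take the
representative sup over \<alpha> = 1/(n+1).\<close>

definition green_op :: "'a measure \<Rightarrow> (('a \<Rightarrow> real) \<Rightarrow> ennreal) \<Rightarrow> ('a \<Rightarrow> real) \<Rightarrow> 'a \<Rightarrow> ennreal" where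
  "green_op M E f = (\<lambda>x. SUP n. ext_resolvent M E (1 / real (Suc n)) f x)"

definition subcritical :: "'a measure \<Rightarrow> (('a \<Rightarrow> real) \<Rightarrow> ennreal) \<Rightarrow> bool" where
  "subcritical M E \<longleftrightarrow> (\<exists>f. f \<in> borel_measurable M \<and> (AE x in M. 0 < f x) \<and>
      (AE x in M. green_op M E f x < \<infinity>))"

definition excessive :: "'a measure \<Rightarrow> (('a \<Rightarrow> real) \<Rightarrow> ennreal) \<Rightarrow> ('a \<Rightarrow> real) \<Rightarrow> bool" where
  "excessive M E h \<longleftrightarrow> h \<in> borel_measurable M \<and> (AE x in M. 0 \<le> h x) \<and>
     (\<forall>\<alpha>>0. AE x in M. ext_resolvent M E \<alpha> (\<lambda>y. \<alpha> * h y) x \<le> ennreal (h x))"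

definition capacity ::
  "'a::topological_space measure \<Rightarrow> (('a \<Rightarrow> real) \<Rightarrow> ennreal) \<Rightarrow> ('a \<Rightarrow> real) \<Rightarrow> 'a set \<Rightarrow> ennreal" where
  "capacity M E h A = Inf {E_ext M E f | f. f \<in> borel_measurable M \<and>
      (\<exists>U. open U \<and> A \<subseteq> U \<and> (AE x in M. x \<in> U \<longrightarrow> h x \<le> f x))}"

definition local_space ::
  "'a::topological_space measure \<Rightarrow> ('a \<Rightarrow> real) set \<Rightarrow> 'a set \<Rightarrow> ('a \<Rightarrow> real) set" where
  "local_space M F G = {f\<in>F. \<exists>U. open U \<and> - G \<subseteq> U \<and> (AE x in M. x \<in> U \<longrightarrow> f x = 0)}"

definition is_nest ::
  "'a::topological_space measure \<Rightarrow> (('a \<Rightarrow> real) \<Rightarrow> ennreal) \<Rightarrow> (nat \<Rightarrow> 'a set) \<Rightarrow> bool" where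
  "is_nest M E F \<longleftrightarrow> (\<forall>n. closed (F n)) \<and> incseq F \<and>
     (\<forall>f\<in>modular_space (E_ext M E). \<forall>\<epsilon>>0. \<exists>n.
        \<exists>g\<in>local_space M (modular_space (E_ext M E)) (F n).
          luxemburg (E_ext M E) (\<lambda>x. f x - g x) < ennreal \<epsilon>)"

definition exceptional ::
  "'a::topological_space measure \<Rightarrow> (('a \<Rightarrow> real) \<Rightarrow> ennreal) \<Rightarrow> 'a set \<Rightarrow> bool" where
  "exceptional M E A \<longleftrightarrow> (\<exists>F. is_nest M E F \<and> A \<subseteq> (\<Inter>n. - F n))"

end

theory Submission
  imports Defs
begin

text \<open>
  Write \<open>\<E>\<^sub>e\<close> for the extended form. It is convex, lower semicontinuous with respect to convergence almost
  everywhere, and submodular: \<open>\<E>\<^sub>e(f \<and> g) + \<E>\<^sub>e(f \<or> g) \<le> \<E>\<^sub>e(f) + \<E>\<^sub>e(g)\<close>. A function \<open>h \<ge> 0\<close> is excessive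
  iff \<open>\<E>\<^sub>e(f \<and> h) \<le> \<E>\<^sub>e(f)\<close> for all \<open>f\<close>, and subcriticality provides \<open>\<phi> > 0\<close> and \<open>C\<close> with
  \<open>\<integral> \<phi> |v| \<le> C + \<E>\<^sub>e(v)\<close>; with the \<open>\<Delta>\<^sub>2\<close>-condition, \<open>\<E>\<^sub>e\<close> vanishes only at \<open>0\<close>.

  If \<open>A\<close> is exceptional and \<open>g\<close> approximates \<open>h\<close> and vanishes near \<open>A\<close>, then \<open>h - g\<close> competes in the
  capacity, which is therefore zero.

  Conversely, solving obstacle problems gives excessive functions \<open>H\<^sub>N \<ge> N h\<close> increasing in \<open>N\<close>. Choose
  \<open>f\<^sub>k \<ge> H\<^sub>k\<close> on open sets \<open>U\<^sub>k \<supseteq> A\<close> with \<open>\<E>\<^sub>e(f\<^sub>k) \<le> 2\<^sup>-\<^sup>k\<close>, and let \<open>F\<^sub>n\<close> be the complement of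
  \<open>\<Union>\<^sub>k\<^sub>\<ge>\<^sub>n U\<^sub>k\<close>. For \<open>0 \<le> g \<le> H\<^sub>N\<close> and \<open>e\<^sub>n = sup\<^sub>k\<^sub>\<ge>\<^sub>n (f\<^sub>k \<and> H\<^sub>N)\<close> the function \<open>g - g \<and> e\<^sub>n\<close>
  vanishes off \<open>F\<^sub>n\<close>, and \<open>\<E>\<^sub>e(g \<and> e\<^sub>n) \<rightarrow> 0\<close>. For general \<open>g \<ge> 0\<close> the truncations \<open>g \<and> H\<^sub>N\<close>
  are bounded in energy, so by reflexivity convex combinations of them converge to \<open>g\<close>.
\<close>

section \<open>Hahn--Banach separation for spaces of functions\<close>

definition fun_subspace :: "('b \<Rightarrow> real) set \<Rightarrow> bool" where
  "fun_subspace V \<longleftrightarrow> (\<lambda>x. 0) \<in> V \<and>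
     (\<forall>f\<in>V. \<forall>g\<in>V. \<forall>a b. (\<lambda>x. a * f x + b * g x) \<in> V)"

definition fun_convex :: "('b \<Rightarrow> real) set \<Rightarrow> bool" where
  "fun_convex K \<longleftrightarrow>
     (\<forall>f\<in>K. \<forall>g\<in>K. \<forall>t. 0 \<le> t \<and> t \<le> 1 \<longrightarrow> (\<lambda>x. t * f x + (1 - t) * g x) \<in> K)"

definition sublinear_on :: "('b \<Rightarrow> real) set \<Rightarrow> (('b \<Rightarrow> real) \<Rightarrow> real) \<Rightarrow> bool" where
  "sublinear_on V p \<longleftrightarrow>
     (\<forall>f\<in>V. \<forall>g\<in>V. p (\<lambda>x. f x + g x) \<le> p f + p g) \<and>
     (\<forall>f\<in>V. \<forall>t\<ge>0. p (\<lambda>x. t * f x) = t * p f)"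

definition linear_fun_on :: "('b \<Rightarrow> real) set \<Rightarrow> (('b \<Rightarrow> real) \<Rightarrow> real) \<Rightarrow> bool" where
  "linear_fun_on V \<phi> \<longleftrightarrow>
     (\<forall>f\<in>V. \<forall>g\<in>V. \<forall>a b. \<phi> (\<lambda>x. a * f x + b * g x) = a * \<phi> f + b * \<phi> g)"

lemma fun_subspace_zero: "fun_subspace V \<Longrightarrow> (\<lambda>x. 0) \<in> V"
  by (simp add: fun_subspace_def)

lemma fun_subspace_lincomb:
  "fun_subspace V \<Longrightarrow> f \<in> V \<Longrightarrow> g \<in> V \<Longrightarrow> (\<lambda>x. a * f x + b * g x) \<in> V"
  by (simp add: fun_subspace_def)

lemma fun_subspace_add: "fun_subspace V \<Longrightarrow> f \<in> V \<Longrightarrow> g \<in> V \<Longrightarrow> (\<lambda>x. f x + g x) \<in> V"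
  using fun_subspace_lincomb[of V f g 1 1] by simp

lemma fun_subspace_diff: "fun_subspace V \<Longrightarrow> f \<in> V \<Longrightarrow> g \<in> V \<Longrightarrow> (\<lambda>x. f x - g x) \<in> V"
  using fun_subspace_lincomb[of V f g 1 "-1"] by simp

lemma fun_subspace_scale: "fun_subspace V \<Longrightarrow> f \<in> V \<Longrightarrow> (\<lambda>x. a * f x) \<in> V"
  using fun_subspace_lincomb[of V f f a 0] by simp

lemma fun_subspace_minus: "fun_subspace V \<Longrightarrow> f \<in> V \<Longrightarrow> (\<lambda>x. - f x) \<in> V"
  using fun_subspace_scale[of V f "-1"] by simp

lemma fun_convexD:
  "fun_convex K \<Longrightarrow> f \<in> K \<Longrightarrow> g \<in> K \<Longrightarrow> 0 \<le> t \<Longrightarrow> t \<le> 1 \<Longrightarrow> (\<lambda>x. t * f x + (1 - t) * g x) \<in> K"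
  by (simp add: fun_convex_def)

lemma fun_convex_hull: "fun_convex (fun_convex hull S)"
  by (rule hull_in) (auto simp: fun_convex_def)

lemma fun_convex_translate:
  assumes "fun_convex K"
  shows "fun_convex ((\<lambda>f x. f x - v x) ` K)"
  unfolding fun_convex_def
proof (intro ballI allI impI)
  fix f g :: "'a \<Rightarrow> real" and t :: real
  assume "f \<in> (\<lambda>f x. f x - v x) ` K" "g \<in> (\<lambda>f x. f x - v x) ` K" and t: "0 \<le> t \<and> t \<le> 1"
  then obtain a b where ab: "a \<in> K" "b \<in> K" and fg: "f = (\<lambda>x. a x - v x)" "g = (\<lambda>x. b x - v x)" by blast
  have "(\<lambda>x. t * f x + (1 - t) * g x) = (\<lambda>x. (t * a x + (1 - t) * b x) - v x)"
    unfolding fg by (auto simp: algebra_simps)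
  then show "(\<lambda>x. t * f x + (1 - t) * g x) \<in> (\<lambda>f x. f x - v x) ` K"
    using fun_convexD[OF assms ab, of t] t by (intro image_eqI) auto
qed

lemma fun_convex_cone_add:
  assumes K: "fun_convex K" and fg: "f \<in> K" "g \<in> K" and ts: "0 \<le> t" "0 \<le> s"
  obtains k where "k \<in> K" "(\<lambda>x. t * f x + s * g x) = (\<lambda>x. (t + s) * k x)"
proof (cases "t + s = 0")
  case True
  then have "t = 0" "s = 0" using ts by auto
  then show ?thesis using that[OF fg(1)] by simp
next
  case False
  then have pos: "t + s > 0" using ts by simp
  let ?k = "\<lambda>x. t / (t + s) * f x + (1 - t / (t + s)) * g x"
  have "1 - t / (t + s) = s / (t + s)" using pos by (simp add: field_simps)
  then have "(\<lambda>x. t * f x + s * g x) = (\<lambda>x. (t + s) * ?k x)" using pos by (simp add: distrib_left)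
  moreover have "?k \<in> K" using pos ts by (intro fun_convexD[OF K fg]) auto
  ultimately show ?thesis by (intro that)
qed

lemma sublinear_on_add:
  "sublinear_on V p \<Longrightarrow> f \<in> V \<Longrightarrow> g \<in> V \<Longrightarrow> p (\<lambda>x. f x + g x) \<le> p f + p g"
  by (simp add: sublinear_on_def)

lemma sublinear_on_scale:
  "sublinear_on V p \<Longrightarrow> f \<in> V \<Longrightarrow> 0 \<le> t \<Longrightarrow> p (\<lambda>x. t * f x) = t * p f"
  by (simp add: sublinear_on_def)

lemma sublinear_on_zero: "sublinear_on V p \<Longrightarrow> (\<lambda>x. 0) \<in> V \<Longrightarrow> p (\<lambda>x. 0) = 0"
  using sublinear_on_scale[of V p "\<lambda>x. 0" 0] by simp

lemma sublinear_on_minus: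
  assumes "fun_subspace V" "sublinear_on V p" "f \<in> V"
  shows "- p (\<lambda>x. - f x) \<le> p f"
  using sublinear_on_add[OF assms(2,3) fun_subspace_minus[OF assms(1,3)]]
    sublinear_on_zero[OF assms(2) fun_subspace_zero[OF assms(1)]] by simp

lemma sublinear_onI:
  assumes V: "fun_subspace V" and zero: "p (\<lambda>x. 0) = 0"
    and add: "\<And>f g. f \<in> V \<Longrightarrow> g \<in> V \<Longrightarrow> p (\<lambda>x. f x + g x) \<le> p f + p g"
    and hom: "\<And>f u. f \<in> V \<Longrightarrow> 0 < u \<Longrightarrow> p (\<lambda>x. u * f x) / u \<le> p f"
  shows "sublinear_on V p"
  unfolding sublinear_on_def
proof (intro conjI ballI allI impI add)
  fix f and u :: real assume f: "f \<in> V" and "0 \<le> u"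
  then consider "u = 0" | "0 < u" by linarith
  then show "p (\<lambda>x. u * f x) = u * p f"
  proof cases
    case 2
    have "p (\<lambda>x. (1 / u) * (u * f x)) / (1 / u) \<le> p (\<lambda>x. u * f x)"
      using 2 by (intro hom fun_subspace_scale[OF V f]) simp
    then show ?thesis using hom[OF f 2] 2 by (simp add: field_simps)
  qed (simp add: zero)
qed

lemma linear_fun_on_lincomb:
  "linear_fun_on V \<phi> \<Longrightarrow> f \<in> V \<Longrightarrow> g \<in> V \<Longrightarrow> \<phi> (\<lambda>x. a * f x + b * g x) = a * \<phi> f + b * \<phi> g"
  by (simp add: linear_fun_on_def)

lemma linear_fun_on_scale: "linear_fun_on V \<phi> \<Longrightarrow> f \<in> V \<Longrightarrow> \<phi> (\<lambda>x. a * f x) = a * \<phi> f"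
  using linear_fun_on_lincomb[of V \<phi> f f a 0] by simp

lemma linear_fun_on_minus: "linear_fun_on V \<phi> \<Longrightarrow> f \<in> V \<Longrightarrow> \<phi> (\<lambda>x. - f x) = - \<phi> f"
  using linear_fun_on_scale[of V \<phi> f "-1"] by simp

lemma linear_fun_on_diff:
  "linear_fun_on V \<phi> \<Longrightarrow> f \<in> V \<Longrightarrow> g \<in> V \<Longrightarrow> \<phi> (\<lambda>x. f x - g x) = \<phi> f - \<phi> g"
  using linear_fun_on_lincomb[of V \<phi> f g 1 "-1"] by simp

lemma le_cINF_add:
  fixes f :: "'b \<Rightarrow> real" and g :: "'c \<Rightarrow> real"
  assumes ne: "A \<noteq> {}" "B \<noteq> {}" and bound: "\<And>x y. x \<in> A \<Longrightarrow> y \<in> B \<Longrightarrow> a \<le> f x + g y"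
  shows "a \<le> (INF x\<in>A. f x) + (INF y\<in>B. g y)"
proof -
  have "a - g y \<le> (INF x\<in>A. f x)" if "y \<in> B" for y
    using bound that by (intro cINF_greatest[OF ne(1)]) (simp add: algebra_simps)
  then have "a - (INF x\<in>A. f x) \<le> (INF y\<in>B. g y)"
    by (intro cINF_greatest[OF ne(2)]) (simp add: algebra_simps)
  then show ?thesis by simp
qed

text \<open>For \<open>K = {f}\<close> and \<open>d = n f\<close> this functional shows that a minimal sublinear functional is odd, for
  general \<open>K\<close> it separates \<open>K\<close> from \<open>0\<close>.\<close>

definition cone_gauge ::
  "(('b \<Rightarrow> real) \<Rightarrow> real) \<Rightarrow> ('b \<Rightarrow> real) set \<Rightarrow> real \<Rightarrow> ('b \<Rightarrow> real) \<Rightarrow> real" where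
  "cone_gauge n K d f = (INF (t, c)\<in>{0..} \<times> K. n (\<lambda>x. f x + t * c x) - t * d)"

context
  fixes V K :: "('b \<Rightarrow> real) set" and n d
  assumes V: "fun_subspace V" and n: "sublinear_on V n" and KV: "K \<subseteq> V" and K_ne: "K \<noteq> {}"
    and K_convex: "fun_convex K" and n_ge: "\<And>f. f \<in> K \<Longrightarrow> d \<le> n f"
begin

lemma cone_gauge_lower_bound:
  assumes f: "f \<in> V" and t: "0 \<le> t" and c: "c \<in> K"
  shows "- n (\<lambda>x. - f x) \<le> n (\<lambda>x. f x + t * c x) - t * d"
proof -
  have cV: "c \<in> V" using c KV by blast
  have "t * d \<le> t * n c" using t n_ge[OF c] by (intro mult_left_mono)
  also have "\<dots> = n (\<lambda>x. (f x + t * c x) + - f x)" using sublinear_on_scale[OF n cV t] by simp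
  also have "\<dots> \<le> n (\<lambda>x. f x + t * c x) + n (\<lambda>x. - f x)"
    by (intro sublinear_on_add[OF n] fun_subspace_add[OF V] fun_subspace_scale[OF V]
        fun_subspace_minus[OF V] f cV)
  finally show ?thesis by simp
qed

lemma cone_gauge_le:
  assumes f: "f \<in> V" and "0 \<le> t" "c \<in> K"
  shows "cone_gauge n K d f \<le> n (\<lambda>x. f x + t * c x) - t * d"
proof -
  have "bdd_below ((\<lambda>(t, c). n (\<lambda>x. f x + t * c x) - t * d) ` ({0..} \<times> K))"
    using cone_gauge_lower_bound[OF f] by (intro bdd_belowI2[where m = "- n (\<lambda>x. - f x)"]) auto
  from cINF_lower[OF this, of "(t, c)"] show ?thesis using assms by (simp add: cone_gauge_def)
qed

lemma cone_gauge_greatest: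
  assumes "\<And>t c. 0 \<le> t \<Longrightarrow> c \<in> K \<Longrightarrow> a \<le> n (\<lambda>x. f x + t * c x) - t * d"
  shows "a \<le> cone_gauge n K d f"
  unfolding cone_gauge_def using K_ne assms by (intro cINF_greatest) auto

lemma cone_gauge_le_self:
  assumes "f \<in> V"
  shows "cone_gauge n K d f \<le> n f"
proof -
  obtain c where "c \<in> K" using K_ne by blast
  from cone_gauge_le[OF assms order_refl this] show ?thesis by simp
qed

lemma cone_gauge_minus_le:
  assumes c: "c \<in> K"
  shows "cone_gauge n K d (\<lambda>x. - c x) \<le> - d"
proof -
  have "(\<lambda>x. - c x) \<in> V" using c KV by (intro fun_subspace_minus[OF V]) blast
  from cone_gauge_le[OF this zero_le_one c] show ?thesis
    using sublinear_on_zero[OF n fun_subspace_zero[OF V]] by simp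
qed

lemma cone_gauge_add:
  assumes f: "f \<in> V" and g: "g \<in> V"
  shows "cone_gauge n K d (\<lambda>x. f x + g x) \<le> cone_gauge n K d f + cone_gauge n K d g"
  unfolding cone_gauge_def[of n K d f] cone_gauge_def[of n K d g]
proof (rule le_cINF_add)
  fix tc se :: "real \<times> ('b \<Rightarrow> real)"
  assume "tc \<in> {0..} \<times> K" "se \<in> {0..} \<times> K"
  then obtain t c s e where tc: "tc = (t, c)" "0 \<le> t" "c \<in> K" and se: "se = (s, e)" "0 \<le> s" "e \<in> K"
    by auto
  have V': "c \<in> V" "e \<in> V" using tc se KV by auto
  obtain k where k: "k \<in> K" "(\<lambda>x. t * c x + s * e x) = (\<lambda>x. (t + s) * k x)"
    by (rule fun_convex_cone_add[OF K_convex tc(3) se(3) tc(2) se(2)])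
  have "cone_gauge n K d (\<lambda>x. f x + g x) \<le> n (\<lambda>x. (f x + g x) + (t + s) * k x) - (t + s) * d"
    using tc se k by (intro cone_gauge_le fun_subspace_add[OF V f g]) auto
  also have "(\<lambda>x. (f x + g x) + (t + s) * k x) = (\<lambda>x. (f x + t * c x) + (g x + s * e x))"
    using fun_cong[OF k(2)] by (simp add: add_ac)
  also have "n \<dots> \<le> n (\<lambda>x. f x + t * c x) + n (\<lambda>x. g x + s * e x)"
    by (intro sublinear_on_add[OF n] fun_subspace_add[OF V] fun_subspace_scale[OF V] f g V')
  finally show "cone_gauge n K d (\<lambda>x. f x + g x)
      \<le> (case tc of (t, c) \<Rightarrow> n (\<lambda>x. f x + t * c x) - t * d)
        + (case se of (t, c) \<Rightarrow> n (\<lambda>x. g x + t * c x) - t * d)"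
    by (simp add: tc(1) se(1) algebra_simps)
qed (use K_ne in auto)

lemma cone_gauge_scale:
  assumes f: "f \<in> V" and u: "0 < u"
  shows "cone_gauge n K d (\<lambda>x. u * f x) / u \<le> cone_gauge n K d f"
proof (rule cone_gauge_greatest)
  fix t :: real and c assume t: "0 \<le> t" and c: "c \<in> K"
  have "c \<in> V" using c KV by blast
  then have mem: "(\<lambda>x. f x + t * c x) \<in> V"
    by (intro fun_subspace_add[OF V] fun_subspace_scale[OF V] f)
  have "cone_gauge n K d (\<lambda>x. u * f x) \<le> n (\<lambda>x. u * f x + (u * t) * c x) - (u * t) * d"
    using u t c by (intro cone_gauge_le fun_subspace_scale[OF V f]) auto
  also have "(\<lambda>x. u * f x + (u * t) * c x) = (\<lambda>x. u * (f x + t * c x))" by (simp add: algebra_simps)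
  also have "n \<dots> = u * n (\<lambda>x. f x + t * c x)" using u by (intro sublinear_on_scale[OF n mem]) simp
  finally show "cone_gauge n K d (\<lambda>x. u * f x) / u \<le> n (\<lambda>x. f x + t * c x) - t * d"
    using u by (simp add: field_simps)
qed

lemma sublinear_on_cone_gauge: "sublinear_on V (cone_gauge n K d)"
proof (rule sublinear_onI[OF V _ cone_gauge_add cone_gauge_scale])
  have n0: "n (\<lambda>x. 0) = 0" and zero: "(\<lambda>x. 0) \<in> V"
    using sublinear_on_zero[OF n] fun_subspace_zero[OF V] by auto
  have "0 \<le> cone_gauge n K d (\<lambda>x. 0)"
    using cone_gauge_lower_bound[OF zero] n0 by (intro cone_gauge_greatest) simp
  then show "cone_gauge n K d (\<lambda>x. 0) = 0" using cone_gauge_le_self[OF zero] n0 by simp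
qed

end

lemma linear_if_minimal_sublinear:
  fixes V :: "('b \<Rightarrow> real) set"
  assumes V: "fun_subspace V" and q: "sublinear_on V q"
    and minimal: "\<And>r. sublinear_on V r \<Longrightarrow> (\<And>f. f \<in> V \<Longrightarrow> r f \<le> q f) \<Longrightarrow>
                    (\<And>f. f \<in> V \<Longrightarrow> r f = q f)"
  shows "linear_fun_on V q"
proof -
  have neg: "q (\<lambda>x. - f x) = - q f" if f: "f \<in> V" for f
  proof -
    have K: "{f} \<subseteq> V" "{f} \<noteq> {}" "fun_convex {f}" using f by (auto simp: fun_convex_def algebra_simps)
    have "cone_gauge q {f} (q f) (\<lambda>x. - f x) = q (\<lambda>x. - f x)"
      by (rule minimal[OF sublinear_on_cone_gauge[OF V q K]
            cone_gauge_le_self[OF V q K] fun_subspace_minus[OF V f]]) auto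
    moreover have "cone_gauge q {f} (q f) (\<lambda>x. - f x) \<le> - q f"
      by (rule cone_gauge_minus_le[OF V q K]) auto
    ultimately show ?thesis using sublinear_on_minus[OF V q f] by simp
  qed
  have add: "q (\<lambda>x. f x + g x) = q f + q g" if f: "f \<in> V" and g: "g \<in> V" for f g
  proof -
    have "q (\<lambda>x. (f x + g x) + - g x) \<le> q (\<lambda>x. f x + g x) + q (\<lambda>x. - g x)"
      by (intro sublinear_on_add[OF q] fun_subspace_add[OF V] fun_subspace_minus[OF V] f g)
    then show ?thesis using neg[OF g] sublinear_on_add[OF q f g] by simp
  qed
  have scale: "q (\<lambda>x. a * f x) = a * q f" if f: "f \<in> V" for a f
  proof (cases "a \<ge> 0")
    case False
    then have "q (\<lambda>x. (- a) * f x) = (- a) * q f" by (intro sublinear_on_scale[OF q f]) simp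
    then show ?thesis using neg[OF fun_subspace_scale[OF V f], of a] by simp
  qed (rule sublinear_on_scale[OF q f])
  show ?thesis
    unfolding linear_fun_on_def using add scale V by (simp add: fun_subspace_scale)
qed

text \<open>Requiring the functionals to vanish off \<open>V\<close> lets Zorn's lemma use the pointwise order.\<close>

definition sublinear_minorants ::
  "('b \<Rightarrow> real) set \<Rightarrow> (('b \<Rightarrow> real) \<Rightarrow> real) \<Rightarrow> (('b \<Rightarrow> real) \<Rightarrow> real) set" where
  "sublinear_minorants V p =
     {q. sublinear_on V q \<and> (\<forall>f\<in>V. q f \<le> p f) \<and> (\<forall>f. f \<notin> V \<longrightarrow> q f = 0)}"

lemma sublinear_minorants_restrict:
  assumes V: "fun_subspace V" and q: "sublinear_on V q" "\<And>f. f \<in> V \<Longrightarrow> q f \<le> p f"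
  shows "(\<lambda>f. if f \<in> V then q f else 0) \<in> sublinear_minorants V p"
  using assms by (auto simp: sublinear_minorants_def sublinear_on_def fun_subspace_add fun_subspace_scale)

context
  fixes V :: "('b \<Rightarrow> real) set" and p and C
  assumes V: "fun_subspace V" and C_ne: "C \<noteq> {}" and C: "C \<subseteq> sublinear_minorants V p"
    and chain: "\<And>q r. q \<in> C \<Longrightarrow> r \<in> C \<Longrightarrow> q \<le> r \<or> r \<le> q"
begin

lemma chain_sublinear_on: "q \<in> C \<Longrightarrow> sublinear_on V q"
  using C by (auto simp: sublinear_minorants_def)

lemma chain_zero_off: "q \<in> C \<Longrightarrow> f \<notin> V \<Longrightarrow> q f = 0"
  using C by (auto simp: sublinear_minorants_def)

lemma INF_chain_lower:
  assumes q: "q \<in> C"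
  shows "(INF q\<in>C. q f) \<le> q f"
proof (rule cINF_lower[OF _ q])
  have "min 0 (- p (\<lambda>x. - f x)) \<le> q f" if "q \<in> C" for q
  proof (cases "f \<in> V")
    case True
    have "q (\<lambda>x. - f x) \<le> p (\<lambda>x. - f x)"
      using C that fun_subspace_minus[OF V True] by (auto simp: sublinear_minorants_def)
    then show ?thesis using sublinear_on_minus[OF V chain_sublinear_on[OF that] True] by simp
  qed (use chain_zero_off[OF that] in simp)
  then show "bdd_below ((\<lambda>q. q f) ` C)" by (auto simp: bdd_below_def)
qed

lemma INF_chain_add:
  assumes f: "f \<in> V" and g: "g \<in> V"
  shows "(INF q\<in>C. q (\<lambda>x. f x + g x)) \<le> (INF q\<in>C. q f) + (INF q\<in>C. q g)"
proof (rule le_cINF_add[OF C_ne C_ne])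
  fix q r assume qr: "q \<in> C" "r \<in> C"
  then obtain s where s: "s \<in> C" "s \<le> q" "s \<le> r" using chain by blast
  have "(INF q\<in>C. q (\<lambda>x. f x + g x)) \<le> s (\<lambda>x. f x + g x)" by (rule INF_chain_lower[OF s(1)])
  also have "\<dots> \<le> s f + s g" by (rule sublinear_on_add[OF chain_sublinear_on[OF s(1)] f g])
  also have "\<dots> \<le> q f + r g" using s by (intro add_mono) (auto simp: le_fun_def)
  finally show "(INF q\<in>C. q (\<lambda>x. f x + g x)) \<le> q f + r g" .
qed

lemma sublinear_on_INF_chain: "sublinear_on V (\<lambda>f. INF q\<in>C. q f)"
proof (rule sublinear_onI[OF V _ INF_chain_add])
  have "(INF q\<in>C. q (\<lambda>x. 0)) = (INF q\<in>C. 0 :: real)"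
    using sublinear_on_zero[OF chain_sublinear_on fun_subspace_zero[OF V]] by (intro INF_cong) auto
  then show "(INF q\<in>C. q (\<lambda>x. 0)) = 0" using C_ne by simp
next
  fix f and u :: real assume f: "f \<in> V" and u: "0 < u"
  show "(INF q\<in>C. q (\<lambda>x. u * f x)) / u \<le> (INF q\<in>C. q f)"
  proof (rule cINF_greatest[OF C_ne])
    fix q assume q: "q \<in> C"
    have "(INF q\<in>C. q (\<lambda>x. u * f x)) \<le> u * q f"
      using INF_chain_lower[OF q, of "\<lambda>x. u * f x"] u
        sublinear_on_scale[OF chain_sublinear_on[OF q] f, of u] by simp
    then show "(INF q\<in>C. q (\<lambda>x. u * f x)) / u \<le> q f" using u by (simp add: field_simps)
  qed
qed

lemma INF_chain_sublinear_minorant: "(\<lambda>f. INF q\<in>C. q f) \<in> sublinear_minorants V p"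
proof -
  obtain q where q: "q \<in> C" using C_ne by blast
  have "(INF q\<in>C. q f) \<le> p f" if "f \<in> V" for f
    using INF_chain_lower[OF q, of f] C q that by (force simp: sublinear_minorants_def)
  moreover have "(INF q\<in>C. q f) = 0" if "f \<notin> V" for f
  proof -
    have "(INF q\<in>C. q f) = (INF q\<in>C. 0)" using chain_zero_off that by (intro INF_cong) auto
    then show ?thesis using C_ne by simp
  qed
  ultimately show ?thesis using sublinear_on_INF_chain by (simp add: sublinear_minorants_def)
qed

end

lemma minimal_sublinear_minorant_exists:
  assumes V: "fun_subspace V" and p: "sublinear_on V p"
  obtains m where "m \<in> sublinear_minorants V p"
    "\<And>q. q \<in> sublinear_minorants V p \<Longrightarrow> q \<le> m \<Longrightarrow> q = m"
proof -
  let ?P = "sublinear_minorants V p"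
  have "\<exists>m\<in>?P. \<forall>q\<in>?P. m \<ge> q \<longrightarrow> q = m"
  proof (rule predicate_Zorn)
    show "partial_order_on ?P (relation_of (\<ge>) ?P)"
      by (rule partial_order_on_relation_ofI) auto
  next
    fix C assume "C \<in> Chains (relation_of (\<ge>) ?P)"
    then have C: "C \<subseteq> ?P" "\<And>q r. q \<in> C \<Longrightarrow> r \<in> C \<Longrightarrow> q \<le> r \<or> r \<le> q"
      by (auto simp: Chains_def relation_of_def)
    show "\<exists>u\<in>?P. \<forall>q\<in>C. q \<ge> u"
    proof (cases "C = {}")
      case True
      then show ?thesis using sublinear_minorants_restrict[OF V p] by blast
    next
      case False
      show ?thesis
        using INF_chain_sublinear_minorant[OF V False C] INF_chain_lower[OF V False C]
        by (intro bexI[of _ "\<lambda>f. INF q\<in>C. q f"]) (auto simp: le_fun_def)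
    qed
  qed
  then show ?thesis using that by blast
qed

theorem hahn_banach_dominated:
  assumes V: "fun_subspace V" and p: "sublinear_on V p"
  obtains \<phi> where "linear_fun_on V \<phi>" "\<And>f. f \<in> V \<Longrightarrow> \<phi> f \<le> p f"
proof -
  obtain m where m: "m \<in> sublinear_minorants V p"
    and minimal: "\<And>q. q \<in> sublinear_minorants V p \<Longrightarrow> q \<le> m \<Longrightarrow> q = m"
    using minimal_sublinear_minorant_exists[OF V p] by blast
  have "linear_fun_on V m"
  proof (rule linear_if_minimal_sublinear[OF V])
    show "sublinear_on V m" using m by (simp add: sublinear_minorants_def)
    fix r f assume r: "sublinear_on V r" and r_le: "\<And>f. f \<in> V \<Longrightarrow> r f \<le> m f" and f: "f \<in> V"
    let ?r = "\<lambda>f. if f \<in> V then r f else 0"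
    have "?r = m"
    proof (rule minimal)
      show "?r \<in> sublinear_minorants V p"
        using m r_le by (intro sublinear_minorants_restrict[OF V r]) (force simp: sublinear_minorants_def)
      show "?r \<le> m" using m r_le by (auto simp: le_fun_def sublinear_minorants_def)
    qed
    from fun_cong[OF this, of f] show "r f = m f" using f by simp
  qed
  then show ?thesis using m by (intro that) (auto simp: sublinear_minorants_def)
qed

theorem hahn_banach_separation:
  fixes V K :: "('b \<Rightarrow> real) set"
  assumes V: "fun_subspace V" and n: "sublinear_on V n"
    and K: "K \<subseteq> V" "K \<noteq> {}" "fun_convex K" and n_ge: "\<And>f. f \<in> K \<Longrightarrow> d \<le> n f"
  obtains \<phi> where "linear_fun_on V \<phi>" "\<And>f. f \<in> V \<Longrightarrow> \<phi> f \<le> n f" "\<And>f. f \<in> K \<Longrightarrow> d \<le> \<phi> f"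
proof -
  obtain \<phi> where lin: "linear_fun_on V \<phi>" and dom: "\<And>f. f \<in> V \<Longrightarrow> \<phi> f \<le> cone_gauge n K d f"
    using hahn_banach_dominated[OF V sublinear_on_cone_gauge[OF V n K n_ge]] by blast
  have "d \<le> \<phi> c" if c: "c \<in> K" for c
  proof -
    have cV: "c \<in> V" using c K(1) by blast
    have "\<phi> (\<lambda>x. - c x) \<le> cone_gauge n K d (\<lambda>x. - c x)" by (rule dom[OF fun_subspace_minus[OF V cV]])
    also have "\<dots> \<le> - d" by (rule cone_gauge_minus_le[OF V n K n_ge c])
    finally show ?thesis using linear_fun_on_minus[OF lin cV] by simp
  qed
  moreover have "\<phi> f \<le> n f" if "f \<in> V" for f
    using dom[OF that] cone_gauge_le_self[OF V n K n_ge that] by linarith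
  ultimately show ?thesis using that[OF lin] by blast
qed

section \<open>Convex modulars\<close>

lemma ennreal_convex_combination_same:
  assumes "0 \<le> t" "t \<le> 1"
  shows "ennreal t * c + ennreal (1 - t) * c = c"
proof -
  have "ennreal t + ennreal (1 - t) = 1" using assms by (simp flip: ennreal_plus)
  then show ?thesis by (simp flip: distrib_right)
qed

lemma compact_sequence_cluster_point:
  fixes f :: "nat \<Rightarrow> 'c::topological_space"
  assumes K: "compact K" and f: "\<And>n. f n \<in> K"
  obtains x where "x \<in> K" "\<And>S. closed S \<Longrightarrow> eventually (\<lambda>n. f n \<in> S) sequentially \<Longrightarrow> x \<in> S"
proof -
  have "filtermap f sequentially \<noteq> bot" by (simp add: filtermap_bot_iff)
  moreover have "eventually (\<lambda>x. x \<in> K) (filtermap f sequentially)"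
    using f by (simp add: eventually_filtermap)
  ultimately obtain x where x: "x \<in> K" and cluster: "inf (nhds x) (filtermap f sequentially) \<noteq> bot"
    using K unfolding compact_filter by blast
  have "x \<in> S" if S: "closed S" "eventually (\<lambda>n. f n \<in> S) sequentially" for S
  proof (rule ccontr)
    assume "x \<notin> S"
    then have "eventually (\<lambda>y. y \<in> - S) (nhds x)" using S(1) by (intro eventually_nhds_in_open) auto
    moreover have "eventually (\<lambda>y. y \<in> S) (filtermap f sequentially)"
      using S(2) by (simp add: eventually_filtermap)
    ultimately have "eventually (\<lambda>y. False) (inf (nhds x) (filtermap f sequentially))"
      unfolding eventually_inf by (metis ComplD)
    then show False using cluster by (simp add: eventually_False)
  qed
  with x show ?thesis by (rule that)
qed

lemma compact_Pi_UNIV: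
  fixes S :: "'b \<Rightarrow> 'c::topological_space set"
  assumes "\<And>i. compact (S i)"
  shows "compact (Pi UNIV S)"
proof -
  have "compactin (product_topology (\<lambda>i. euclidean) UNIV) (PiE UNIV S)"
    unfolding compactin_PiE using assms by simp
  then show ?thesis
    by (simp add: PiE_UNIV_domain flip: compactin_euclidean_iff euclidean_product_topology)
qed

definition lux_norm :: "(('b \<Rightarrow> real) \<Rightarrow> ennreal) \<Rightarrow> ('b \<Rightarrow> real) \<Rightarrow> real" where
  "lux_norm F f = enn2real (luxemburg F f)"

lemma lux_norm_nonneg: "0 \<le> lux_norm F f"
  by (simp add: lux_norm_def)

lemma luxemburg_le: "0 < l \<Longrightarrow> F (\<lambda>x. f x / l) \<le> 1 \<Longrightarrow> luxemburg F f \<le> ennreal l"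
  unfolding luxemburg_def by (rule Inf_lower) auto

lemma lux_norm_le: "0 < l \<Longrightarrow> F (\<lambda>x. f x / l) \<le> 1 \<Longrightarrow> lux_norm F f \<le> l"
  unfolding lux_norm_def using luxemburg_le[of l F f] by (intro enn2real_leI) auto

lemma dual_space_linear: "\<phi> \<in> dual_space F \<Longrightarrow> linear_fun_on (modular_space F) \<phi>"
  by (simp add: dual_space_def linear_fun_on_def)

lemma dual_space_bounded:
  "\<phi> \<in> dual_space F \<Longrightarrow> \<exists>C. \<forall>f\<in>modular_space F. \<bar>\<phi> f\<bar> \<le> C * lux_norm F f"
  unfolding dual_space_def lux_norm_def by blast

lemma dual_space_lincomb:
  assumes \<phi>: "\<phi> \<in> dual_space F" and \<psi>: "\<psi> \<in> dual_space F"
  shows "(\<lambda>f. a * \<phi> f + b * \<psi> f) \<in> dual_space F"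
  unfolding dual_space_def mem_Collect_eq
proof (intro conjI)
  show "\<forall>f\<in>modular_space F. \<forall>g\<in>modular_space F. \<forall>c d.
      a * \<phi> (\<lambda>x. c * f x + d * g x) + b * \<psi> (\<lambda>x. c * f x + d * g x)
        = c * (a * \<phi> f + b * \<psi> f) + d * (a * \<phi> g + b * \<psi> g)"
    using \<phi> \<psi> by (auto simp: dual_space_def algebra_simps)
  obtain C D where C: "\<And>f. f \<in> modular_space F \<Longrightarrow> \<bar>\<phi> f\<bar> \<le> C * lux_norm F f"
    and D: "\<And>f. f \<in> modular_space F \<Longrightarrow> \<bar>\<psi> f\<bar> \<le> D * lux_norm F f"
    using dual_space_bounded[OF \<phi>] dual_space_bounded[OF \<psi>] by metis
  show "\<exists>C. \<forall>f\<in>modular_space F. \<bar>a * \<phi> f + b * \<psi> f\<bar> \<le> C * enn2real (luxemburg F f)"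
  proof (intro exI[of _ "\<bar>a\<bar> * C + \<bar>b\<bar> * D"] ballI)
    fix f assume f: "f \<in> modular_space F"
    have "\<bar>a * \<phi> f + b * \<psi> f\<bar> \<le> \<bar>a\<bar> * \<bar>\<phi> f\<bar> + \<bar>b\<bar> * \<bar>\<psi> f\<bar>"
      using abs_triangle_ineq[of "a * \<phi> f" "b * \<psi> f"] by (simp add: abs_mult)
    also have "\<dots> \<le> \<bar>a\<bar> * (C * lux_norm F f) + \<bar>b\<bar> * (D * lux_norm F f)"
      by (intro add_mono mult_left_mono C D f) auto
    finally show "\<bar>a * \<phi> f + b * \<psi> f\<bar> \<le> (\<bar>a\<bar> * C + \<bar>b\<bar> * D) * enn2real (luxemburg F f)"
      by (simp add: lux_norm_def algebra_simps)
  qed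
  show "\<forall>f. f \<notin> modular_space F \<longrightarrow> a * \<phi> f + b * \<psi> f = 0"
    using \<phi> \<psi> by (auto simp: dual_space_def)
qed

locale convex_modular =
  fixes F :: "('b \<Rightarrow> real) \<Rightarrow> ennreal"
  assumes modular_zero: "F (\<lambda>x. 0) = 0"
    and modular_minus: "F (\<lambda>x. - f x) = F f"
    and modular_convex: "0 \<le> t \<Longrightarrow> t \<le> 1 \<Longrightarrow>
      F (\<lambda>x. t * f x + (1 - t) * g x) \<le> ennreal t * F f + ennreal (1 - t) * F g"
begin

lemma modular_scale_le: "0 \<le> t \<Longrightarrow> t \<le> 1 \<Longrightarrow> F (\<lambda>x. t * f x) \<le> ennreal t * F f"
  using modular_convex[of t f "\<lambda>x. 0"] by (simp add: modular_zero)

lemma modular_scale_abs: "F (\<lambda>x. a * f x) = F (\<lambda>x. \<bar>a\<bar> * f x)"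
  using modular_minus[of "\<lambda>x. a * f x"] by (cases "0 \<le> a") simp_all

lemma modular_add_le: "F (\<lambda>x. f x + g x) \<le> F (\<lambda>x. 2 * f x) + F (\<lambda>x. 2 * g x)"
proof -
  have "F (\<lambda>x. f x + g x) = F (\<lambda>x. (1/2) * (2 * f x) + (1 - 1/2) * (2 * g x))" by simp
  also have "\<dots> \<le> ennreal (1/2) * F (\<lambda>x. 2 * f x) + ennreal (1 - 1/2) * F (\<lambda>x. 2 * g x)"
    by (rule modular_convex) auto
  also have "\<dots> \<le> 1 * F (\<lambda>x. 2 * f x) + 1 * F (\<lambda>x. 2 * g x)"
    by (intro add_mono mult_right_mono) (auto simp: ennreal_le_1 simp del: ennreal_half)
  finally show ?thesis by simp
qed

lemma modular_diff_le: "F (\<lambda>x. f x - g x) \<le> F (\<lambda>x. 2 * (f x - h x)) + F (\<lambda>x. 2 * (g x - h x))"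
proof -
  have "F (\<lambda>x. f x - g x) = F (\<lambda>x. (f x - h x) + (h x - g x))" by simp
  also have "\<dots> \<le> F (\<lambda>x. 2 * (f x - h x)) + F (\<lambda>x. 2 * (h x - g x))" by (rule modular_add_le)
  also have "F (\<lambda>x. 2 * (h x - g x)) = F (\<lambda>x. 2 * (g x - h x))"
    using modular_minus[of "\<lambda>x. 2 * (g x - h x)"] by simp
  finally show ?thesis .
qed

lemma modular_divide_le_1:
  assumes "F f \<le> ennreal l" "1 \<le> l"
  shows "F (\<lambda>x. f x / l) \<le> 1"
proof -
  have "F (\<lambda>x. f x / l) \<le> ennreal (1 / l) * F f"
    using modular_scale_le[of "1 / l" f] assms(2) by simp
  also have "\<dots> \<le> ennreal (1 / l) * ennreal l" by (rule mult_left_mono[OF assms(1)]) simp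
  also have "\<dots> = 1" using assms(2) by (simp flip: ennreal_mult)
  finally show ?thesis .
qed

lemma fun_convex_modular_sublevel: "fun_convex {f. F f \<le> c}"
  unfolding fun_convex_def mem_Collect_eq
proof (intro ballI allI impI)
  fix f g and t :: real assume fg: "f \<in> {f. F f \<le> c}" "g \<in> {f. F f \<le> c}" and t: "0 \<le> t \<and> t \<le> 1"
  have "F (\<lambda>x. t * f x + (1 - t) * g x) \<le> ennreal t * F f + ennreal (1 - t) * F g"
    using t by (intro modular_convex) auto
  also have "\<dots> \<le> ennreal t * c + ennreal (1 - t) * c" using fg by (intro add_mono mult_left_mono) auto
  also have "\<dots> = c" using t by (intro ennreal_convex_combination_same) auto
  finally show "F (\<lambda>x. t * f x + (1 - t) * g x) \<le> c" .
qed

lemma modular_hull_le: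
  assumes "f \<in> fun_convex hull S" "\<And>s. s \<in> S \<Longrightarrow> F s \<le> c"
  shows "F f \<le> c"
  using hull_minimal[of S "{f. F f \<le> c}" fun_convex] fun_convex_modular_sublevel assms by auto

lemma modular_spaceI:
  assumes "F f < \<infinity>"
  shows "f \<in> modular_space F"
proof -
  obtain c where c: "F f = ennreal c" "0 \<le> c" using assms by (cases "F f") auto
  have "((\<lambda>t::real. F (\<lambda>x. t * f x)) \<longlongrightarrow> 0) (at_right 0)"
  proof (rule tendsto_sandwich[of "\<lambda>t. 0" _ _ "\<lambda>t. ennreal (t * c)"])
    show "eventually (\<lambda>t. F (\<lambda>x. t * f x) \<le> ennreal (t * c)) (at_right 0)"
      using eventually_at_right_real[OF zero_less_one]
    proof eventually_elim
      case (elim t)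
      then show ?case using modular_scale_le[of t f] c by (simp add: ennreal_mult)
    qed
    have "((\<lambda>t. ennreal (t * c)) \<longlongrightarrow> ennreal (0 * c)) (at_right 0)" by (intro tendsto_intros)
    then show "((\<lambda>t. ennreal (t * c)) \<longlongrightarrow> 0) (at_right 0)" by simp
  qed auto
  then show ?thesis by (simp add: modular_space_def)
qed

lemma modular_scale_tendsto:
  assumes f: "f \<in> modular_space F"
  shows "((\<lambda>t. F (\<lambda>x. (a * t) * f x)) \<longlongrightarrow> 0) (at_right 0)"
proof (cases "a = 0")
  case False
  have "((\<lambda>t. F (\<lambda>x. (\<bar>a\<bar> * t) * f x)) \<longlongrightarrow> 0) (at_right 0)"
  proof (rule filterlim_compose[of "\<lambda>t. F (\<lambda>x. t * f x)"])
    show "((\<lambda>t. F (\<lambda>x. t * f x)) \<longlongrightarrow> 0) (at_right 0)" using f by (simp add: modular_space_def)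
    show "filterlim (\<lambda>t. \<bar>a\<bar> * t) (at_right 0) (at_right 0)"
      using False by (intro filterlim_times_pos[OF filterlim_ident]) auto
  qed
  moreover have "eventually (\<lambda>t. F (\<lambda>x. (\<bar>a\<bar> * t) * f x) = F (\<lambda>x. (a * t) * f x)) (at_right 0)"
    using eventually_at_right_less[of 0]
    by eventually_elim (simp add: modular_scale_abs[of "a * _"] abs_mult)
  ultimately show ?thesis by (rule Lim_transform_eventually)
qed (simp add: modular_zero)

lemma modular_space_subspace: "fun_subspace (modular_space F)"
  unfolding fun_subspace_def
proof (intro conjI ballI allI)
  show "(\<lambda>x. 0) \<in> modular_space F" by (intro modular_spaceI) (simp add: modular_zero)
  fix f g a b assume f: "f \<in> modular_space F" and g: "g \<in> modular_space F"
  have "((\<lambda>t. F (\<lambda>x. t * (a * f x + b * g x))) \<longlongrightarrow> 0) (at_right 0)"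
  proof (rule tendsto_sandwich[of "\<lambda>t. 0"])
    have "F (\<lambda>x. t * (a * f x + b * g x))
        \<le> F (\<lambda>x. ((2 * a) * t) * f x) + F (\<lambda>x. ((2 * b) * t) * g x)" for t
      using modular_add_le[of "\<lambda>x. t * (a * f x)" "\<lambda>x. t * (b * g x)"] by (simp add: algebra_simps)
    then show "eventually (\<lambda>t. F (\<lambda>x. t * (a * f x + b * g x))
        \<le> F (\<lambda>x. ((2 * a) * t) * f x) + F (\<lambda>x. ((2 * b) * t) * g x)) (at_right 0)" by simp
    show "((\<lambda>t. F (\<lambda>x. ((2 * a) * t) * f x) + F (\<lambda>x. ((2 * b) * t) * g x)) \<longlongrightarrow> 0) (at_right 0)"
      using tendsto_add[OF modular_scale_tendsto[OF f] modular_scale_tendsto[OF g]] by simp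
  qed auto
  then show "(\<lambda>x. a * f x + b * g x) \<in> modular_space F" by (simp add: modular_space_def)
qed

lemma luxemburg_finite:
  assumes "f \<in> modular_space F"
  shows "luxemburg F f < \<infinity>"
proof -
  have "eventually (\<lambda>t::real. F (\<lambda>x. t * f x) < 1) (at_right 0)"
    using assms unfolding modular_space_def mem_Collect_eq by (rule order_tendstoD) simp
  then obtain b :: real where b: "b > 0" "\<And>t. 0 < t \<Longrightarrow> t < b \<Longrightarrow> F (\<lambda>x. t * f x) < 1"
    unfolding eventually_at_right_field by auto
  have "luxemburg F f \<le> ennreal (2 / b)"
  proof (rule luxemburg_le[where F = F])
    show "F (\<lambda>x. f x / (2 / b)) \<le> 1" using b(2)[of "b / 2"] b(1) by (simp add: mult.commute)
  qed (use b(1) in simp)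
  then show ?thesis by (rule le_less_trans) simp
qed

lemma luxemburg_eq_lux_norm: "f \<in> modular_space F \<Longrightarrow> luxemburg F f = ennreal (lux_norm F f)"
  using luxemburg_finite by (simp add: lux_norm_def)

lemma modular_le_1_if_luxemburg_less:
  assumes "luxemburg F f < ennreal l"
  shows "F (\<lambda>x. f x / l) \<le> 1"
proof -
  obtain k where k: "0 < k" "F (\<lambda>x. f x / k) \<le> 1" "ennreal k < ennreal l"
    using assms unfolding luxemburg_def Inf_less_iff by auto
  then have kl: "k < l" by (simp add: ennreal_less_iff)
  have "F (\<lambda>x. f x / l) = F (\<lambda>x. (k / l) * (f x / k))" using k kl by simp
  also have "\<dots> \<le> ennreal (k / l) * F (\<lambda>x. f x / k)" using k kl by (intro modular_scale_le) auto
  also have "\<dots> \<le> 1 * 1" using k kl by (intro mult_mono) (auto simp: ennreal_le_1)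
  finally show ?thesis by simp
qed

lemma modular_le_if_luxemburg_less:
  assumes less: "luxemburg F f < ennreal l" and "l \<le> 1"
  shows "F f \<le> ennreal l"
proof -
  have "0 < ennreal l" using less by (rule le_less_trans[OF zero_le])
  then have l: "0 < l" by (simp add: ennreal_less_zero_iff)
  have "F (\<lambda>x. l * (f x / l)) \<le> ennreal l * F (\<lambda>x. f x / l)"
    using l assms(2) by (intro modular_scale_le) auto
  also have "\<dots> \<le> ennreal l * 1" by (intro mult_left_mono modular_le_1_if_luxemburg_less[OF less]) simp
  finally show ?thesis using l by simp
qed

lemma modular_le_1_if_lux_norm_less:
  assumes f: "f \<in> modular_space F" and l: "lux_norm F f < l"
  shows "F (\<lambda>x. f x / l) \<le> 1"
  using luxemburg_eq_lux_norm[OF f] l le_less_trans[OF lux_norm_nonneg l]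
  by (intro modular_le_1_if_luxemburg_less) (simp add: ennreal_less_iff lux_norm_nonneg)

lemma lux_norm_add:
  assumes f: "f \<in> modular_space F" and g: "g \<in> modular_space F"
  shows "lux_norm F (\<lambda>x. f x + g x) \<le> lux_norm F f + lux_norm F g"
proof (rule field_le_epsilon)
  fix e :: real assume e: "0 < e"
  define l k where "l = lux_norm F f + e / 2" and "k = lux_norm F g + e / 2"
  have pos: "0 < l" "0 < k" using e lux_norm_nonneg[of F] by (simp_all add: l_def k_def add_nonneg_pos)
  have "1 - l / (l + k) = k / (l + k)" using pos by (simp add: field_simps)
  then have "F (\<lambda>x. (f x + g x) / (l + k))
      = F (\<lambda>x. (l / (l + k)) * (f x / l) + (1 - l / (l + k)) * (g x / k))"
    using pos by (simp add: add_divide_distrib)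
  also have "\<dots> \<le> ennreal (l / (l + k)) * F (\<lambda>x. f x / l) + ennreal (1 - l / (l + k)) * F (\<lambda>x. g x / k)"
    using pos by (intro modular_convex) auto
  also have "\<dots> \<le> ennreal (l / (l + k)) * 1 + ennreal (1 - l / (l + k)) * 1"
    using e by (intro add_mono mult_left_mono modular_le_1_if_lux_norm_less f g) (auto simp: l_def k_def)
  also have "\<dots> = 1" using pos by (intro ennreal_convex_combination_same) auto
  finally have "lux_norm F (\<lambda>x. f x + g x) \<le> l + k" using pos by (intro lux_norm_le) auto
  then show "lux_norm F (\<lambda>x. f x + g x) \<le> lux_norm F f + lux_norm F g + e" by (simp add: l_def k_def)
qed

lemma lux_norm_sublinear: "sublinear_on (modular_space F) (lux_norm F)"
proof (rule sublinear_onI[OF modular_space_subspace _ lux_norm_add])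
  have "lux_norm F (\<lambda>x. 0) \<le> 0" by (rule dense_ge, rule lux_norm_le) (simp_all add: modular_zero)
  then show "lux_norm F (\<lambda>x. 0) = 0" using lux_norm_nonneg[of F "\<lambda>x. 0"] by simp
next
  fix f and u :: real assume f: "f \<in> modular_space F" and u: "0 < u"
  show "lux_norm F (\<lambda>x. u * f x) / u \<le> lux_norm F f"
  proof (rule dense_ge)
    fix l assume l: "lux_norm F f < l"
    have "0 < l" using lux_norm_nonneg l by (rule le_less_trans)
    then have "lux_norm F (\<lambda>x. u * f x) \<le> u * l"
      using u modular_le_1_if_lux_norm_less[OF f l] by (intro lux_norm_le) auto
    then show "lux_norm F (\<lambda>x. u * f x) / u \<le> l" using u by (simp add: field_simps)
  qed
qed

lemma lux_norm_minus: "lux_norm F (\<lambda>x. - f x) = lux_norm F f"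
proof -
  have "F (\<lambda>x. - f x / l) = F (\<lambda>x. f x / l)" for l using modular_minus[of "\<lambda>x. f x / l"] by simp
  then show ?thesis by (simp add: lux_norm_def luxemburg_def)
qed

lemma lux_norm_le_1_iff: "f \<in> modular_space F \<Longrightarrow> luxemburg F f \<le> 1 \<longleftrightarrow> lux_norm F f \<le> 1"
  by (simp add: luxemburg_eq_lux_norm ennreal_le_1)

lemma dual_space_restrictI:
  assumes lin: "linear_fun_on (modular_space F) \<phi>"
    and phi_le: "\<And>f. f \<in> modular_space F \<Longrightarrow> \<phi> f \<le> lux_norm F f"
  shows "(\<lambda>f. if f \<in> modular_space F then \<phi> f else 0) \<in> dual_space F" (is "?\<phi> \<in> _")
    and "dual_norm F (\<lambda>f. if f \<in> modular_space F then \<phi> f else 0) \<le> 1"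
proof -
  note V = modular_space_subspace
  have abs: "\<bar>\<phi> f\<bar> \<le> lux_norm F f" if f: "f \<in> modular_space F" for f
    using phi_le[OF f] phi_le[OF fun_subspace_minus[OF V f]] linear_fun_on_minus[OF lin f]
    by (simp add: lux_norm_minus abs_le_iff)
  show "?\<phi> \<in> dual_space F"
    unfolding dual_space_def mem_Collect_eq
  proof (intro conjI)
    show "\<forall>f\<in>modular_space F. \<forall>g\<in>modular_space F. \<forall>a b.
        ?\<phi> (\<lambda>x. a * f x + b * g x) = a * ?\<phi> f + b * ?\<phi> g"
      using lin fun_subspace_lincomb[OF V] by (simp add: linear_fun_on_def)
    show "\<exists>C. \<forall>f\<in>modular_space F. \<bar>?\<phi> f\<bar> \<le> C * enn2real (luxemburg F f)"
      using abs by (intro exI[of _ 1]) (simp add: lux_norm_def)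
  qed simp
  show "dual_norm F ?\<phi> \<le> 1"
    unfolding dual_norm_def
  proof (rule cSup_least)
    have "luxemburg F (\<lambda>x. 0) \<le> 1" using luxemburg_le[of 1 F "\<lambda>x. 0"] by (simp add: modular_zero)
    then show "{\<bar>?\<phi> f\<bar> | f. f \<in> modular_space F \<and> luxemburg F f \<le> 1} \<noteq> {}"
      using fun_subspace_zero[OF V] by blast
    show "y \<le> 1" if "y \<in> {\<bar>?\<phi> f\<bar> | f. f \<in> modular_space F \<and> luxemburg F f \<le> 1}" for y
      using that abs lux_norm_le_1_iff by (force intro: order_trans)
  qed
qed

lemma abs_dual_le_dual_norm:
  assumes \<phi>: "\<phi> \<in> dual_space F" and f: "f \<in> modular_space F" "luxemburg F f \<le> 1"
  shows "\<bar>\<phi> f\<bar> \<le> dual_norm F \<phi>"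
  unfolding dual_norm_def
proof (rule cSup_upper)
  obtain C where C: "\<And>f. f \<in> modular_space F \<Longrightarrow> \<bar>\<phi> f\<bar> \<le> C * lux_norm F f"
    using dual_space_bounded[OF \<phi>] by blast
  show "bdd_above {\<bar>\<phi> f\<bar> | f. f \<in> modular_space F \<and> luxemburg F f \<le> 1}"
  proof (rule bdd_aboveI)
    fix y assume "y \<in> {\<bar>\<phi> f\<bar> | f. f \<in> modular_space F \<and> luxemburg F f \<le> 1}"
    then obtain g where g: "g \<in> modular_space F" "lux_norm F g \<le> 1" "y = \<bar>\<phi> g\<bar>"
      using lux_norm_le_1_iff by auto
    have "y \<le> C * lux_norm F g" using C g by simp
    also have "\<dots> \<le> \<bar>C\<bar> * 1" using g(2) lux_norm_nonneg[of F g] by (intro mult_mono) auto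
    finally show "y \<le> \<bar>C\<bar>" by simp
  qed
qed (use f in blast)

lemma abs_dual_le_if_modular_le:
  assumes \<phi>: "\<phi> \<in> dual_space F" and u: "F u \<le> ennreal c"
  shows "\<bar>\<phi> u\<bar> \<le> max 1 c * dual_norm F \<phi>"
proof -
  define l where "l = max 1 c"
  have l: "1 \<le> l" by (simp add: l_def)
  have uV: "u \<in> modular_space F" using u by (intro modular_spaceI) (simp add: le_less_trans)
  have v: "(\<lambda>x. (1 / l) * u x) \<in> modular_space F"
    by (rule fun_subspace_scale[OF modular_space_subspace uV])
  have "F u \<le> ennreal l" using u by (rule order_trans) (simp add: l_def ennreal_leI)
  then have "F (\<lambda>x. (1 / l) * u x) \<le> 1" using modular_divide_le_1[of u l] l by simp
  then have "luxemburg F (\<lambda>x. (1 / l) * u x) \<le> 1" using luxemburg_le[of 1 F "\<lambda>x. (1 / l) * u x"] by simp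
  from abs_dual_le_dual_norm[OF \<phi> v this] have "\<bar>(1 / l) * \<phi> u\<bar> \<le> dual_norm F \<phi>"
    unfolding linear_fun_on_scale[OF dual_space_linear[OF \<phi>] uV] .
  then show ?thesis using l by (simp add: l_def[symmetric] abs_mult pos_divide_le_eq mult.commute)
qed

text \<open>The Banach--Alaoglu argument: Tychonoff's theorem applied to the evaluations at \<open>u\<^sub>n\<close>.\<close>

lemma bidual_cluster_point:
  fixes u :: "nat \<Rightarrow> 'b \<Rightarrow> real"
  assumes u: "\<And>n. F (u n) \<le> ennreal c"
  obtains \<Phi> where "\<Phi> \<in> bidual_space F"
    "\<And>\<phi> b. \<phi> \<in> dual_space F \<Longrightarrow> eventually (\<lambda>n. b \<le> \<phi> (u n)) sequentially \<Longrightarrow> b \<le> \<Phi> \<phi>"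
proof -
  define r where "r \<phi> = (if \<phi> \<in> dual_space F then max 1 c * dual_norm F \<phi> else 0)" for \<phi>
  define eval where "eval n \<phi> = (if \<phi> \<in> dual_space F then \<phi> (u n) else 0)" for n \<phi>
  let ?K = "Pi UNIV (\<lambda>\<phi>. {- r \<phi>..r \<phi>})"
  have eval: "eval n \<in> ?K" for n
    using abs_dual_le_if_modular_le[OF _ u] by (auto simp: eval_def r_def abs_le_iff minus_le_iff)
  have compact: "compact ?K" by (rule compact_Pi_UNIV) simp
  obtain \<Phi> where \<Phi>: "\<Phi> \<in> ?K"
    and in_closed: "\<And>S. closed S \<Longrightarrow> eventually (\<lambda>n. eval n \<in> S) sequentially \<Longrightarrow> \<Phi> \<in> S"
    by (rule compact_sequence_cluster_point[of ?K eval, OF compact eval], rule that)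
  have "\<Phi> \<in> bidual_space F"
    unfolding bidual_space_def mem_Collect_eq
  proof (intro conjI ballI allI impI)
    fix \<phi> \<psi> and a b :: real assume \<phi>: "\<phi> \<in> dual_space F" and \<psi>: "\<psi> \<in> dual_space F"
    have "\<Phi> \<in> {\<Psi>. \<Psi> (\<lambda>f. a * \<phi> f + b * \<psi> f) = a * \<Psi> \<phi> + b * \<Psi> \<psi>}"
    proof (rule in_closed)
      show "closed {\<Psi>. \<Psi> (\<lambda>f. a * \<phi> f + b * \<psi> f) = a * \<Psi> \<phi> + b * \<Psi> \<psi>}"
        by (intro closed_Collect_eq continuous_intros continuous_on_product_coordinates)
    qed (simp add: eval_def dual_space_lincomb \<phi> \<psi>)
    then show "\<Phi> (\<lambda>f. a * \<phi> f + b * \<psi> f) = a * \<Phi> \<phi> + b * \<Phi> \<psi>" by simp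
  next
    show "\<exists>C. \<forall>\<phi>\<in>dual_space F. \<bar>\<Phi> \<phi>\<bar> \<le> C * dual_norm F \<phi>"
      using \<Phi>
        by (intro exI[of _ "max 1 c"]) (auto simp: r_def abs_le_iff Pi_iff minus_le_iff split: if_splits)
    show "\<Phi> \<phi> = 0" if "\<phi> \<notin> dual_space F" for \<phi>
      using \<Phi> that by (auto simp: r_def Pi_iff dest!: spec[of _ \<phi>])
  qed
  moreover have "b \<le> \<Phi> \<phi>" if "\<phi> \<in> dual_space F" "eventually (\<lambda>n. b \<le> \<phi> (u n)) sequentially" for \<phi> b
  proof -
    have "\<Phi> \<in> {\<Psi>. b \<le> \<Psi> \<phi>}"
    proof (rule in_closed)
      show "closed {\<Psi>. b \<le> \<Psi> \<phi>}"
        by (intro closed_Collect_le continuous_intros continuous_on_product_coordinates)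
    qed (use that in \<open>simp add: eval_def\<close>)
    then show ?thesis by simp
  qed
  ultimately show ?thesis by (rule that)
qed

lemma hull_subset_modular_space:
  assumes "\<And>s. s \<in> S \<Longrightarrow> F s \<le> ennreal c"
  shows "fun_convex hull S \<subseteq> modular_space F"
proof
  fix f assume "f \<in> fun_convex hull S"
  then have "F f \<le> ennreal c" using assms by (rule modular_hull_le)
  then have "F f < \<infinity>" by (rule le_less_trans) simp
  then show "f \<in> modular_space F" by (rule modular_spaceI)
qed

lemma dual_separation:
  assumes K: "K \<subseteq> modular_space F" "K \<noteq> {}" "fun_convex K" and v: "v \<in> modular_space F"
    and far: "\<And>f. f \<in> K \<Longrightarrow> d \<le> lux_norm F (\<lambda>x. f x - v x)"
  obtains \<phi> where "\<phi> \<in> dual_space F" "dual_norm F \<phi> \<le> 1" "\<And>f. f \<in> K \<Longrightarrow> \<phi> v + d \<le> \<phi> f"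
proof -
  note V = modular_space_subspace
  let ?K = "(\<lambda>f x. f x - v x) ` K"
  have sub: "?K \<subseteq> modular_space F" using K(1) v fun_subspace_diff[OF V] by blast
  have ne: "?K \<noteq> {}" using K(2) by blast
  obtain \<phi> where lin: "linear_fun_on (modular_space F) \<phi>"
    and dom: "\<And>f. f \<in> modular_space F \<Longrightarrow> \<phi> f \<le> lux_norm F f" and sep: "\<And>f. f \<in> ?K \<Longrightarrow> d \<le> \<phi> f"
    using hahn_banach_separation[OF V lux_norm_sublinear sub ne fun_convex_translate[OF K(3)]] far
      by blast
  let ?\<phi> = "\<lambda>f. if f \<in> modular_space F then \<phi> f else 0"
  have "?\<phi> v + d \<le> ?\<phi> f" if f: "f \<in> K" for f
  proof -
    have fV: "f \<in> modular_space F" using f K(1) by blast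
    then show ?thesis using sep[of "\<lambda>x. f x - v x"] f v by (simp add: linear_fun_on_diff[OF lin fV v])
  qed
  then show ?thesis using dual_space_restrictI[OF lin dom] that[of ?\<phi>] by blast
qed

lemma reflexive_hull_approx:
  fixes u :: "nat \<Rightarrow> 'b \<Rightarrow> real"
  assumes refl: "reflexive_form F" and u: "\<And>n. F (u n) \<le> ennreal c" and \<epsilon>: "0 < \<epsilon>"
  obtains v g where "v \<in> modular_space F" "\<And>j. g j \<in> fun_convex hull (u ` {j..})"
    "\<And>j. lux_norm F (\<lambda>x. g j x - v x) < \<epsilon>"
proof -
  obtain \<Phi> where \<Phi>: "\<Phi> \<in> bidual_space F"
    and cluster: "\<And>\<phi> b. \<phi> \<in> dual_space F \<Longrightarrow> eventually (\<lambda>n. b \<le> \<phi> (u n)) sequentially \<Longrightarrow> b \<le> \<Phi> \<phi>"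
    by (rule bidual_cluster_point[of u c, OF u], rule that)
  obtain v where v: "v \<in> modular_space F"
    and near: "\<And>\<phi>. \<phi> \<in> dual_space F \<Longrightarrow> \<bar>\<Phi> \<phi> - \<phi> v\<bar> \<le> \<epsilon> / 2 * dual_norm F \<phi>"
    using refl \<Phi> \<epsilon> unfolding reflexive_form_def by (meson half_gt_zero)
  have "\<exists>g. g \<in> fun_convex hull (u ` {j..}) \<and> lux_norm F (\<lambda>x. g x - v x) < \<epsilon>" for j
  proof (rule ccontr)
    let ?K = "fun_convex hull (u ` {j..})"
    assume "\<not> ?thesis"
    then have far: "\<epsilon> \<le> lux_norm F (\<lambda>x. g x - v x)" if "g \<in> ?K" for g using that not_less by blast
    have uK: "u n \<in> ?K" if "j \<le> n" for n using that by (intro hull_inc) auto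
    have KV: "?K \<subseteq> modular_space F" using u by (intro hull_subset_modular_space[of _ c]) auto
    have ne: "?K \<noteq> {}" using uK by blast
    obtain \<phi> where \<phi>: "\<phi> \<in> dual_space F" "dual_norm F \<phi> \<le> 1"
      and sep: "\<And>f. f \<in> ?K \<Longrightarrow> \<phi> v + \<epsilon> \<le> \<phi> f"
      using dual_separation[OF KV ne fun_convex_hull v far] by blast
    have "\<phi> v + \<epsilon> \<le> \<Phi> \<phi>"
      by (intro cluster[OF \<phi>(1)] eventually_sequentiallyI[of j] sep uK)
    moreover have "\<bar>\<Phi> \<phi> - \<phi> v\<bar> \<le> \<epsilon> / 2 * 1"
      using \<epsilon> by (intro order_trans[OF near[OF \<phi>(1)] mult_left_mono[OF \<phi>(2)]]) simp
    ultimately show False using \<epsilon> by (simp add: abs_le_iff)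
  qed
  then obtain g where "\<And>j. g j \<in> fun_convex hull (u ` {j..})" "\<And>j. lux_norm F (\<lambda>x. g j x - v x) < \<epsilon>"
    by metis
  with v show ?thesis by (rule that)
qed

end

locale doubling_modular = convex_modular +
  assumes doubling: "delta2_condition F"
begin

lemma modular_scale_bound:
  obtains B where "0 \<le> B" "\<And>f. F (\<lambda>x. a * f x) \<le> ennreal B * F f"
proof -
  obtain K where K: "\<And>f. F (\<lambda>x. 2 * f x) \<le> ennreal K * F f"
    using doubling by (auto simp: delta2_condition_def)
  have pow: "F (\<lambda>x. 2 ^ m * f x) \<le> ennreal K ^ m * F f" for m f
  proof (induction m arbitrary: f)
    case (Suc m)
    have "F (\<lambda>x. 2 ^ Suc m * f x) = F (\<lambda>x. 2 ^ m * (2 * f x))" by (simp add: mult.assoc mult.left_commute)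
    also have "\<dots> \<le> ennreal K ^ m * F (\<lambda>x. 2 * f x)" by (rule Suc.IH)
    also have "\<dots> \<le> ennreal K ^ m * (ennreal K * F f)" by (rule mult_left_mono[OF K]) simp
    finally show ?case by (simp add: ac_simps)
  qed simp
  obtain m :: nat where m: "\<bar>a\<bar> < 2 ^ m" using real_arch_pow[of 2 "\<bar>a\<bar>"] by auto
  have "F (\<lambda>x. a * f x) \<le> ennreal (enn2real (ennreal K ^ m)) * F f" for f
  proof -
    have "F (\<lambda>x. a * f x) = F (\<lambda>x. (\<bar>a\<bar> / 2 ^ m) * (2 ^ m * f x))" by (simp add: modular_scale_abs[of a])
    also have "\<dots> \<le> ennreal (\<bar>a\<bar> / 2 ^ m) * F (\<lambda>x. 2 ^ m * f x)" using m by (intro modular_scale_le) auto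
    also have "\<dots> \<le> 1 * (ennreal K ^ m * F f)" using m by (intro mult_mono pow) (auto simp: ennreal_le_1)
    also have "ennreal K ^ m = ennreal (enn2real (ennreal K ^ m))"
      by (simp add: less_top power_less_top_ennreal)
    finally show ?thesis by simp
  qed
  then show ?thesis by (intro that[of "enn2real (ennreal K ^ m)"]) auto
qed

lemma modular_space_eq: "modular_space F = {f. F f < \<infinity>}"
proof (intro set_eqI iffI CollectI)
  fix f assume f: "f \<in> modular_space F"
  define l where "l = lux_norm F f + 1"
  have l: "0 < l" using lux_norm_nonneg[of F f] by (simp add: l_def)
  obtain B where B: "\<And>f. F (\<lambda>x. l * f x) \<le> ennreal B * F f" using modular_scale_bound[of l] by blast
  have "F f = F (\<lambda>x. l * (f x / l))" using l by simp
  also have "\<dots> \<le> ennreal B * F (\<lambda>x. f x / l)" by (rule B)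
  also have "\<dots> \<le> ennreal B * 1"
    by (intro mult_left_mono modular_le_1_if_lux_norm_less[OF f]) (simp_all add: l_def)
  also have "\<dots> < \<infinity>" by simp
  finally show "F f < \<infinity>" .
qed (simp add: modular_spaceI)

lemma modular_scale_finite: "F f < \<infinity> \<Longrightarrow> F (\<lambda>x. a * f x) < \<infinity>"
  using fun_subspace_scale[OF modular_space_subspace] by (simp add: modular_space_eq)

lemma modular_lincomb_bound:
  obtains D where "0 \<le> D" "\<And>f g. F (\<lambda>x. a * f x + b * g x) \<le> ennreal D * (F f + F g)"
proof -
  obtain A where A: "0 \<le> A" "\<And>f. F (\<lambda>x. (2 * a) * f x) \<le> ennreal A * F f"
    using modular_scale_bound[of "2 * a"] by blast
  obtain B where B: "0 \<le> B" "\<And>f. F (\<lambda>x. (2 * b) * f x) \<le> ennreal B * F f"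
    using modular_scale_bound[of "2 * b"] by blast
  have "F (\<lambda>x. a * f x + b * g x) \<le> ennreal (A + B) * (F f + F g)" for f g
  proof -
    have "F (\<lambda>x. a * f x + b * g x) \<le> F (\<lambda>x. (2 * a) * f x) + F (\<lambda>x. (2 * b) * g x)"
      using modular_add_le[of "\<lambda>x. a * f x" "\<lambda>x. b * g x"] by (simp add: mult.assoc)
    also have "\<dots> \<le> ennreal (A + B) * F f + ennreal (A + B) * F g"
      using A(1) B(1)
      by (intro add_mono order_trans[OF A(2)] order_trans[OF B(2)] mult_right_mono ennreal_leI) auto
    finally show ?thesis by (simp only: distrib_left)
  qed
  then show ?thesis using A(1) B(1) by (intro that[of "A + B"]) auto
qed

lemma modular_lincomb_small:
  assumes \<delta>: "0 < \<delta>"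
  obtains \<eta> :: real where "0 < \<eta>"
    "\<And>f g. F f \<le> ennreal \<eta> \<Longrightarrow> F g \<le> ennreal \<eta> \<Longrightarrow> F (\<lambda>x. a * f x + b * g x) \<le> ennreal \<delta>"
proof -
  obtain D where D: "0 \<le> D" "\<And>f g. F (\<lambda>x. a * f x + b * g x) \<le> ennreal D * (F f + F g)"
    using modular_lincomb_bound[of a b] by blast
  define \<eta> where "\<eta> = \<delta> / (D + 1) / 2"
  have \<eta>: "0 < \<eta>" using \<delta> D by (simp add: \<eta>_def)
  have "F (\<lambda>x. a * f x + b * g x) \<le> ennreal \<delta>" if "F f \<le> ennreal \<eta>" "F g \<le> ennreal \<eta>" for f g
  proof -
    have "F (\<lambda>x. a * f x + b * g x) \<le> ennreal D * (ennreal \<eta> + ennreal \<eta>)"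
      by (rule order_trans[OF D(2)]) (intro mult_left_mono add_mono that, simp)
    also have "ennreal \<eta> + ennreal \<eta> = ennreal (\<eta> + \<eta>)" using \<eta> by (intro ennreal_plus[symmetric]) auto
    also have "ennreal D * ennreal (\<eta> + \<eta>) = ennreal (D * (\<eta> + \<eta>))"
      using D(1) \<eta> by (intro ennreal_mult[symmetric]) auto
    also have "\<dots> \<le> ennreal \<delta>"
    proof (rule ennreal_leI)
      have "D * (\<eta> + \<eta>) \<le> (D + 1) * (\<eta> + \<eta>)" using \<eta> by (intro mult_right_mono) auto
      then show "D * (\<eta> + \<eta>) \<le> \<delta>" using D(1) by (simp only: \<eta>_def field_sum_of_halves) simp
    qed
    finally show ?thesis .
  qed
  with \<eta> show ?thesis by (rule that)
qed

lemma luxemburg_less_if_modular_small: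
  assumes \<epsilon>: "0 < \<epsilon>"
  obtains \<delta> :: real where "0 < \<delta>" "\<And>f. F f \<le> ennreal \<delta> \<Longrightarrow> luxemburg F f < ennreal \<epsilon>"
proof -
  obtain \<delta> where \<delta>: "0 < \<delta>"
    and small: "\<And>f g. F f \<le> ennreal \<delta> \<Longrightarrow> F g \<le> ennreal \<delta> \<Longrightarrow> F (\<lambda>x. (2 / \<epsilon>) * f x + 0 * g x) \<le> ennreal 1"
    using modular_lincomb_small[OF zero_less_one, of "2 / \<epsilon>" 0] by blast
  have "luxemburg F f < ennreal \<epsilon>" if "F f \<le> ennreal \<delta>" for f
  proof -
    have "luxemburg F f \<le> ennreal (\<epsilon> / 2)"
      using small[OF that that] \<epsilon> by (intro luxemburg_le[where F = F]) (simp_all add: mult.commute)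
    also have "\<dots> < ennreal \<epsilon>" using \<epsilon> by (simp add: ennreal_less_iff)
    finally show ?thesis .
  qed
  with \<delta> show ?thesis by (rule that)
qed

end

locale submodular_modular = convex_modular +
  assumes modular_min_max: "F (\<lambda>x. min (f x) (g x)) + F (\<lambda>x. max (f x) (g x)) \<le> F f + F g"
begin

lemma modular_max_le: "F (\<lambda>x. max (f x) (g x)) \<le> F f + F g"
  by (rule order_trans[OF _ modular_min_max[of f g]]) simp

lemma modular_pos_part_le: "F (\<lambda>x. max (f x) 0) \<le> F f"
  using modular_max_le[of f "\<lambda>x. 0"] by (simp add: modular_zero)

lemma modular_abs_le: "F (\<lambda>x. \<bar>f x\<bar>) \<le> F f"
proof -
  have "(\<lambda>x. max (f x) (- f x)) = (\<lambda>x. \<bar>f x\<bar>)" "(\<lambda>x. min (f x) (- f x)) = (\<lambda>x. - \<bar>f x\<bar>)"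
    by (auto simp: min_def max_def)
  then have "F (\<lambda>x. \<bar>f x\<bar>) + F (\<lambda>x. \<bar>f x\<bar>) \<le> F f + F f"
    using modular_min_max[of f "\<lambda>x. - f x"] by (simp add: modular_minus)
  then have "2 * F (\<lambda>x. \<bar>f x\<bar>) \<le> 2 * F f" by (simp add: mult_2)
  then show ?thesis by (subst (asm) ennreal_mult_le_mult_iff) auto
qed

end

section \<open>Square-integrable functions\<close>

lemma L2D: assumes "f \<in> L2 M" shows "f \<in> borel_measurable M" "integrable M (\<lambda>x. (f x)\<^sup>2)"
  using assms by (auto simp: L2_def)

lemma L2_mult:
  assumes "f \<in> L2 M" "g \<in> L2 M"
  shows "integrable M (\<lambda>x. f x * g x)"
proof (rule Bochner_Integration.integrable_bound)
  note [measurable] = L2D(1)[OF assms(1)] L2D(1)[OF assms(2)]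
  show "integrable M (\<lambda>x. (f x)\<^sup>2 + (g x)\<^sup>2)"
    using L2D(2)[OF assms(1)] L2D(2)[OF assms(2)] by simp
  show "(\<lambda>x. f x * g x) \<in> borel_measurable M" by measurable
  have "\<bar>f x * g x\<bar> \<le> (f x)\<^sup>2 + (g x)\<^sup>2" for x
  proof -
    have "2 * (\<bar>f x\<bar> * \<bar>g x\<bar>) \<le> (f x)\<^sup>2 + (g x)\<^sup>2"
      using sum_squares_bound[of "\<bar>f x\<bar>" "\<bar>g x\<bar>"] by simp
    moreover have "0 \<le> \<bar>f x\<bar> * \<bar>g x\<bar>" by simp
    ultimately show ?thesis unfolding abs_mult by linarith
  qed
  then show "AE x in M. norm (f x * g x) \<le> norm ((f x)\<^sup>2 + (g x)\<^sup>2)" by simp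
qed

lemma L2_dominated:
  assumes g: "g \<in> L2 M" and f: "f \<in> borel_measurable M" and dominated: "AE x in M. \<bar>f x\<bar> \<le> \<bar>g x\<bar>"
  shows "f \<in> L2 M"
proof -
  have "integrable M (\<lambda>x. (f x)\<^sup>2)"
  proof (rule Bochner_Integration.integrable_bound)
    show "integrable M (\<lambda>x. (g x)\<^sup>2)" using g by (rule L2D)
    show "AE x in M. norm ((f x)\<^sup>2) \<le> norm ((g x)\<^sup>2)"
      using dominated by eventually_elim (simp add: abs_le_square_iff)
  qed (use f in measurable)
  then show ?thesis using f by (simp add: L2_def)
qed

lemma L2_lincomb:
  assumes "f \<in> L2 M" "g \<in> L2 M"
  shows "(\<lambda>x. a * f x + b * g x) \<in> L2 M"
proof -
  note [measurable] = L2D(1)[OF assms(1)] L2D(1)[OF assms(2)]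
  have "integrable M (\<lambda>x. a\<^sup>2 * (f x)\<^sup>2 + (2 * a * b) * (f x * g x) + b\<^sup>2 * (g x)\<^sup>2)"
    using L2_mult[OF assms] L2D(2)[OF assms(1)] L2D(2)[OF assms(2)] by simp
  also have "(\<lambda>x. a\<^sup>2 * (f x)\<^sup>2 + (2 * a * b) * (f x * g x) + b\<^sup>2 * (g x)\<^sup>2)
      = (\<lambda>x. (a * f x + b * g x)\<^sup>2)"
    by (auto simp: power2_eq_square algebra_simps)
  finally show ?thesis by (simp add: L2_def)
qed

lemma L2_add: "f \<in> L2 M \<Longrightarrow> g \<in> L2 M \<Longrightarrow> (\<lambda>x. f x + g x) \<in> L2 M"
  using L2_lincomb[of f M g 1 1] by simp

lemma L2_diff: "f \<in> L2 M \<Longrightarrow> g \<in> L2 M \<Longrightarrow> (\<lambda>x. f x - g x) \<in> L2 M"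
  using L2_lincomb[of f M g 1 "-1"] by simp

lemma L2_scale: "f \<in> L2 M \<Longrightarrow> (\<lambda>x. a * f x) \<in> L2 M"
  using L2_lincomb[of f M f a 0] by simp

lemma L2_divide: "f \<in> L2 M \<Longrightarrow> (\<lambda>x. f x / a) \<in> L2 M"
  using L2_scale[of f M "1/a"] by simp

lemma L2_zero: "(\<lambda>x. 0) \<in> L2 M"
  by (simp add: L2_def)

lemma L2_abs: "f \<in> L2 M \<Longrightarrow> (\<lambda>x. \<bar>f x\<bar>) \<in> L2 M"
  by (rule L2_dominated) (auto dest: L2D(1))

lemma min_max_eq_half_sum_abs_diff:
  "min a b = (a + b) / 2 - \<bar>(a - b) / 2\<bar>" "max a b = (a + b) / 2 + \<bar>(a - b) / 2\<bar>" for a b :: real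
  by (auto simp: min_def max_def abs_if field_simps)

lemma L2_min: "f \<in> L2 M \<Longrightarrow> g \<in> L2 M \<Longrightarrow> (\<lambda>x. min (f x) (g x)) \<in> L2 M"
  unfolding min_max_eq_half_sum_abs_diff by (intro L2_add L2_diff L2_divide L2_abs)

lemma L2_max: "f \<in> L2 M \<Longrightarrow> g \<in> L2 M \<Longrightarrow> (\<lambda>x. max (f x) (g x)) \<in> L2 M"
  unfolding min_max_eq_half_sum_abs_diff by (intro L2_add L2_diff L2_divide L2_abs)

lemma L2_min_nonneg:
  assumes "f \<in> L2 M" "h \<in> borel_measurable M" "AE x in M. 0 \<le> h x"
  shows "(\<lambda>x. min (f x) (h x)) \<in> L2 M"
proof (rule L2_dominated[OF assms(1)])
  show "(\<lambda>x. min (f x) (h x)) \<in> borel_measurable M" using L2D(1)[OF assms(1)] assms(2) by measurable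
  show "AE x in M. \<bar>min (f x) (h x)\<bar> \<le> \<bar>f x\<bar>" using assms(3) by eventually_elim auto
qed

lemma integral_add_scaled_sq:
  assumes "p \<in> L2 M" "q \<in> L2 M"
  shows "(\<integral>x. (p x + t * q x)\<^sup>2 \<partial>M)
    = (\<integral>x. (p x)\<^sup>2 \<partial>M) + 2 * t * (\<integral>x. p x * q x \<partial>M) + t\<^sup>2 * (\<integral>x. (q x)\<^sup>2 \<partial>M)"
proof -
  have "(\<lambda>x. (p x + t * q x)\<^sup>2) = (\<lambda>x. (p x)\<^sup>2 + (2 * t) * (p x * q x) + t\<^sup>2 * (q x)\<^sup>2)"
    by (auto simp: power2_eq_square algebra_simps)
  then show ?thesis using L2_mult[OF assms] assms[THEN L2D(2)] by simp
qed

lemma L2_Cauchy_Schwarz: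
  assumes f: "f \<in> L2 M" and g: "g \<in> L2 M"
  shows "(\<integral>x. \<bar>f x * g x\<bar> \<partial>M)\<^sup>2 \<le> (\<integral>x. (f x)\<^sup>2 \<partial>M) * (\<integral>x. (g x)\<^sup>2 \<partial>M)"
proof -
  note [measurable] = L2D(1)[OF f] L2D(1)[OF g]
  have sq: "(\<integral>\<^sup>+x. (ennreal \<bar>h x\<bar>)\<^sup>2 \<partial>M) = ennreal (\<integral>x. (h x)\<^sup>2 \<partial>M)" if "h \<in> L2 M" for h
    using L2D(2)[OF that] by (simp add: ennreal_power nn_integral_eq_integral)
  have "ennreal ((\<integral>x. \<bar>f x * g x\<bar> \<partial>M)\<^sup>2) = (\<integral>\<^sup>+x. ennreal \<bar>f x\<bar> * ennreal \<bar>g x\<bar> \<partial>M)\<^sup>2"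
    using integrable_abs[OF L2_mult[OF f g]]
    by (simp add: nn_integral_eq_integral abs_mult flip: ennreal_mult ennreal_power)
  also have "\<dots> \<le> (\<integral>\<^sup>+x. (ennreal \<bar>f x\<bar>)\<^sup>2 \<partial>M) * (\<integral>\<^sup>+x. (ennreal \<bar>g x\<bar>)\<^sup>2 \<partial>M)"
    by (rule Cauchy_Schwarz_nn_integral) auto
  also have "\<dots> = ennreal ((\<integral>x. (f x)\<^sup>2 \<partial>M) * (\<integral>x. (g x)\<^sup>2 \<partial>M))" by (simp add: sq f g ennreal_mult)
  finally show ?thesis by (subst (asm) ennreal_le_iff) auto
qed

lemma L2_tendsto_inner:
  assumes u: "\<And>n. u n \<in> L2 M" and v: "v \<in> L2 M" and lim: "(\<lambda>n. \<integral>x. (u n x - v x)\<^sup>2 \<partial>M) \<longlonglongrightarrow> 0"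
    and w: "w \<in> L2 M"
  shows "(\<lambda>n. \<integral>x. w x * u n x \<partial>M) \<longlonglongrightarrow> (\<integral>x. w x * v x \<partial>M)"
proof (rule Lim_null_comparison[THEN LIM_zero_cancel])
  let ?W = "\<integral>x. (w x)\<^sup>2 \<partial>M"
  show "eventually (\<lambda>n. norm ((\<integral>x. w x * u n x \<partial>M) - (\<integral>x. w x * v x \<partial>M))
      \<le> sqrt (?W * (\<integral>x. (u n x - v x)\<^sup>2 \<partial>M))) sequentially"
  proof (intro always_eventually allI)
    fix n
    have "(\<integral>x. w x * u n x \<partial>M) - (\<integral>x. w x * v x \<partial>M) = (\<integral>x. w x * (u n x - v x) \<partial>M)"
      using L2_mult[OF w u] L2_mult[OF w v] by (simp add: right_diff_distrib)
    also have "norm \<dots> \<le> (\<integral>x. \<bar>w x * (u n x - v x)\<bar> \<partial>M)" by simp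
    also have "\<dots> \<le> sqrt (?W * (\<integral>x. (u n x - v x)\<^sup>2 \<partial>M))"
      by (intro real_le_rsqrt L2_Cauchy_Schwarz w L2_diff u v)
    finally show "norm ((\<integral>x. w x * u n x \<partial>M) - (\<integral>x. w x * v x \<partial>M))
        \<le> sqrt (?W * (\<integral>x. (u n x - v x)\<^sup>2 \<partial>M))" .
  qed
  show "(\<lambda>n. sqrt (?W * (\<integral>x. (u n x - v x)\<^sup>2 \<partial>M))) \<longlonglongrightarrow> 0"
    using tendsto_real_sqrt[OF tendsto_mult_left[OF lim, of ?W]] by simp
qed

lemma L2_tendsto_integral_sq:
  assumes u: "\<And>n. u n \<in> L2 M" and v: "v \<in> L2 M" and lim: "(\<lambda>n. \<integral>x. (u n x - v x)\<^sup>2 \<partial>M) \<longlonglongrightarrow> 0"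
  shows "(\<lambda>n. \<integral>x. (u n x)\<^sup>2 \<partial>M) \<longlonglongrightarrow> (\<integral>x. (v x)\<^sup>2 \<partial>M)"
proof -
  have "(\<lambda>x. (u n x)\<^sup>2) = (\<lambda>x. (u n x - v x)\<^sup>2 + 2 * (v x * u n x) - (v x)\<^sup>2)" for n
    by (auto simp: power2_eq_square algebra_simps)
  then have "(\<integral>x. (u n x)\<^sup>2 \<partial>M)
      = (\<integral>x. (u n x - v x)\<^sup>2 \<partial>M) + 2 * (\<integral>x. v x * u n x \<partial>M) - (\<integral>x. (v x)\<^sup>2 \<partial>M)" for n
    using L2D(2)[OF L2_diff[OF u v]] L2D(2)[OF v] L2_mult[OF v u] by simp
  moreover have "(\<lambda>n. (\<integral>x. (u n x - v x)\<^sup>2 \<partial>M) + 2 * (\<integral>x. v x * u n x \<partial>M) - (\<integral>x. (v x)\<^sup>2 \<partial>M))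
      \<longlonglongrightarrow> 0 + 2 * (\<integral>x. v x * v x \<partial>M) - (\<integral>x. (v x)\<^sup>2 \<partial>M)"
    by (intro tendsto_intros lim L2_tendsto_inner[OF u v lim v])
  ultimately show ?thesis by (simp add: power2_eq_square)
qed

lemma AE_le_if_integral_pos_part_sq_nonpos:
  assumes d: "(\<lambda>x. max (f x - g x) 0) \<in> L2 M" and diff_le_0: "(\<integral>x. (max (f x - g x) 0)\<^sup>2 \<partial>M) \<le> 0"
  shows "AE x in M. f x \<le> g x"
proof -
  have "(\<integral>x. (max (f x - g x) 0)\<^sup>2 \<partial>M) = 0" using diff_le_0 by (intro antisym) auto
  then have "AE x in M. (max (f x - g x) 0)\<^sup>2 = 0"
    using L2D(2)[OF d] by (subst (asm) integral_nonneg_eq_0_iff_AE) auto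
  then show ?thesis by eventually_elim (auto simp: max_def split: if_splits)
qed

lemma AE_le_if_integral_le_neg_pos_part_sq:
  assumes \<alpha>: "0 < \<alpha>" and d: "(\<lambda>x. max (g x - g' x) 0) \<in> L2 M" and k: "integrable M k" "0 \<le> (\<integral>x. k x \<partial>M)"
    and integrand_le: "AE x in M. k x \<le> - \<alpha> * (max (g x - g' x) 0)\<^sup>2"
  shows "AE x in M. g x \<le> g' x"
proof (rule AE_le_if_integral_pos_part_sq_nonpos[OF d])
  have "0 \<le> (\<integral>x. k x \<partial>M)" by (rule k(2))
  also have "\<dots> \<le> (\<integral>x. - \<alpha> * (max (g x - g' x) 0)\<^sup>2 \<partial>M)"
    using integrand_le L2D(2)[OF d] by (intro integral_mono_AE k(1)) simp_all
  finally show "(\<integral>x. (max (g x - g' x) 0)\<^sup>2 \<partial>M) \<le> 0" using \<alpha> L2D(2)[OF d] by (simp add: mult_le_0_iff)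
qed

lemma L2_min_tendsto:
  assumes u: "u \<in> L2 M" and p [measurable]: "\<And>n. p n \<in> borel_measurable M" and p_nn: "\<And>n x. 0 \<le> p n x"
    and lim: "AE x in M. (\<lambda>n. p n x) \<longlonglongrightarrow> h x" and u_le: "AE x in M. u x \<le> h x"
  shows "(\<lambda>n. \<integral>x. (u x - min (u x) (p n x))\<^sup>2 \<partial>M) \<longlonglongrightarrow> 0"
proof -
  note [measurable] = L2D(1)[OF u]
  have "(\<lambda>n. \<integral>x. (u x - min (u x) (p n x))\<^sup>2 \<partial>M) \<longlonglongrightarrow> (\<integral>x. 0 \<partial>M)"
  proof (rule integral_dominated_convergence[OF _ _ L2D(2)[OF u]])
    show "AE x in M. (\<lambda>n. (u x - min (u x) (p n x))\<^sup>2) \<longlonglongrightarrow> 0"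
      using lim u_le
    proof eventually_elim
      case (elim x)
      then have "(\<lambda>n. (u x - min (u x) (p n x))\<^sup>2) \<longlonglongrightarrow> (u x - min (u x) (h x))\<^sup>2"
        by (intro tendsto_intros)
      then show ?case using elim by (simp add: min_def)
    qed
    have "(u x - min (u x) (p n x))\<^sup>2 \<le> (u x)\<^sup>2" for n x
      unfolding abs_le_square_iff[symmetric] using p_nn[of n x] by auto
    then show "AE x in M. norm ((u x - min (u x) (p n x))\<^sup>2) \<le> (u x)\<^sup>2" for n by simp
  qed simp_all
  then show ?thesis by simp
qed

lemma real_le_if_le_add_scaled:
  fixes a b c :: real
  assumes "\<And>t. 0 < t \<Longrightarrow> t < 1 \<Longrightarrow> a \<le> b + t * c"
  shows "a \<le> b"
proof (rule tendsto_lowerbound)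
  have "((\<lambda>t. b + t * c) \<longlongrightarrow> b + 0 * c) (at_right 0)" by (intro tendsto_intros)
  then show "((\<lambda>t. b + t * c) \<longlongrightarrow> b) (at_right 0)" by simp
  show "eventually (\<lambda>t. a \<le> b + t * c) (at_right 0)"
    using eventually_at_right_real[OF zero_less_one] by eventually_elim (simp add: assms)
qed simp

lemma nn_integral_lim_le_liminf:
  fixes f :: "nat \<Rightarrow> 'a \<Rightarrow> ennreal"
  assumes "\<And>k. f k \<in> borel_measurable M" and lim: "AE x in M. (\<lambda>k. f k x) \<longlonglongrightarrow> g x"
  shows "(\<integral>\<^sup>+x. g x \<partial>M) \<le> liminf (\<lambda>k. \<integral>\<^sup>+x. f k x \<partial>M)"
proof -
  have "AE x in M. g x = liminf (\<lambda>k. f k x)"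
    using lim by eventually_elim (simp add: lim_imp_Liminf)
  then have "(\<integral>\<^sup>+x. g x \<partial>M) = (\<integral>\<^sup>+x. liminf (\<lambda>k. f k x) \<partial>M)" by (rule nn_integral_cong_AE)
  also have "\<dots> \<le> liminf (\<lambda>k. \<integral>\<^sup>+x. f k x \<partial>M)" by (rule nn_integral_liminf[OF assms(1)])
  finally show ?thesis .
qed

lemma L2_limit_of_bounded:
  assumes u: "\<And>n. u n \<in> L2 M" and v: "v \<in> borel_measurable M" and lim: "AE x in M. (\<lambda>n. u n x) \<longlonglongrightarrow> v x"
    and bound: "eventually (\<lambda>n. (\<integral>x. (u n x)\<^sup>2 \<partial>M) \<le> c) sequentially"
  shows "v \<in> L2 M" "(\<integral>x. (v x)\<^sup>2 \<partial>M) \<le> c"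
proof -
  note [measurable] = L2D(1)[OF u] v
  have nn: "(\<integral>\<^sup>+x. ennreal ((u n x)\<^sup>2) \<partial>M) = ennreal (\<integral>x. (u n x)\<^sup>2 \<partial>M)" for n
    using L2D(2)[OF u] by (simp add: nn_integral_eq_integral)
  have "AE x in M. (\<lambda>n. ennreal ((u n x)\<^sup>2)) \<longlonglongrightarrow> ennreal ((v x)\<^sup>2)"
    using lim by eventually_elim (intro tendsto_intros)
  then have "(\<integral>\<^sup>+x. ennreal ((v x)\<^sup>2) \<partial>M) \<le> liminf (\<lambda>n. \<integral>\<^sup>+x. ennreal ((u n x)\<^sup>2) \<partial>M)"
    by (intro nn_integral_lim_le_liminf) auto
  also have "\<dots> \<le> ennreal c"
    unfolding nn using bound by (intro Liminf_le) (auto elim!: eventually_mono intro: ennreal_leI)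
  finally have sq_le: "(\<integral>\<^sup>+x. ennreal ((v x)\<^sup>2) \<partial>M) \<le> ennreal c" .
  then have int: "integrable M (\<lambda>x. (v x)\<^sup>2)"
    by (intro integrableI_bounded) (auto simp: le_less_trans)
  then show "v \<in> L2 M" using v by (simp add: L2_def)
  obtain n where "(\<integral>x. (u n x)\<^sup>2 \<partial>M) \<le> c" using eventually_happens[OF bound] by auto
  then have "0 \<le> c" by (rule order_trans[rotated]) simp
  then show "(\<integral>x. (v x)\<^sup>2 \<partial>M) \<le> c" using sq_le int by (simp add: nn_integral_eq_integral)
qed

section \<open>Local convergence in measure\<close>

lemma AE_imp_loc_conv_in_measure:
  assumes gs [measurable]: "\<And>n. gs n \<in> borel_measurable M" and f [measurable]: "f \<in> borel_measurable M"
    and lim: "AE x in M. (\<lambda>n. gs n x) \<longlonglongrightarrow> f x"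
  shows "loc_conv_in_measure M gs f"
  unfolding loc_conv_in_measure_def
proof (intro ballI impI allI)
  fix A and e :: real assume A [measurable]: "A \<in> sets M" and fin: "emeasure M A < \<infinity>" and e: "e > 0"
  let ?S = "\<lambda>n. {x\<in>A. e < \<bar>gs n x - f x\<bar>}"
  have "?S n = A \<inter> {x\<in>space M. e < \<bar>gs n x - f x\<bar>}" for n using sets.sets_into_space[OF A] by auto
  then have S [measurable]: "?S n \<in> sets M" for n by simp
  have "(\<lambda>n. \<integral>\<^sup>+x. indicator (?S n) x \<partial>M) \<longlonglongrightarrow> (\<integral>\<^sup>+x. 0 \<partial>M)"
  proof (rule nn_integral_dominated_convergence[where w = "indicator A"])
    show "AE x in M. indicator (?S n) x \<le> (indicator A x :: ennreal)" for n
      by (intro AE_I2) (auto simp: indicator_def)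
    show "(\<integral>\<^sup>+x. indicator A x \<partial>M) < \<infinity>" using fin by simp
    show "AE x in M. (\<lambda>n. indicator (?S n) x) \<longlonglongrightarrow> (0::ennreal)"
      using lim
    proof eventually_elim
      case (elim x)
      then have "eventually (\<lambda>n. \<bar>gs n x - f x\<bar> < e) sequentially"
        using e by (auto dest: tendstoD simp: dist_real_def)
      then have "eventually (\<lambda>n. indicator (?S n) x = (0::ennreal)) sequentially"
        by eventually_elim (auto simp: indicator_def)
      then show ?case by (rule tendsto_eventually)
    qed
  qed simp_all
  then show "(\<lambda>n. emeasure M (?S n)) \<longlonglongrightarrow> 0" by simp
qed

context sigma_finite_measure
begin

lemma integrable_weight_exists:
  "\<exists>w :: 'a \<Rightarrow> real. w \<in> borel_measurable M \<and> (\<forall>x. 0 \<le> w x \<and> w x \<le> 1) \<and> (\<forall>x\<in>space M. 0 < w x)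
      \<and> integrable M w"
proof -
  obtain h where h [measurable]: "h \<in> borel_measurable M" and fin: "integral\<^sup>N M h \<noteq> \<infinity>"
    and pos: "\<And>x. x \<in> space M \<Longrightarrow> 0 < h x \<and> h x < \<infinity>"
    using Ex_finite_integrable_function by blast
  let ?w = "\<lambda>x. min 1 (enn2real (h x))"
  have "(\<integral>\<^sup>+x. ennreal (norm (?w x)) \<partial>M) \<le> integral\<^sup>N M h"
  proof (rule nn_integral_mono)
    fix x assume "x \<in> space M"
    then have "ennreal (enn2real (h x)) = h x" using pos by simp
    moreover have "ennreal (norm (?w x)) \<le> ennreal (enn2real (h x))"
      by (intro ennreal_leI) (simp add: min_def)
    ultimately show "ennreal (norm (?w x)) \<le> h x" by simp
  qed
  then have "integrable M ?w" using fin by (intro integrableI_bounded) (auto simp: less_top top_unique)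
  moreover have "0 < ?w x" if "x \<in> space M" for x
    using pos[OF that] by (simp add: enn2real_positive_iff less_top)
  ultimately show ?thesis by (intro exI[of _ ?w]) auto
qed

definition weight :: "'a \<Rightarrow> real" where
  "weight = (SOME w. w \<in> borel_measurable M \<and> (\<forall>x. 0 \<le> w x \<and> w x \<le> 1) \<and>
     (\<forall>x\<in>space M. 0 < w x) \<and> integrable M w)"

lemma weight_measurable [measurable]: "weight \<in> borel_measurable M"
  and weight_nonneg: "0 \<le> weight x" and weight_le_1: "weight x \<le> 1"
  and weight_pos: "x \<in> space M \<Longrightarrow> 0 < weight x" and weight_integrable: "integrable M weight"
  using someI_ex[OF integrable_weight_exists, folded weight_def] by auto

lemma weight_L2: "weight \<in> L2 M"
proof -
  have "integrable M (\<lambda>x. (weight x)\<^sup>2)"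
  proof (rule Bochner_Integration.integrable_bound[OF weight_integrable])
    have "(weight x)\<^sup>2 \<le> weight x" for x
      using mult_left_le[OF weight_le_1 weight_nonneg] by (simp add: power2_eq_square)
    then show "AE x in M. norm ((weight x)\<^sup>2) \<le> norm (weight x)" using weight_nonneg by simp
  qed simp
  then show ?thesis by (simp add: L2_def)
qed

lemma weight_mult_tendsto_cancel:
  assumes "x \<in> space M" "(\<lambda>n. weight x * a n) \<longlonglongrightarrow> l"
  shows "a \<longlonglongrightarrow> l / weight x"
  using tendsto_divide[OF assms(2) tendsto_const, of "weight x"] weight_pos[OF assms(1)] by simp

lemma weighted_density_exists:
  assumes f [measurable]: "f \<in> borel_measurable M" "AE x in M. 0 < f x"
    and g [measurable]: "g \<in> borel_measurable M" and g0: "\<And>x. 0 \<le> g x"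
  obtains \<phi> where "\<phi> \<in> L2 M" "\<And>x. 0 \<le> \<phi> x" "AE x in M. 0 < \<phi> x" "AE x in M. \<phi> x \<le> f x"
    "\<And>x. g x * \<phi> x \<le> weight x"
proof -
  define \<phi> where "\<phi> x = min (max (f x) 0) (weight x / (1 + g x))" for x
  have \<phi>0: "0 \<le> \<phi> x" for x using weight_nonneg g0[of x] by (auto simp: \<phi>_def)
  have \<phi>w: "\<phi> x \<le> weight x \<and> g x * \<phi> x \<le> weight x" for x
  proof -
    have "\<phi> x \<le> weight x / (1 + g x)" by (simp add: \<phi>_def)
    then have "\<phi> x + g x * \<phi> x \<le> weight x" using g0[of x] by (simp add: field_simps)
    moreover have "0 \<le> g x * \<phi> x" using \<phi>0 g0 by simp
    ultimately show ?thesis using \<phi>0[of x] by linarith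
  qed
  have "\<phi> \<in> borel_measurable M" unfolding \<phi>_def by measurable
  then have "\<phi> \<in> L2 M" using \<phi>0 \<phi>w weight_nonneg by (intro L2_dominated[OF weight_L2]) auto
  moreover have "AE x in M. \<phi> x \<le> f x" using f(2) by eventually_elim (simp add: \<phi>_def)
  moreover have "AE x in M. 0 < \<phi> x"
    using f(2) AE_space
  proof eventually_elim
    case (elim x)
    then show ?case using weight_pos[OF elim(2)] g0[of x] by (auto simp: \<phi>_def)
  qed
  ultimately show ?thesis using \<phi>0 \<phi>w by (intro that) auto
qed

lemma incseq_L2_approx:
  assumes [measurable]: "f \<in> borel_measurable M" and nonneg: "AE x in M. 0 \<le> f x"
  obtains fs where "\<And>n. fs n \<in> L2 M" "\<And>n x. 0 \<le> fs n x"
    "AE x in M. incseq (\<lambda>n. fs n x) \<and> (\<lambda>n. fs n x) \<longlonglongrightarrow> f x"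
proof -
  define fs where "fs n x = min (max (f x) 0) (real n * weight x)" for n :: nat and x
  have "fs n \<in> L2 M" for n
  proof (rule L2_dominated[OF L2_scale[OF weight_L2, of "real n"]])
    show "fs n \<in> borel_measurable M" unfolding fs_def by measurable
    show "AE x in M. \<bar>fs n x\<bar> \<le> \<bar>real n * weight x\<bar>" using weight_nonneg by (auto simp: fs_def)
  qed
  moreover have "0 \<le> fs n x" for n x using weight_nonneg by (simp add: fs_def)
  moreover have "AE x in M. incseq (\<lambda>n. fs n x) \<and> (\<lambda>n. fs n x) \<longlonglongrightarrow> f x"
    using nonneg AE_space
  proof eventually_elim
    case (elim x)
    have mono: "real k * weight x \<le> real n * weight x" if "k \<le> n" for k n
      using that weight_nonneg[of x] by (intro mult_right_mono) auto
    then have "incseq (\<lambda>n. fs n x)" unfolding incseq_def fs_def by (intro allI impI min.mono) auto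
    moreover obtain k where k: "f x < real k * weight x"
      using ex_less_of_nat_mult[OF weight_pos[OF elim(2)]] ..
    have "fs n x = f x" if "k \<le> n" for n using k elim mono[OF that] by (simp add: fs_def)
    then have "(\<lambda>n. fs n x) \<longlonglongrightarrow> f x" by (auto intro!: tendsto_eventually eventually_sequentiallyI[of k])
    ultimately show ?case ..
  qed
  ultimately show ?thesis by (rule that)
qed

definition measure_gauge :: "('a \<Rightarrow> real) \<Rightarrow> real" where
  "measure_gauge d = (\<integral>x. weight x * min 1 \<bar>d x\<bar> \<partial>M)"

lemma norm_weight_mult_min_le: "norm (weight x * min 1 \<bar>a\<bar>) \<le> weight x"
  using weight_nonneg by (auto simp: abs_mult min_def mult_left_le)

lemma measure_gauge_integrable:
  assumes [measurable]: "d \<in> borel_measurable M"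
  shows "integrable M (\<lambda>x. weight x * min 1 \<bar>d x\<bar>)"
  by (rule Bochner_Integration.integrable_bound[OF weight_integrable])
    (use norm_weight_mult_min_le weight_nonneg in auto)

lemma measure_gauge_nonneg: "0 \<le> measure_gauge d"
  unfolding measure_gauge_def using weight_nonneg by (intro integral_nonneg_AE AE_I2) auto

lemma AE_imp_measure_gauge_tendsto:
  assumes ds [measurable]: "\<And>n. ds n \<in> borel_measurable M" and lim: "AE x in M. (\<lambda>n. ds n x) \<longlonglongrightarrow> 0"
  shows "(\<lambda>n. measure_gauge (ds n)) \<longlonglongrightarrow> 0"
proof -
  have "(\<lambda>n. \<integral>x. weight x * min 1 \<bar>ds n x\<bar> \<partial>M) \<longlonglongrightarrow> (\<integral>x. 0 \<partial>M)"
  proof (rule integral_dominated_convergence[OF _ _ weight_integrable])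
    show "AE x in M. (\<lambda>n. weight x * min 1 \<bar>ds n x\<bar>) \<longlonglongrightarrow> 0"
      using lim
    proof eventually_elim
      case (elim x)
      then have "(\<lambda>n. weight x * min 1 \<bar>ds n x\<bar>) \<longlonglongrightarrow> weight x * min 1 \<bar>0\<bar>" by (intro tendsto_intros)
      then show ?case by simp
    qed
  qed (use norm_weight_mult_min_le in simp_all)
  then show ?thesis unfolding measure_gauge_def by simp
qed

lemma measure_gauge_tendsto_imp_AE_subseq:
  assumes ds [measurable]: "\<And>n. ds n \<in> borel_measurable M" and lim: "(\<lambda>n. measure_gauge (ds n)) \<longlonglongrightarrow> 0"
  obtains r :: "nat \<Rightarrow> nat" where "strict_mono r" "AE x in M. (\<lambda>n. ds (r n) x) \<longlonglongrightarrow> 0"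
proof -
  have "norm (weight x * min 1 \<bar>ds n x\<bar>) = weight x * min 1 \<bar>ds n x\<bar>" for n x
    using weight_nonneg[of x] by simp
  then have "(\<lambda>n. LINT x|M. norm (weight x * min 1 \<bar>ds n x\<bar>)) \<longlonglongrightarrow> 0"
    using lim by (simp add: measure_gauge_def)
  from tendsto_L1_AE_subseq[OF measure_gauge_integrable[OF ds] this]
  obtain r :: "nat \<Rightarrow> nat" where r: "strict_mono r"
    and sub: "AE x in M. (\<lambda>n. weight x * min 1 \<bar>ds (r n) x\<bar>) \<longlonglongrightarrow> 0" by blast
  from sub AE_space have "AE x in M. (\<lambda>n. ds (r n) x) \<longlonglongrightarrow> 0"
  proof eventually_elim
    case (elim x)
    have m: "(\<lambda>n. min 1 \<bar>ds (r n) x\<bar>) \<longlonglongrightarrow> 0" using weight_mult_tendsto_cancel[OF elim(2,1)] by simp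
    then have "eventually (\<lambda>n. min 1 \<bar>ds (r n) x\<bar> < 1) sequentially" by (rule order_tendstoD) simp
    then have "eventually (\<lambda>n. min 1 \<bar>ds (r n) x\<bar> = \<bar>ds (r n) x\<bar>) sequentially"
      by eventually_elim auto
    then have "(\<lambda>n. \<bar>ds (r n) x\<bar>) \<longlonglongrightarrow> 0" using m tendsto_cong by fast
    then show ?case by (rule tendsto_rabs_zero_cancel)
  qed
  with r show ?thesis by (rule that)
qed

lemma weight_small_off_finite_measure_set:
  assumes e: "0 < e"
  obtains A where "A \<in> sets M" "emeasure M A < \<infinity>" "(\<integral>x. indicator (space M - A) x * weight x \<partial>M) < e"
proof -
  obtain A :: "nat \<Rightarrow> 'a set" where A: "range A \<subseteq> sets M" "(\<Union>i. A i) = space M"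
    "\<And>i. emeasure M (A i) \<noteq> \<infinity>" "incseq A" by (rule sigma_finite_incseq) blast
  have [measurable]: "A k \<in> sets M" for k using A(1) by blast
  have "(\<lambda>k. \<integral>x. indicator (space M - A k) x * weight x \<partial>M) \<longlonglongrightarrow> (\<integral>x. 0 \<partial>M)"
  proof (rule integral_dominated_convergence[OF _ _ weight_integrable])
    show "AE x in M. (\<lambda>k. indicator (space M - A k) x * weight x) \<longlonglongrightarrow> 0"
    proof (rule AE_I2)
      fix x assume "x \<in> space M"
      then obtain k where "x \<in> A k" using A(2) by blast
      then have "eventually (\<lambda>k. indicator (space M - A k) x * weight x = 0) sequentially"
        using incseqD[OF A(4)] by (intro eventually_sequentiallyI[of k]) (auto simp: indicator_def)
      then show "(\<lambda>k. indicator (space M - A k) x * weight x) \<longlonglongrightarrow> 0" by (rule tendsto_eventually)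
    qed
    show "AE x in M. norm (indicator (space M - A k) x * weight x) \<le> weight x" for k
      using weight_nonneg by (intro AE_I2) (auto simp: indicator_def)
  qed simp_all
  then have "eventually (\<lambda>k. (\<integral>x. indicator (space M - A k) x * weight x \<partial>M) < e) sequentially"
    using e by (intro order_tendstoD(2)[of _ 0]) auto
  then obtain k where "(\<integral>x. indicator (space M - A k) x * weight x \<partial>M) < e"
    by (auto simp: eventually_sequentially)
  then show ?thesis using A(3)[of k] by (intro that[of "A k"]) (auto simp: less_top)
qed

lemma measure_gauge_le:
  assumes A [measurable]: "A \<in> sets M" and fin: "emeasure M A < \<infinity>" and e: "0 < e"
    and d [measurable]: "d \<in> borel_measurable M"
  shows "measure_gauge d \<le> (\<integral>x. indicator (space M - A) x * weight x \<partial>M) + e * (\<integral>x. weight x \<partial>M)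
      + measure M {x\<in>A. e < \<bar>d x\<bar>}"
proof -
  let ?S = "{x\<in>A. e < \<bar>d x\<bar>}"
  have "?S = A \<inter> {x\<in>space M. e < \<bar>d x\<bar>}" using sets.sets_into_space[OF A] by auto
  then have S [measurable]: "?S \<in> sets M" by simp
  have "emeasure M ?S \<le> emeasure M A" by (intro emeasure_mono) auto
  then have int_S: "integrable M (\<lambda>x. indicator ?S x :: real)"
    using fin by (intro integrable_real_indicator S) (rule le_less_trans)
  have int_A: "integrable M (\<lambda>x. indicator (space M - A) x * weight x)"
    using integrable_mult_indicator[of "space M - A", OF _ weight_integrable] by simp
  have bound: "weight x * min 1 \<bar>d x\<bar>
      \<le> indicator (space M - A) x * weight x + e * weight x + indicator ?S x"
    if x: "x \<in> space M" for x
  proof -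
    have w: "0 \<le> weight x" "weight x \<le> 1" using weight_nonneg weight_le_1 by auto
    have "weight x * min 1 \<bar>d x\<bar> \<le> weight x * 1" "weight x * min 1 \<bar>d x\<bar> \<le> weight x * \<bar>d x\<bar>"
      using w by (intro mult_left_mono; simp)+
    moreover have "weight x * \<bar>d x\<bar> \<le> weight x * e" if "\<bar>d x\<bar> \<le> e" using w that by (intro mult_left_mono)
    moreover have "0 \<le> e * weight x" using w e by simp
    ultimately show ?thesis using x w by (auto simp: indicator_def mult.commute)
  qed
  have "measure_gauge d \<le> (\<integral>x. indicator (space M - A) x * weight x + e * weight x + indicator ?S x \<partial>M)"
    unfolding measure_gauge_def
    by (intro integral_mono measure_gauge_integrable Bochner_Integration.integrable_add int_A int_S
        integrable_mult_right weight_integrable bound d)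
  then show ?thesis using int_A int_S weight_integrable by simp
qed

lemma loc_conv_imp_measure_gauge_tendsto:
  assumes gs [measurable]: "\<And>n. gs n \<in> borel_measurable M" and f [measurable]: "f \<in> borel_measurable M"
    and lim: "loc_conv_in_measure M gs f"
  shows "(\<lambda>n. measure_gauge (\<lambda>x. gs n x - f x)) \<longlonglongrightarrow> 0"
proof (rule LIMSEQ_I)
  fix r :: real assume r: "0 < r"
  obtain A where A: "A \<in> sets M" "emeasure M A < \<infinity>"
    and tail: "(\<integral>x. indicator (space M - A) x * weight x \<partial>M) < r / 3"
    using weight_small_off_finite_measure_set[of "r / 3"] r by auto
  define W where "W = (\<integral>x. weight x \<partial>M)"
  have W: "0 \<le> W" using weight_nonneg by (simp add: W_def)
  define e where "e = r / (3 * (W + 1))"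
  have e: "0 < e" using r W by (simp add: e_def)
  have eW: "e * W \<le> r / 3" using W r by (simp add: e_def field_simps)
  let ?S = "\<lambda>n. {x\<in>A. e < \<bar>gs n x - f x\<bar>}"
  have "(\<lambda>n. emeasure M (?S n)) \<longlonglongrightarrow> 0" using lim A e unfolding loc_conv_in_measure_def by blast
  then have "eventually (\<lambda>n. emeasure M (?S n) < ennreal (r / 3)) sequentially"
    using r by (auto dest!: order_tendstoD(2))
  then obtain N where N: "\<And>n. n \<ge> N \<Longrightarrow> emeasure M (?S n) < ennreal (r / 3)"
    by (auto simp: eventually_sequentially)
  have "norm (measure_gauge (\<lambda>x. gs n x - f x) - 0) < r" if n: "n \<ge> N" for n
  proof -
    have "measure M (?S n) < r / 3"
      using N[OF n] r unfolding measure_def by (subst enn2real_less_iff) (auto intro: order_less_trans)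
    then have "measure_gauge (\<lambda>x. gs n x - f x) < r"
      using measure_gauge_le[OF A e, of "\<lambda>x. gs n x - f x"] tail eW by (simp add: W_def)
    then show ?thesis using measure_gauge_nonneg by simp
  qed
  then show "\<exists>no. \<forall>n\<ge>no. norm (measure_gauge (\<lambda>x. gs n x - f x) - 0) < r" by blast
qed

lemma loc_conv_imp_AE_subseq:
  assumes gs [measurable]: "\<And>n. gs n \<in> borel_measurable M" and f [measurable]: "f \<in> borel_measurable M"
    and lim: "loc_conv_in_measure M gs f"
  obtains r :: "nat \<Rightarrow> nat" where "strict_mono r" "AE x in M. (\<lambda>n. gs (r n) x) \<longlonglongrightarrow> f x"
proof -
  obtain r :: "nat \<Rightarrow> nat" where r: "strict_mono r" and "AE x in M. (\<lambda>n. gs (r n) x - f x) \<longlonglongrightarrow> 0"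
    using measure_gauge_tendsto_imp_AE_subseq[of "\<lambda>n x. gs n x - f x"]
      loc_conv_imp_measure_gauge_tendsto[OF gs f lim] by auto
  then show ?thesis by (intro that[OF r]) (simp add: LIM_zero_iff)
qed

text \<open>The diagonal sequence that makes relaxation on \<open>L\<^sup>0\<close> idempotent.\<close>

lemma AE_diagonal_subseq:
  fixes f :: "'a \<Rightarrow> real" and P :: "nat \<Rightarrow> ('a \<Rightarrow> real) \<Rightarrow> bool"
  assumes f [measurable]: "f \<in> borel_measurable M" and fs [measurable]: "\<And>n. fs n \<in> borel_measurable M"
    and lim: "AE x in M. (\<lambda>n. fs n x) \<longlonglongrightarrow> f x"
    and gs: "\<And>n. \<exists>g. (\<forall>k. g k \<in> borel_measurable M \<and> P n (g k)) \<and> (AE x in M. (\<lambda>k. g k x) \<longlonglongrightarrow> fs n x)"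
  obtains g and r :: "nat \<Rightarrow> nat" where "strict_mono r" "\<And>n. g n \<in> borel_measurable M" "\<And>n. P (r n) (g n)"
    "AE x in M. (\<lambda>n. g n x) \<longlonglongrightarrow> f x"
proof -
  have "\<exists>u. u \<in> borel_measurable M \<and> P n u
      \<and> measure_gauge (\<lambda>x. u x - fs n x) < inverse (real (Suc n))" for n
  proof -
    obtain g where g [measurable]: "\<And>k. g k \<in> borel_measurable M" and P: "\<And>k. P n (g k)"
      and "AE x in M. (\<lambda>k. g k x) \<longlonglongrightarrow> fs n x" using gs by metis
    then have "(\<lambda>k. measure_gauge (\<lambda>x. g k x - fs n x)) \<longlonglongrightarrow> 0"
      by (intro AE_imp_measure_gauge_tendsto) (auto simp: LIM_zero_iff)
    then have "eventually (\<lambda>k. measure_gauge (\<lambda>x. g k x - fs n x) < inverse (real (Suc n))) sequentially"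
      by (rule order_tendstoD) simp
    then obtain k where "measure_gauge (\<lambda>x. g k x - fs n x) < inverse (real (Suc n))"
      by (auto simp: eventually_sequentially)
    then show ?thesis using g P by blast
  qed
  then obtain u where u [measurable]: "\<And>n. u n \<in> borel_measurable M" and P: "\<And>n. P n (u n)"
    and near: "\<And>n. measure_gauge (\<lambda>x. u n x - fs n x) < inverse (real (Suc n))" by metis
  have "(\<lambda>n. measure_gauge (\<lambda>x. u n x - fs n x)) \<longlonglongrightarrow> 0"
    by (rule tendsto_sandwich[OF _ _ tendsto_const LIMSEQ_inverse_real_of_nat])
      (simp_all only: measure_gauge_nonneg less_imp_le[OF near] eventually_True)
  then obtain r :: "nat \<Rightarrow> nat" where r: "strict_mono r"
    and diff: "AE x in M. (\<lambda>n. u (r n) x - fs (r n) x) \<longlonglongrightarrow> 0"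
    using measure_gauge_tendsto_imp_AE_subseq[of "\<lambda>n x. u n x - fs n x"] by auto
  from diff lim have "AE x in M. (\<lambda>n. u (r n) x) \<longlonglongrightarrow> f x"
  proof eventually_elim
    case (elim x)
    from tendsto_add[OF elim(1) LIMSEQ_subseq_LIMSEQ[OF elim(2) r]] show ?case by (simp add: o_def)
  qed
  then show ?thesis using P by (intro that[OF r]) auto
qed

lemma L2_Cauchy_AE_subseq:
  fixes u :: "nat \<Rightarrow> 'a \<Rightarrow> real"
  assumes u: "\<And>n. u n \<in> L2 M"
    and Cauchy: "\<And>e. e > 0 \<Longrightarrow> \<exists>N. \<forall>i\<ge>N. \<forall>j\<ge>N. (\<integral>x. (u i x - u j x)\<^sup>2 \<partial>M) < e"
  obtains r v where "strict_mono r" "v \<in> borel_measurable M" "AE x in M. (\<lambda>n. u (r n) x) \<longlonglongrightarrow> v x"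
proof -
  note [measurable] = L2D(1)[OF u]
  define W where "W = (\<integral>x. (weight x)\<^sup>2 \<partial>M) + 1"
  have W: "0 < W" by (simp add: W_def add_nonneg_pos)
  obtain r where r: "strict_mono r" and "AE x in M. Cauchy (\<lambda>i. weight x * u (r i) x)"
  proof (rule cauchy_L1_AE_cauchy_subseq[where s = "\<lambda>n x. weight x * u n x" and M = M])
    show "integrable M (\<lambda>x. weight x * u n x)" for n by (rule L2_mult[OF weight_L2 u])
    fix e :: real assume e: "e > 0"
    obtain N where N: "\<And>i j. i \<ge> N \<Longrightarrow> j \<ge> N \<Longrightarrow> (\<integral>x. (u i x - u j x)\<^sup>2 \<partial>M) < e\<^sup>2 / W"
      using Cauchy[of "e\<^sup>2 / W"] e W by auto
    have "(LINT x|M. norm (weight x * u i x - weight x * u j x)) < e" if ij: "i \<ge> N" "j \<ge> N" for i j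
    proof -
      have "(\<integral>x. \<bar>weight x * (u i x - u j x)\<bar> \<partial>M)\<^sup>2 \<le> (\<integral>x. (weight x)\<^sup>2 \<partial>M) * (\<integral>x. (u i x - u j x)\<^sup>2 \<partial>M)"
        by (rule L2_Cauchy_Schwarz[OF weight_L2 L2_diff[OF u u]])
      also have "\<dots> \<le> W * (\<integral>x. (u i x - u j x)\<^sup>2 \<partial>M)" by (intro mult_right_mono) (simp_all add: W_def)
      also have "\<dots> < e\<^sup>2" using N[OF ij] W by (simp add: field_simps)
      finally have "(\<integral>x. \<bar>weight x * (u i x - u j x)\<bar> \<partial>M) < e"
        by (rule power2_less_imp_less) (use e in simp)
      then show ?thesis by (simp add: right_diff_distrib)
    qed
    then show "\<exists>N. \<forall>i\<ge>N. \<forall>j\<ge>N. (LINT x|M. norm (weight x * u i x - weight x * u j x)) < e" by blast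
  qed
  have "AE x in M. (\<lambda>n. u (r n) x) \<longlonglongrightarrow> lim (\<lambda>n. u (r n) x)"
    using \<open>AE x in M. Cauchy (\<lambda>i. weight x * u (r i) x)\<close> AE_space
  proof eventually_elim
    case (elim x)
    then obtain l where "(\<lambda>i. weight x * u (r i) x) \<longlonglongrightarrow> l"
      by (auto simp: Cauchy_convergent_iff convergent_def)
    then have "convergent (\<lambda>i. u (r i) x)"
      by (rule convergentI[OF weight_mult_tendsto_cancel[OF elim(2)]])
    then show ?case by (simp add: convergent_LIMSEQ_iff)
  qed
  then show ?thesis by (intro that[OF r]) auto
qed

lemma L2_complete:
  fixes u :: "nat \<Rightarrow> 'a \<Rightarrow> real"
  assumes u: "\<And>n. u n \<in> L2 M"
    and Cauchy: "\<And>e. e > 0 \<Longrightarrow> \<exists>N. \<forall>i\<ge>N. \<forall>j\<ge>N. (\<integral>x. (u i x - u j x)\<^sup>2 \<partial>M) < e"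
  obtains v where "v \<in> L2 M" "(\<lambda>n. \<integral>x. (u n x - v x)\<^sup>2 \<partial>M) \<longlonglongrightarrow> 0"
proof -
  obtain r v where r: "strict_mono r" and v [measurable]: "v \<in> borel_measurable M"
    and lim: "AE x in M. (\<lambda>n. u (r n) x) \<longlonglongrightarrow> v x"
    using L2_Cauchy_AE_subseq[OF u Cauchy] by blast
  note [measurable] = L2D(1)[OF u]
  have near: "\<exists>N. \<forall>n\<ge>N. (\<lambda>x. u n x - v x) \<in> L2 M \<and> (\<integral>x. (u n x - v x)\<^sup>2 \<partial>M) \<le> e" if e: "e > 0" for e
  proof -
    obtain N where N: "\<And>i j. i \<ge> N \<Longrightarrow> j \<ge> N \<Longrightarrow> (\<integral>x. (u i x - u j x)\<^sup>2 \<partial>M) < e"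
      using Cauchy[OF e] by blast
    have "(\<lambda>x. u n x - v x) \<in> L2 M \<and> (\<integral>x. (u n x - v x)\<^sup>2 \<partial>M) \<le> e" if n: "n \<ge> N" for n
    proof
      have bound: "eventually (\<lambda>k. (\<integral>x. (u n x - u (r k) x)\<^sup>2 \<partial>M) \<le> e) sequentially"
        using order_trans[OF _ seq_suble[OF r]] less_imp_le[OF N[OF n]]
          by (intro eventually_sequentiallyI[of N]) auto
      have lim_n: "AE x in M. (\<lambda>k. u n x - u (r k) x) \<longlonglongrightarrow> u n x - v x"
        using lim by eventually_elim (intro tendsto_intros)
      have meas: "(\<lambda>x. u n x - v x) \<in> borel_measurable M" by measurable
      show "(\<lambda>x. u n x - v x) \<in> L2 M"
        by (rule L2_limit_of_bounded(1)[OF L2_diff[OF u u] meas lim_n bound])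
      show "(\<integral>x. (u n x - v x)\<^sup>2 \<partial>M) \<le> e"
        by (rule L2_limit_of_bounded(2)[OF L2_diff[OF u u] meas lim_n bound])
    qed
    then show ?thesis by blast
  qed
  obtain n where "(\<lambda>x. u n x - v x) \<in> L2 M" using near[OF zero_less_one] by blast
  from L2_diff[OF u[of n] this] have "v \<in> L2 M" by simp
  moreover have "(\<lambda>n. \<integral>x. (u n x - v x)\<^sup>2 \<partial>M) \<longlonglongrightarrow> 0"
  proof (rule LIMSEQ_I)
    fix e :: real assume "0 < e"
    then show "\<exists>no. \<forall>n\<ge>no. norm ((\<integral>x. (u n x - v x)\<^sup>2 \<partial>M) - 0) < e"
      using near[of "e / 2"] by fastforce
  qed
  ultimately show ?thesis by (rule that)
qed

lemma L2_complete_inverse_rate: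
  fixes u :: "nat \<Rightarrow> 'a \<Rightarrow> real"
  assumes u: "\<And>n. u n \<in> L2 M" and c: "0 < c"
    and rate: "\<And>n m. c * (\<integral>x. (u n x - u m x)\<^sup>2 \<partial>M) < inverse (real (Suc n)) + inverse (real (Suc m))"
  obtains v where "v \<in> L2 M" "(\<lambda>n. \<integral>x. (u n x - v x)\<^sup>2 \<partial>M) \<longlonglongrightarrow> 0"
proof (rule L2_complete[OF u])
  fix e :: real assume e: "e > 0"
  obtain N where N: "inverse (real (Suc N)) < c * e / 2"
    using reals_Archimedean[of "c * e / 2"] c e by auto
  have "(\<integral>x. (u n x - u m x)\<^sup>2 \<partial>M) < e" if "n \<ge> N" "m \<ge> N" for n m
  proof -
    have "inverse (real (Suc n)) \<le> inverse (real (Suc N))"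
        "inverse (real (Suc m)) \<le> inverse (real (Suc N))"
      using that by (auto intro!: le_imp_inverse_le)
    then have "c * (\<integral>x. (u n x - u m x)\<^sup>2 \<partial>M) < c * e" using rate[of n m] N by linarith
    then show ?thesis using c by simp
  qed
  then show "\<exists>N. \<forall>i\<ge>N. \<forall>j\<ge>N. (\<integral>x. (u i x - u j x)\<^sup>2 \<partial>M) < e" by blast
qed (rule that)

end

section \<open>The extended form\<close>

lemma liminf_add_le_lim:
  fixes a b c :: "nat \<Rightarrow> ennreal"
  assumes sum_le: "\<And>n. a n + b n \<le> c n" and lim: "c \<longlonglongrightarrow> l"
  shows "liminf a + liminf b \<le> l"
proof -
  have "liminf a + liminf b = (SUP n. (INF m\<in>{n..}. a m) + (INF m\<in>{n..}. b m))"
    unfolding liminf_SUP_INF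
    by (rule ennreal_SUP_add[symmetric]; unfold incseq_def; intro allI impI INF_superset_mono) simp_all
  also have "\<dots> \<le> (SUP n. INF m\<in>{n..}. c m)"
  proof (intro SUP_mono' INF_greatest)
    fix n m :: nat assume m: "m \<in> {n..}"
    have "(INF m\<in>{n..}. a m) + (INF m\<in>{n..}. b m) \<le> a m + b m" by (intro add_mono INF_lower m)
    also have "\<dots> \<le> c m" by (rule sum_le)
    finally show "(INF m\<in>{n..}. a m) + (INF m\<in>{n..}. b m) \<le> c m" .
  qed
  also have "\<dots> = l" using lim_imp_Liminf[OF _ lim] by (simp add: liminf_SUP_INF)
  finally show ?thesis .
qed

lemma modular_convex_if_convex_on_domain:
  fixes F :: "('b \<Rightarrow> real) \<Rightarrow> ennreal"
  assumes dom: "\<And>t f g. 0 < t \<Longrightarrow> t < 1 \<Longrightarrow> F f < \<infinity> \<Longrightarrow> F g < \<infinity> \<Longrightarrow>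
      F (\<lambda>x. t * f x + (1 - t) * g x) \<le> ennreal t * F f + ennreal (1 - t) * F g"
    and t: "0 \<le> t" "t \<le> 1"
  shows "F (\<lambda>x. t * f x + (1 - t) * g x) \<le> ennreal t * F f + ennreal (1 - t) * F g"
proof -
  consider "t = 0" | "t = 1" | "0 < t" "t < 1" using t by linarith
  then show ?thesis
  proof cases
    case 3
    show ?thesis
    proof (cases "F f < \<infinity> \<and> F g < \<infinity>")
      case True
      then show ?thesis using 3 by (intro dom) auto
    next
      case False
      then have "ennreal t * F f + ennreal (1 - t) * F g = top"
        using 3 by (auto simp: ennreal_mult_top simp flip: less_top)
      then show ?thesis by (simp only: top_greatest)
    qed
  qed auto
qed

locale extended_form = sigma_finite_measure M for M :: "'a measure" +
  fixes E :: "('a \<Rightarrow> real) \<Rightarrow> ennreal"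
  assumes form: "nonlinear_order_preserving_form M E" and ext: "extended_form_exists M E"
begin

abbreviation Ee :: "('a \<Rightarrow> real) \<Rightarrow> ennreal" where "Ee \<equiv> E_ext M E"

lemma form_outside_L2: "f \<notin> L2 M \<Longrightarrow> E f = \<infinity>"
  using form unfolding nonlinear_order_preserving_form_def by blast

lemma form_finite_L2: "E f < \<infinity> \<Longrightarrow> f \<in> L2 M"
  using form_outside_L2 by fastforce

lemma form_lsc:
  assumes "f \<in> L2 M" "\<And>n. fs n \<in> L2 M" "(\<lambda>n. \<integral>x. (fs n x - f x)\<^sup>2 \<partial>M) \<longlonglongrightarrow> 0"
  shows "E f \<le> liminf (\<lambda>n. E (fs n))"
  using form assms unfolding nonlinear_order_preserving_form_def by blast

lemma form_order:
  assumes "f \<in> L2 M" "g \<in> L2 M"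
  shows "E (\<lambda>x. f x + \<bar>g x\<bar>) + E (\<lambda>x. f x - \<bar>g x\<bar>) \<le> E (\<lambda>x. f x + g x) + E (\<lambda>x. f x - g x)"
  using form assms unfolding nonlinear_order_preserving_form_def by blast

lemma form_min_max: "E (\<lambda>x. min (f x) (g x)) + E (\<lambda>x. max (f x) (g x)) \<le> E f + E g"
proof (cases "f \<in> L2 M \<and> g \<in> L2 M")
  case True
  let ?a = "\<lambda>x. (f x + g x) / 2" and ?b = "\<lambda>x. (f x - g x) / 2"
  have "?a \<in> L2 M" "?b \<in> L2 M" using True by (auto intro: L2_add L2_diff L2_divide)
  from form_order[OF this]
  have "E (\<lambda>x. ?a x + \<bar>?b x\<bar>) + E (\<lambda>x. ?a x - \<bar>?b x\<bar>) \<le> E (\<lambda>x. ?a x + ?b x) + E (\<lambda>x. ?a x - ?b x)" .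
  moreover have "(\<lambda>x. ?a x + ?b x) = f" "(\<lambda>x. ?a x - ?b x) = g" by (auto simp: field_simps)
  ultimately show ?thesis unfolding min_max_eq_half_sum_abs_diff by (simp add: add.commute)
next
  case False
  then have "E f = \<infinity> \<or> E g = \<infinity>" using form_outside_L2 by blast
  then show ?thesis by auto
qed

sublocale E: submodular_modular E
proof
  show "E (\<lambda>x. 0) = 0" "E (\<lambda>x. - f x) = E f" for f
    using form unfolding nonlinear_order_preserving_form_def by blast+
  show "E (\<lambda>x. t * f x + (1 - t) * g x) \<le> ennreal t * E f + ennreal (1 - t) * E g"
    if "0 \<le> t" "t \<le> 1" for t f g
    using _ that
  proof (rule modular_convex_if_convex_on_domain[where F = E])
    fix t :: real and f g assume t: "0 < t" "t < 1" and fin: "E f < \<infinity>" "E g < \<infinity>"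
    then show "E (\<lambda>x. t * f x + (1 - t) * g x) \<le> ennreal t * E f + ennreal (1 - t) * E g"
      using form fin[THEN form_finite_L2] t[THEN less_imp_le]
      unfolding nonlinear_order_preserving_form_def by blast
  qed
qed (rule form_min_max)

lemma Ee_L2: "f \<in> L2 M \<Longrightarrow> Ee f = E f"
  using ext by (simp add: extended_form_exists_def)

lemma Ee_le_form: "Ee f \<le> E f"
  using Ee_L2 form_outside_L2[of f] by (cases "f \<in> L2 M") auto

lemma Ee_finite_measurable: "Ee f < \<infinity> \<Longrightarrow> f \<in> borel_measurable M"
  by (auto simp: E_ext_def split: if_splits)

lemma Ee_le_liminf_form:
  assumes "\<And>n. gs n \<in> borel_measurable M" "f \<in> borel_measurable M"
    and "AE x in M. (\<lambda>n. gs n x) \<longlonglongrightarrow> f x"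
  shows "Ee f \<le> liminf (\<lambda>n. E (gs n))"
  unfolding E_ext_def using assms AE_imp_loc_conv_in_measure[OF assms]
  by (auto intro!: Inf_lower)

lemma Ee_less_approx:
  assumes less: "Ee f < c"
  obtains gs where "\<And>n. gs n \<in> borel_measurable M" "\<And>n. E (gs n) < c" "AE x in M. (\<lambda>n. gs n x) \<longlonglongrightarrow> f x"
proof -
  have f [measurable]: "f \<in> borel_measurable M"
    using less by (intro Ee_finite_measurable) (simp add: order_less_le_trans)
  then obtain gs where gs [measurable]: "\<And>n. gs n \<in> borel_measurable M"
    and lc: "loc_conv_in_measure M gs f"
    and liminf: "liminf (\<lambda>n. E (gs n)) < c"
    using less by (auto simp: E_ext_def Inf_less_iff)
  obtain r :: "nat \<Rightarrow> nat" where r: "strict_mono r" and "((\<lambda>n. E (gs n)) \<circ> r) \<longlonglongrightarrow> liminf (\<lambda>n. E (gs n))"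
    using liminf_subseq_lim by blast
  then have less: "eventually (\<lambda>n. E (gs (r n)) < c) sequentially"
    using order_tendstoD(2)[OF _ liminf] by fastforce
  have "loc_conv_in_measure M (\<lambda>n. gs (r n)) f"
    using lc LIMSEQ_subseq_LIMSEQ[OF _ r] unfolding loc_conv_in_measure_def o_def by blast
  then obtain s :: "nat \<Rightarrow> nat" where s: "strict_mono s" and lim: "AE x in M. (\<lambda>n. gs (r (s n)) x) \<longlonglongrightarrow> f x"
    using loc_conv_imp_AE_subseq[of "\<lambda>n. gs (r n)" f] by auto
  obtain N where N: "\<And>n. N \<le> n \<Longrightarrow> E (gs (r (s n))) < c"
    using eventually_subseq[OF s less] by (auto simp: eventually_sequentially)
  have "AE x in M. (\<lambda>n. gs (r (s (n + N))) x) \<longlonglongrightarrow> f x"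
    using lim by eventually_elim (rule LIMSEQ_ignore_initial_segment)
  then show ?thesis using N by (intro that[of "\<lambda>n. gs (r (s (n + N)))"]) auto
qed

lemma Ee_lsc:
  assumes f [measurable]: "f \<in> borel_measurable M" and lim: "AE x in M. (\<lambda>n. fs n x) \<longlonglongrightarrow> f x"
  shows "Ee f \<le> liminf (\<lambda>n. Ee (fs n))"
proof (rule ccontr)
  assume "\<not> ?thesis"
  then obtain c where c: "liminf (\<lambda>n. Ee (fs n)) < c" "c < Ee f"
    using dense[of "liminf (\<lambda>n. Ee (fs n))" "Ee f"] by (auto simp: not_le)
  obtain r :: "nat \<Rightarrow> nat" where r: "strict_mono r" and "((\<lambda>n. Ee (fs n)) \<circ> r) \<longlonglongrightarrow> liminf (\<lambda>n. Ee (fs n))"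
    using liminf_subseq_lim by blast
  then have "eventually (\<lambda>n. Ee (fs (r n)) < c) sequentially"
    using order_tendstoD(2)[OF _ c(1)] by fastforce
  then obtain N where "\<And>n. N \<le> n \<Longrightarrow> Ee (fs (r n)) < c" by (auto simp: eventually_sequentially)
  then have less: "Ee (fs (r (n + N))) < c" for n by simp
  have meas: "fs (r (n + N)) \<in> borel_measurable M" for n
    using less[of n] by (intro Ee_finite_measurable) (simp add: order_less_le_trans)
  have sub: "AE x in M. (\<lambda>n. fs (r (n + N)) x) \<longlonglongrightarrow> f x"
    using lim
  proof eventually_elim
    case (elim x)
    show ?case
      using LIMSEQ_ignore_initial_segment[OF LIMSEQ_subseq_LIMSEQ[OF elim r], of N] by (simp add: o_def)
  qed
  have "\<exists>g. (\<forall>k. g k \<in> borel_measurable M \<and> E (g k) < c)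
      \<and> (AE x in M. (\<lambda>k. g k x) \<longlonglongrightarrow> fs (r (n + N)) x)" for n
    using Ee_less_approx[OF less[of n]] by metis
  then obtain g where g: "\<And>n. g n \<in> borel_measurable M" "\<And>n. E (g n) < c" "AE x in M. (\<lambda>n. g n x) \<longlonglongrightarrow> f x"
    by (rule AE_diagonal_subseq[OF f meas sub, of "\<lambda>n g. E g < c"]) blast
  have "Ee f \<le> liminf (\<lambda>n. E (g n))" by (rule Ee_le_liminf_form[OF g(1) f g(3)])
  also have "\<dots> \<le> c" using less_imp_le[OF g(2)] by (intro Liminf_le) auto
  finally show False using c(2) by simp
qed

lemma Ee_le_if_AE_tendsto:
  assumes f: "f \<in> borel_measurable M" and energy_le: "\<And>n. Ee (fs n) \<le> c"
    and lim: "AE x in M. (\<lambda>n. fs n x) \<longlonglongrightarrow> f x"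
  shows "Ee f \<le> c"
proof -
  have "Ee f \<le> liminf (\<lambda>n. Ee (fs n))" by (rule Ee_lsc[OF f lim])
  also have "\<dots> \<le> c" using energy_le by (intro Liminf_le) auto
  finally show ?thesis .
qed

lemma recovery_sequence:
  assumes fin: "Ee f < \<infinity>"
  obtains gs where "\<And>n. gs n \<in> L2 M" "(\<lambda>n. E (gs n)) \<longlonglongrightarrow> Ee f" "AE x in M. (\<lambda>n. gs n x) \<longlonglongrightarrow> f x"
proof -
  note f = Ee_finite_measurable[OF fin]
  let ?c = "\<lambda>n. Ee f + ennreal (inverse (real (Suc n)))"
  have "Ee f < ?c n" for n using fin by (simp add: ennreal_add_left_cancel_less)
  then have approx: "\<exists>g. (\<forall>k. g k \<in> borel_measurable M \<and> E (g k) < ?c n)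
      \<and> (AE x in M. (\<lambda>k. g k x) \<longlonglongrightarrow> f x)" for n
    using Ee_less_approx[of f "?c n"] by metis
  have const: "AE x in M. (\<lambda>n::nat. f x) \<longlonglongrightarrow> f x" by simp
  from approx obtain g r where r: "strict_mono r" and g: "\<And>n. g n \<in> borel_measurable M"
    and less: "\<And>n. E (g n) < ?c (r n)" and lim: "AE x in M. (\<lambda>n. g n x) \<longlonglongrightarrow> f x"
    by (rule AE_diagonal_subseq[OF f f const, of "\<lambda>n g. E g < ?c n"]) blast
  have "g n \<in> L2 M" for n using less[of n] by (intro form_finite_L2) (simp add: order_less_le_trans)
  moreover have "(\<lambda>n. E (g n)) \<longlonglongrightarrow> Ee f"
  proof -
    have lower: "Ee f \<le> liminf (\<lambda>n. E (g n))" by (rule Ee_le_liminf_form[OF g f lim])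
    have "(\<lambda>n. ?c n) \<longlonglongrightarrow> Ee f + ennreal 0" by (intro tendsto_intros LIMSEQ_inverse_real_of_nat)
    then have "(\<lambda>n. ?c (r n)) \<longlonglongrightarrow> Ee f" using LIMSEQ_subseq_LIMSEQ[OF _ r] by (simp add: o_def)
    then have "limsup (\<lambda>n. ?c (r n)) = Ee f" by (intro lim_imp_Limsup) simp
    moreover have "limsup (\<lambda>n. E (g n)) \<le> limsup (\<lambda>n. ?c (r n))"
      using less_imp_le[OF less] by (intro Limsup_mono) simp
    ultimately have upper: "limsup (\<lambda>n. E (g n)) \<le> Ee f" by simp
    have "liminf (\<lambda>n. E (g n)) \<le> limsup (\<lambda>n. E (g n))" by (rule Liminf_le_Limsup) simp
    with lower upper show ?thesis unfolding tendsto_iff_Liminf_eq_Limsup[OF sequentially_bot]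
      by (metis antisym order_trans)
  qed
  ultimately show ?thesis using lim by (rule that)
qed

lemma Ee_le_lim:
  assumes "\<And>n. gs n \<in> borel_measurable M" "f \<in> borel_measurable M" "AE x in M. (\<lambda>n. gs n x) \<longlonglongrightarrow> f x"
    and energy_le: "\<And>n. E (gs n) \<le> a n" and lim: "a \<longlonglongrightarrow> l"
  shows "Ee f \<le> l"
proof -
  have "Ee f \<le> liminf (\<lambda>n. E (gs n))" by (rule Ee_le_liminf_form[OF assms(1-3)])
  also have "\<dots> \<le> liminf a" using energy_le by (intro Liminf_mono) simp
  also have "\<dots> = l" using lim by (intro lim_imp_Liminf) simp
  finally show ?thesis .
qed

lemma Ee_superposition_le:
  assumes meas: "\<And>g. g \<in> borel_measurable M \<Longrightarrow> (\<lambda>x. \<tau> x (g x)) \<in> borel_measurable M"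
    and cont: "\<And>x y. isCont (\<tau> x) y" and k: "0 < k"
    and scaled_le: "\<And>g. E (\<lambda>x. \<tau> x (g x)) \<le> ennreal k * E g"
  shows "Ee (\<lambda>x. \<tau> x (f x)) \<le> ennreal k * Ee f"
proof (cases "Ee f < \<infinity>")
  case True
  obtain gs where gs: "\<And>n. gs n \<in> L2 M" "(\<lambda>n. E (gs n)) \<longlonglongrightarrow> Ee f" "AE x in M. (\<lambda>n. gs n x) \<longlonglongrightarrow> f x"
    using recovery_sequence[OF True] by blast
  show ?thesis
  proof (rule Ee_le_lim)
    show "AE x in M. (\<lambda>n. \<tau> x (gs n x)) \<longlonglongrightarrow> \<tau> x (f x)"
      using gs(3) by eventually_elim (rule isCont_tendsto_compose[OF cont])
    show "E (\<lambda>x. \<tau> x (gs n x)) \<le> ennreal k * E (gs n)" for n by (rule scaled_le)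
    show "(\<lambda>n. ennreal k * E (gs n)) \<longlonglongrightarrow> ennreal k * Ee f" by (intro ennreal_tendsto_cmult gs(2)) simp
  qed (intro meas L2D(1)[OF gs(1)] Ee_finite_measurable[OF True])+
qed (use k in \<open>simp add: ennreal_mult_top flip: less_top\<close>)

lemma Ee_minus: "Ee (\<lambda>x. - f x) = Ee f"
proof -
  have "Ee (\<lambda>x. - f x) \<le> Ee f" for f
    using Ee_superposition_le[of "\<lambda>x y. - y" 1 f] by (simp add: E.modular_minus)
  from this[of f] this[of "\<lambda>x. - f x"] show ?thesis by simp
qed

lemma Ee_convex:
  assumes "0 \<le> t" "t \<le> 1"
  shows "Ee (\<lambda>x. t * f x + (1 - t) * g x) \<le> ennreal t * Ee f + ennreal (1 - t) * Ee g"
proof (rule modular_convex_if_convex_on_domain[where F = Ee, OF _ assms])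
  fix t :: real and f g assume t: "0 < t" "t < 1" and fin: "Ee f < \<infinity>" "Ee g < \<infinity>"
  note [measurable] = fin[THEN Ee_finite_measurable]
  obtain fs where fs: "\<And>n. fs n \<in> L2 M" "(\<lambda>n. E (fs n)) \<longlonglongrightarrow> Ee f" "AE x in M. (\<lambda>n. fs n x) \<longlonglongrightarrow> f x"
    using recovery_sequence[OF fin(1)] by blast
  obtain gs where gs: "\<And>n. gs n \<in> L2 M" "(\<lambda>n. E (gs n)) \<longlonglongrightarrow> Ee g" "AE x in M. (\<lambda>n. gs n x) \<longlonglongrightarrow> g x"
    using recovery_sequence[OF fin(2)] by blast
  note [measurable] = L2D(1)[OF fs(1)] L2D(1)[OF gs(1)]
  show "Ee (\<lambda>x. t * f x + (1 - t) * g x) \<le> ennreal t * Ee f + ennreal (1 - t) * Ee g"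
  proof (rule Ee_le_lim)
    show "AE x in M. (\<lambda>n. t * fs n x + (1 - t) * gs n x) \<longlonglongrightarrow> t * f x + (1 - t) * g x"
      using fs(3) gs(3) by eventually_elim (intro tendsto_intros)
    show "E (\<lambda>x. t * fs n x + (1 - t) * gs n x) \<le> ennreal t * E (fs n) + ennreal (1 - t) * E (gs n)" for n
      using t by (intro E.modular_convex) auto
    show "(\<lambda>n. ennreal t * E (fs n) + ennreal (1 - t) * E (gs n))
        \<longlonglongrightarrow> ennreal t * Ee f + ennreal (1 - t) * Ee g"
      by (intro tendsto_add ennreal_tendsto_cmult fs(2) gs(2)) simp_all
  qed measurable
qed

lemma Ee_min_max: "Ee (\<lambda>x. min (f x) (g x)) + Ee (\<lambda>x. max (f x) (g x)) \<le> Ee f + Ee g"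
proof (cases "Ee f < \<infinity> \<and> Ee g < \<infinity>")
  case True
  then have [measurable]: "f \<in> borel_measurable M" "g \<in> borel_measurable M"
    using Ee_finite_measurable by auto
  obtain fs where fs: "\<And>n. fs n \<in> L2 M" "(\<lambda>n. E (fs n)) \<longlonglongrightarrow> Ee f" "AE x in M. (\<lambda>n. fs n x) \<longlonglongrightarrow> f x"
    using recovery_sequence True by blast
  obtain gs where gs: "\<And>n. gs n \<in> L2 M" "(\<lambda>n. E (gs n)) \<longlonglongrightarrow> Ee g" "AE x in M. (\<lambda>n. gs n x) \<longlonglongrightarrow> g x"
    using recovery_sequence True by blast
  note [measurable] = L2D(1)[OF fs(1)] L2D(1)[OF gs(1)]
  have "AE x in M. (\<lambda>n. min (fs n x) (gs n x)) \<longlonglongrightarrow> min (f x) (g x)"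
    using fs(3) gs(3) by eventually_elim (intro tendsto_intros)
  then have "Ee (\<lambda>x. min (f x) (g x)) \<le> liminf (\<lambda>n. E (\<lambda>x. min (fs n x) (gs n x)))"
    by (intro Ee_le_liminf_form) auto
  moreover have "AE x in M. (\<lambda>n. max (fs n x) (gs n x)) \<longlonglongrightarrow> max (f x) (g x)"
    using fs(3) gs(3) by eventually_elim (intro tendsto_intros)
  then have "Ee (\<lambda>x. max (f x) (g x)) \<le> liminf (\<lambda>n. E (\<lambda>x. max (fs n x) (gs n x)))"
    by (intro Ee_le_liminf_form) auto
  ultimately have "Ee (\<lambda>x. min (f x) (g x)) + Ee (\<lambda>x. max (f x) (g x))
      \<le> liminf (\<lambda>n. E (\<lambda>x. min (fs n x) (gs n x))) + liminf (\<lambda>n. E (\<lambda>x. max (fs n x) (gs n x)))"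
    by (rule add_mono)
  also have "\<dots> \<le> Ee f + Ee g"
    by (rule liminf_add_le_lim[OF form_min_max tendsto_add[OF fs(2) gs(2)]])
  finally show ?thesis .
qed (auto simp flip: less_top)

sublocale Ee: submodular_modular Ee
  by unfold_locales (simp_all add: Ee_L2 L2_zero E.modular_zero Ee_minus Ee_convex Ee_min_max)

end

section \<open>Resolvents and excessive functions\<close>

context extended_form
begin

definition resolvent_energy :: "real \<Rightarrow> ('a \<Rightarrow> real) \<Rightarrow> ('a \<Rightarrow> real) \<Rightarrow> real" where
  "resolvent_energy \<alpha> f u = enn2real (E u) + \<alpha> / 2 * (\<integral>x. (u x - f x / \<alpha>)\<^sup>2 \<partial>M)"

lemma ennreal_resolvent_energy:
  assumes "0 < \<alpha>" "E u < \<infinity>"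
  shows "E u + ennreal (\<alpha> / 2 * (\<integral>x. (u x - f x / \<alpha>)\<^sup>2 \<partial>M)) = ennreal (resolvent_energy \<alpha> f u)"
  unfolding resolvent_energy_def using assms by (simp add: ennreal_plus)

lemma resolvent_energy_nonneg: "0 < \<alpha> \<Longrightarrow> 0 \<le> resolvent_energy \<alpha> f u"
  by (simp add: resolvent_energy_def)

lemma is_resolvent_iff:
  assumes \<alpha>: "0 < \<alpha>"
  shows "is_resolvent M E \<alpha> f g \<longleftrightarrow>
    E g < \<infinity> \<and> (\<forall>u. E u < \<infinity> \<longrightarrow> resolvent_energy \<alpha> f g \<le> resolvent_energy \<alpha> f u)"
proof
  assume g: "is_resolvent M E \<alpha> f g"
  have "E g + ennreal (\<alpha> / 2 * (\<integral>x. (g x - f x / \<alpha>)\<^sup>2 \<partial>M))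
      \<le> E (\<lambda>x. 0) + ennreal (\<alpha> / 2 * (\<integral>x. (0 - f x / \<alpha>)\<^sup>2 \<partial>M))"
    using g L2_zero unfolding is_resolvent_def by blast
  also have "\<dots> < \<infinity>" by (simp add: E.modular_zero)
  finally have fin: "E g < \<infinity>" by (simp add: less_top)
  have "resolvent_energy \<alpha> f g \<le> resolvent_energy \<alpha> f u" if u: "E u < \<infinity>" for u
  proof -
    have "ennreal (resolvent_energy \<alpha> f g) \<le> ennreal (resolvent_energy \<alpha> f u)"
      using g form_finite_L2[OF u]
      unfolding is_resolvent_def ennreal_resolvent_energy[OF \<alpha> u, symmetric]
        ennreal_resolvent_energy[OF \<alpha> fin, symmetric]
      by blast
    then show ?thesis using resolvent_energy_nonneg[OF \<alpha>] by simp
  qed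
  with fin show "E g < \<infinity> \<and> (\<forall>u. E u < \<infinity> \<longrightarrow> resolvent_energy \<alpha> f g \<le> resolvent_energy \<alpha> f u)" by blast
next
  assume g: "E g < \<infinity> \<and> (\<forall>u. E u < \<infinity> \<longrightarrow> resolvent_energy \<alpha> f g \<le> resolvent_energy \<alpha> f u)"
  show "is_resolvent M E \<alpha> f g"
    unfolding is_resolvent_def
  proof (intro conjI ballI)
    show "g \<in> L2 M" using g form_finite_L2 by blast
    fix u
    show "E g + ennreal (\<alpha> / 2 * (\<integral>x. (g x - f x / \<alpha>)\<^sup>2 \<partial>M))
        \<le> E u + ennreal (\<alpha> / 2 * (\<integral>x. (u x - f x / \<alpha>)\<^sup>2 \<partial>M))"
    proof (cases "E u < \<infinity>")
      case True
      then have "resolvent_energy \<alpha> f g \<le> resolvent_energy \<alpha> f u" and g_fin: "E g < \<infinity>" using g by blast+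
      then show ?thesis unfolding ennreal_resolvent_energy[OF \<alpha> True] ennreal_resolvent_energy[OF \<alpha> g_fin]
        by (intro ennreal_leI)
    qed (simp flip: less_top)
  qed
qed

lemma resolvent_finite: "0 < \<alpha> \<Longrightarrow> is_resolvent M E \<alpha> f g \<Longrightarrow> E g < \<infinity>"
  by (simp add: is_resolvent_iff)

lemma resolvent_minimal:
  "0 < \<alpha> \<Longrightarrow> is_resolvent M E \<alpha> f g \<Longrightarrow> E u < \<infinity> \<Longrightarrow> resolvent_energy \<alpha> f g \<le> resolvent_energy \<alpha> f u"
  by (simp add: is_resolvent_iff)

lemma resolvent_L2: "is_resolvent M E \<alpha> f g \<Longrightarrow> g \<in> L2 M"
  by (simp add: is_resolvent_def)

lemma form_convex_real:
  assumes fin: "E u < \<infinity>" "E v < \<infinity>" and t: "0 \<le> t" "t \<le> 1"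
  shows "E (\<lambda>x. t * u x + (1 - t) * v x) < \<infinity>"
    and "enn2real (E (\<lambda>x. t * u x + (1 - t) * v x)) \<le> t * enn2real (E u) + (1 - t) * enn2real (E v)"
proof -
  have "E (\<lambda>x. t * u x + (1 - t) * v x) \<le> ennreal t * E u + ennreal (1 - t) * E v"
    by (rule E.modular_convex[OF t])
  also have "\<dots> = ennreal t * ennreal (enn2real (E u)) + ennreal (1 - t) * ennreal (enn2real (E v))"
    using fin by simp
  also have "\<dots> = ennreal (t * enn2real (E u) + (1 - t) * enn2real (E v))"
    using t by (simp add: ennreal_mult ennreal_plus)
  finally have convex_le: "E (\<lambda>x. t * u x + (1 - t) * v x)
      \<le> ennreal (t * enn2real (E u) + (1 - t) * enn2real (E v))" .
  then show "E (\<lambda>x. t * u x + (1 - t) * v x) < \<infinity>" by (rule le_less_trans) simp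
  show "enn2real (E (\<lambda>x. t * u x + (1 - t) * v x)) \<le> t * enn2real (E u) + (1 - t) * enn2real (E v)"
    using t by (intro enn2real_leI convex_le) simp
qed

text \<open>Compare \<open>g\<close> with \<open>(1 - t) g + t u\<close> and let \<open>t \<rightarrow> 0\<close>.\<close>

lemma resolvent_variational:
  assumes \<alpha>: "\<alpha> > 0" and f: "f \<in> L2 M" and g: "is_resolvent M E \<alpha> f g" and u: "E u < \<infinity>"
  shows "enn2real (E g) \<le> enn2real (E u) + (\<integral>x. (\<alpha> * g x - f x) * (u x - g x) \<partial>M)"
proof -
  define p where "p x = g x - f x / \<alpha>" for x
  define q where "q x = u x - g x" for x
  have pL: "p \<in> L2 M" and qL: "q \<in> L2 M"
    unfolding p_def q_def by (intro L2_diff L2_divide f resolvent_L2[OF g] form_finite_L2[OF u])+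
  have g_fin: "E g < \<infinity>" by (rule resolvent_finite[OF \<alpha> g])
  define I D where "I = (\<integral>x. p x * q x \<partial>M)" and "D = (\<integral>x. (q x)\<^sup>2 \<partial>M)"
  have "enn2real (E g) \<le> (enn2real (E u) + \<alpha> * I) + t * (\<alpha> / 2 * D)" if t: "0 < t" "t < 1" for t
  proof -
    let ?v = "\<lambda>x. t * u x + (1 - t) * g x" and ?N = "\<lambda>u. \<integral>x. (u x - f x / \<alpha>)\<^sup>2 \<partial>M"
    have v: "E ?v < \<infinity>" "enn2real (E ?v) \<le> t * enn2real (E u) + (1 - t) * enn2real (E g)"
      using form_convex_real[OF u g_fin] t by auto
    have "(\<lambda>x. ?v x - f x / \<alpha>) = (\<lambda>x. p x + t * q x)" by (auto simp: p_def q_def algebra_simps)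
    then have N: "?N ?v = ?N g + 2 * t * I + t\<^sup>2 * D"
      using integral_add_scaled_sq[OF pL qL, of t] by (simp add: fun_eq_iff I_def D_def) (simp add: p_def)
    have "enn2real (E g) + \<alpha> / 2 * ?N g \<le> enn2real (E ?v) + \<alpha> / 2 * ?N ?v"
      using resolvent_minimal[OF \<alpha> g v(1)] unfolding resolvent_energy_def .
    also have "\<dots> \<le> t * enn2real (E u) + (1 - t) * enn2real (E g) + \<alpha> / 2 * (?N g + 2 * t * I + t\<^sup>2 * D)"
      unfolding N by (rule add_right_mono[OF v(2)])
    also have "\<dots> = (enn2real (E g) + \<alpha> / 2 * ?N g)
        + t * ((enn2real (E u) + \<alpha> * I) + t * (\<alpha> / 2 * D) - enn2real (E g))"
      by (simp only: power2_eq_square distrib_left right_diff_distrib left_diff_distrib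
          mult.left_commute) simp
    finally have "0 \<le> t * ((enn2real (E u) + \<alpha> * I) + t * (\<alpha> / 2 * D) - enn2real (E g))" by simp
    then show ?thesis using t by (simp add: zero_le_mult_iff)
  qed
  then have "enn2real (E g) \<le> enn2real (E u) + \<alpha> * I" by (rule real_le_if_le_add_scaled)
  also have "\<alpha> * I = (\<integral>x. (\<alpha> * g x - f x) * (u x - g x) \<partial>M)"
    unfolding I_def integral_mult_right_zero[symmetric]
    using \<alpha> by (intro Bochner_Integration.integral_cong) (auto simp: p_def q_def field_simps)
  finally show ?thesis .
qed

lemma resolvent_energy_midpoint:
  assumes f: "f \<in> L2 M" and \<alpha>: "0 < \<alpha>" and fin: "E u < \<infinity>" "E v < \<infinity>"
  shows "\<alpha> / 8 * (\<integral>x. (u x - v x)\<^sup>2 \<partial>M) + resolvent_energy \<alpha> f (\<lambda>x. 1/2 * u x + (1 - 1/2) * v x)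
      \<le> (resolvent_energy \<alpha> f u + resolvent_energy \<alpha> f v) / 2"
proof -
  let ?m = "\<lambda>x. 1/2 * u x + (1 - 1/2) * v x" and ?N = "\<lambda>u. \<integral>x. (u x - f x / \<alpha>)\<^sup>2 \<partial>M"
  note uv = fin[THEN form_finite_L2]
  have L: "(\<lambda>x. u x - f x / \<alpha>) \<in> L2 M" "(\<lambda>x. v x - f x / \<alpha>) \<in> L2 M" "(\<lambda>x. u x - v x) \<in> L2 M"
    by (intro L2_diff L2_divide uv f)+
  have "(\<lambda>x. (?m x - f x / \<alpha>)\<^sup>2)
      = (\<lambda>x. 1/2 * (u x - f x / \<alpha>)\<^sup>2 + 1/2 * (v x - f x / \<alpha>)\<^sup>2 - 1/4 * (u x - v x)\<^sup>2)"
    by (auto simp: power2_eq_square algebra_simps)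
  then have N: "?N ?m = 1/2 * ?N u + 1/2 * ?N v - 1/4 * (\<integral>x. (u x - v x)\<^sup>2 \<partial>M)"
    using L[THEN L2D(2)] by simp
  have "\<alpha> / 2 * (1/2 * a + 1/2 * b - 1/4 * d) + \<alpha> / 8 * d = (\<alpha> / 2 * a + \<alpha> / 2 * b) / 2" for a b d
    by (simp add: field_simps)
  then have "\<alpha> / 2 * ?N ?m + \<alpha> / 8 * (\<integral>x. (u x - v x)\<^sup>2 \<partial>M) = (\<alpha> / 2 * ?N u + \<alpha> / 2 * ?N v) / 2"
    unfolding N .
  moreover have "enn2real (E ?m) \<le> 1/2 * enn2real (E u) + (1 - 1/2) * enn2real (E v)"
    by (rule form_convex_real(2)[OF fin]) auto
  ultimately show ?thesis unfolding resolvent_energy_def by argo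
qed

lemma resolvent_energy_lsc:
  assumes f: "f \<in> L2 M" and \<alpha>: "0 < \<alpha>" and u: "\<And>n. E (u n) < \<infinity>" and v: "v \<in> L2 M"
    and lim: "(\<lambda>n. \<integral>x. (u n x - v x)\<^sup>2 \<partial>M) \<longlonglongrightarrow> 0"
    and bound: "\<And>n. resolvent_energy \<alpha> f (u n) \<le> a n" and a: "a \<longlonglongrightarrow> b"
  shows "E v < \<infinity>" "resolvent_energy \<alpha> f v \<le> b"
proof -
  let ?N = "\<lambda>u. \<integral>x. (u x - f x / \<alpha>)\<^sup>2 \<partial>M"
  have uL: "u n \<in> L2 M" for n using u by (rule form_finite_L2)
  have "(\<lambda>x. u n x - f x / \<alpha> - (v x - f x / \<alpha>)) = (\<lambda>x. u n x - v x)" for n by auto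
  then have "(\<lambda>n. ?N (u n)) \<longlonglongrightarrow> ?N v"
    using lim by (intro L2_tendsto_integral_sq L2_diff L2_divide uL v f) simp
  then have "(\<lambda>n. ennreal (\<alpha> / 2 * ?N (u n))) \<longlonglongrightarrow> ennreal (\<alpha> / 2 * ?N v)" by (intro tendsto_intros)
  then have "E v + ennreal (\<alpha> / 2 * ?N v)
      \<le> liminf (\<lambda>n. E (u n)) + liminf (\<lambda>n. ennreal (\<alpha> / 2 * ?N (u n)))"
    by (intro add_mono form_lsc[OF v uL lim]) (simp add: lim_imp_Liminf)
  also have "\<dots> \<le> ennreal b"
  proof (rule liminf_add_le_lim)
    show "E (u n) + ennreal (\<alpha> / 2 * ?N (u n)) \<le> ennreal (a n)" for n
      unfolding ennreal_resolvent_energy[OF \<alpha> u] by (rule ennreal_leI[OF bound])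
    show "(\<lambda>n. ennreal (a n)) \<longlonglongrightarrow> ennreal b" using a by (rule tendsto_ennrealI)
  qed
  finally have energy_le: "E v + ennreal (\<alpha> / 2 * ?N v) \<le> ennreal b" .
  also have "\<dots> < \<infinity>" by simp
  finally show fin: "E v < \<infinity>" by (simp add: less_top)
  have "0 \<le> b"
    using order_trans[OF resolvent_energy_nonneg[OF \<alpha>] bound] by (intro LIMSEQ_le_const[OF a]) auto
  then show "resolvent_energy \<alpha> f v \<le> b"
    using energy_le unfolding ennreal_resolvent_energy[OF \<alpha> fin] by simp
qed

lemma resolvent_exists:
  assumes \<alpha>: "\<alpha> > 0" and f: "f \<in> L2 M"
  obtains g where "is_resolvent M E \<alpha> f g"
proof -
  let ?J = "resolvent_energy \<alpha> f"
  define I where "I = (INF u\<in>{u. E u < \<infinity>}. ?J u)"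
  have I_le: "I \<le> ?J u" if "E u < \<infinity>" for u
    unfolding I_def
      using that resolvent_energy_nonneg[OF \<alpha>] by (intro cINF_lower bdd_belowI2[of _ 0]) auto
  have "(\<lambda>x. 0) \<in> {u. E u < \<infinity>}" by (simp add: E.modular_zero)
  then have "\<exists>u. E u < \<infinity> \<and> ?J u < I + inverse (real (Suc n))" for n
    using cInf_lessD[of "?J ` {u. E u < \<infinity>}" "I + inverse (real (Suc n))"] by (auto simp: I_def)
  then obtain u where u: "\<And>n. E (u n) < \<infinity>" "\<And>n. ?J (u n) < I + inverse (real (Suc n))" by metis
  have uL: "u n \<in> L2 M" for n using u(1) by (rule form_finite_L2)
  have dist: "\<alpha> / 8 * (\<integral>x. (u n x - u m x)\<^sup>2 \<partial>M)
      < inverse (real (Suc n)) + inverse (real (Suc m))" for n m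
  proof -
    have "I \<le> ?J (\<lambda>x. 1/2 * u n x + (1 - 1/2) * u m x)"
      using u(1) by (intro I_le form_convex_real) auto
    moreover have "0 < inverse (real (Suc n))" "0 < inverse (real (Suc m))" by simp_all
    ultimately show ?thesis
      using resolvent_energy_midpoint[OF f \<alpha> u(1) u(1), of n m] u(2)[of n] u(2)[of m] by argo
  qed
  obtain v where v: "v \<in> L2 M" "(\<lambda>n. \<integral>x. (u n x - v x)\<^sup>2 \<partial>M) \<longlonglongrightarrow> 0"
    by (rule L2_complete_inverse_rate[OF uL _ dist]) (use \<alpha> in simp)
  have "(\<lambda>n. I + inverse (real (Suc n))) \<longlonglongrightarrow> I + 0" by (intro tendsto_intros LIMSEQ_inverse_real_of_nat)
  from resolvent_energy_lsc[OF f \<alpha> u(1) v less_imp_le[OF u(2)] this]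
  have "is_resolvent M E \<alpha> f v" using I_le by (auto simp: is_resolvent_iff[OF \<alpha>] intro: order_trans)
  then show ?thesis by (rule that)
qed

lemma resolvent_variational_pair:
  assumes \<alpha>: "\<alpha> > 0" and f: "f \<in> L2 M" "f' \<in> L2 M"
    and g: "is_resolvent M E \<alpha> f g" "is_resolvent M E \<alpha> f' g'" and energy_le: "E u + E u' \<le> E g + E g'"
  shows "integrable M (\<lambda>x. (\<alpha> * g x - f x) * (u x - g x) + (\<alpha> * g' x - f' x) * (u' x - g' x))"
    and "0 \<le> (\<integral>x. (\<alpha> * g x - f x) * (u x - g x) + (\<alpha> * g' x - f' x) * (u' x - g' x) \<partial>M)"
proof -
  have g_fin: "E g < \<infinity>" "E g' < \<infinity>" using g resolvent_finite[OF \<alpha>] by auto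
  have "E u + E u' < \<infinity>" by (rule le_less_trans[OF energy_le]) (use g_fin in simp)
  then have fin: "E u < \<infinity>" "E u' < \<infinity>" by (simp_all add: less_top)
  have int: "integrable M (\<lambda>x. (\<alpha> * g x - f x) * (u x - g x))"
      "integrable M (\<lambda>x. (\<alpha> * g' x - f' x) * (u' x - g' x))"
    by (intro L2_mult L2_diff L2_scale f g_fin[THEN form_finite_L2] fin[THEN form_finite_L2])+
  then show "integrable M (\<lambda>x. (\<alpha> * g x - f x) * (u x - g x) + (\<alpha> * g' x - f' x) * (u' x - g' x))" by simp
  have "enn2real (E u + E u') \<le> enn2real (E g + E g')" using energy_le g_fin by (intro enn2real_mono) simp_all
  then have "enn2real (E u) + enn2real (E u') \<le> enn2real (E g) + enn2real (E g')"
    using fin g_fin by (simp add: enn2real_plus)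
  then show "0 \<le> (\<integral>x. (\<alpha> * g x - f x) * (u x - g x) + (\<alpha> * g' x - f' x) * (u' x - g' x) \<partial>M)"
    using resolvent_variational[OF \<alpha> f(1) g(1) fin(1)] resolvent_variational[OF \<alpha> f(2) g(2) fin(2)] int
      by simp
qed

lemma resolvent_mono:
  assumes \<alpha>: "\<alpha> > 0" and f: "f \<in> L2 M" "f' \<in> L2 M" and data_le: "AE x in M. f x \<le> f' x"
    and g: "is_resolvent M E \<alpha> f g" "is_resolvent M E \<alpha> f' g'"
  shows "AE x in M. g x \<le> g' x"
proof (rule AE_le_if_integral_le_neg_pos_part_sq[OF \<alpha>])
  show "(\<lambda>x. max (g x - g' x) 0) \<in> L2 M" by (intro L2_max L2_diff L2_zero g[THEN resolvent_L2])
  note pair = resolvent_variational_pair[OF \<alpha> f g E.modular_min_max]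
  show "integrable M (\<lambda>x. (\<alpha> * g x - f x) * (min (g x) (g' x) - g x)
      + (\<alpha> * g' x - f' x) * (max (g x) (g' x) - g' x))"
    and "0 \<le> (\<integral>x. (\<alpha> * g x - f x) * (min (g x) (g' x) - g x)
      + (\<alpha> * g' x - f' x) * (max (g x) (g' x) - g' x) \<partial>M)"
    by (rule pair)+
  show "AE x in M. (\<alpha> * g x - f x) * (min (g x) (g' x) - g x)
      + (\<alpha> * g' x - f' x) * (max (g x) (g' x) - g' x)
      \<le> - \<alpha> * (max (g x - g' x) 0)\<^sup>2"
    using data_le
  proof eventually_elim
    case (elim x)
    show ?case
    proof (cases "g x \<le> g' x")
      case False
      then have "0 \<le> (f' x - f x) * (g x - g' x)" using elim by simp
      then show ?thesis using False by (simp add: min_def max_def power2_eq_square algebra_simps)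
    qed (simp add: min_def max_def)
  qed
qed

lemma resolvent_contraction:
  assumes \<alpha>: "\<alpha> > 0" and f: "f \<in> L2 M" "f' \<in> L2 M"
    and g: "is_resolvent M E \<alpha> f g" "is_resolvent M E \<alpha> f' g'"
  shows "\<alpha>\<^sup>2 * (\<integral>x. (g x - g' x)\<^sup>2 \<partial>M) \<le> (\<integral>x. (f x - f' x)\<^sup>2 \<partial>M)"
proof -
  have j: "integrable M (\<lambda>x. (g x - g' x)\<^sup>2)" "integrable M (\<lambda>x. (f x - f' x)\<^sup>2)"
    by (intro L2D(2) L2_diff resolvent_L2[OF g(1)] resolvent_L2[OF g(2)] f)+
  have swap: "E g' + E g \<le> E g + E g'" by (simp add: add.commute)
  have "0 \<le> (\<integral>x. (\<alpha> * g x - f x) * (g' x - g x) + (\<alpha> * g' x - f' x) * (g x - g' x) \<partial>M)"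
    by (rule resolvent_variational_pair(2)[OF \<alpha> f g swap])
  also have "\<dots> \<le> (\<integral>x. 1/(2*\<alpha>) * (f x - f' x)\<^sup>2 - \<alpha>/2 * (g x - g' x)\<^sup>2 \<partial>M)"
  proof (rule integral_mono[OF resolvent_variational_pair(1)[OF \<alpha> f g swap]])
    fix x
    define a b where "a = f x - f' x" and "b = g x - g' x"
    have "0 \<le> (a - \<alpha> * b)\<^sup>2" by simp
    then have "2 * \<alpha> * (a * b) \<le> a\<^sup>2 + \<alpha>\<^sup>2 * b\<^sup>2" by (simp add: power2_eq_square algebra_simps)
    then have "a * b \<le> 1/(2*\<alpha>) * a\<^sup>2 + \<alpha>/2 * b\<^sup>2" using \<alpha> by (simp add: field_simps power2_eq_square)
    moreover have "(\<alpha> * g x - f x) * (g' x - g x) + (\<alpha> * g' x - f' x) * (g x - g' x) = a * b - \<alpha> * b\<^sup>2"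
      by (simp add: a_def b_def power2_eq_square algebra_simps)
    ultimately show "(\<alpha> * g x - f x) * (g' x - g x) + (\<alpha> * g' x - f' x) * (g x - g' x)
        \<le> 1/(2*\<alpha>) * (f x - f' x)\<^sup>2 - \<alpha>/2 * (g x - g' x)\<^sup>2" by (simp add: a_def b_def)
  qed (use j in simp)
  also have "\<dots> = 1/(2*\<alpha>) * (\<integral>x. (f x - f' x)\<^sup>2 \<partial>M) - \<alpha>/2 * (\<integral>x. (g x - g' x)\<^sup>2 \<partial>M)" using j by simp
  finally show ?thesis using \<alpha> by (simp add: field_simps power2_eq_square)
qed

lemma resolvent_le_if_form_min_le:
  assumes \<alpha>: "\<alpha> > 0" and f: "f \<in> L2 M" and g: "is_resolvent M E \<alpha> f g"
    and r: "r \<in> borel_measurable M" "AE x in M. 0 \<le> r x" and f_le: "AE x in M. f x \<le> \<alpha> * r x"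
    and cut: "E (\<lambda>x. min (g x) (r x)) \<le> E g"
  shows "AE x in M. g x \<le> r x"
proof (rule AE_le_if_integral_le_neg_pos_part_sq[OF \<alpha>])
  note gL = resolvent_L2[OF g]
  have mL: "(\<lambda>x. min (g x) (r x)) \<in> L2 M" by (rule L2_min_nonneg[OF gL r])
  have "(\<lambda>x. g x - min (g x) (r x)) = (\<lambda>x. max (g x - r x) 0)" by (auto simp: min_def max_def)
  then show "(\<lambda>x. max (g x - r x) 0) \<in> L2 M" using L2_diff[OF gL mL] by simp
  show int: "integrable M (\<lambda>x. (\<alpha> * g x - f x) * (min (g x) (r x) - g x))"
    by (intro L2_mult L2_diff L2_scale gL f mL)
  have fin: "E g < \<infinity>" by (rule resolvent_finite[OF \<alpha> g])
  then have "enn2real (E (\<lambda>x. min (g x) (r x))) \<le> enn2real (E g)" by (intro enn2real_mono cut) simp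
  then show "0 \<le> (\<integral>x. (\<alpha> * g x - f x) * (min (g x) (r x) - g x) \<partial>M)"
    using resolvent_variational[OF \<alpha> f g le_less_trans[OF cut fin]] by simp
  show "AE x in M. (\<alpha> * g x - f x) * (min (g x) (r x) - g x) \<le> - \<alpha> * (max (g x - r x) 0)\<^sup>2"
    using f_le
  proof eventually_elim
    case (elim x)
    show ?case
    proof (cases "g x \<le> r x")
      case False
      then have "0 \<le> (\<alpha> * r x - f x) * (g x - r x)" using elim by simp
      then show ?thesis using False by (simp add: min_def max_def power2_eq_square algebra_simps)
    qed (simp add: min_def max_def)
  qed
qed

lemma ext_resolvent_witness:
  assumes \<alpha>: "\<alpha> > 0" and f: "f \<in> borel_measurable M" and nn: "AE x in M. 0 \<le> f x"
  obtains fs gs where "\<And>n. fs n \<in> L2 M" "\<And>n x. 0 \<le> fs n x"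
    "AE x in M. incseq (\<lambda>n. fs n x)" "AE x in M. (\<lambda>n. fs n x) \<longlonglongrightarrow> f x"
    "\<And>n. is_resolvent M E \<alpha> (fs n) (gs n)"
    "ext_resolvent M E \<alpha> f = (\<lambda>x. SUP n. ennreal (gs n x))"
proof -
  let ?P = "\<lambda>u fs gs. (\<forall>n. fs n \<in> L2 M \<and> (\<forall>x. 0 \<le> fs n x)) \<and>
      (AE x in M. incseq (\<lambda>n. fs n x) \<and> (\<lambda>n. fs n x) \<longlonglongrightarrow> f x) \<and>
      (\<forall>n. is_resolvent M E \<alpha> (fs n) (gs n)) \<and> u = (\<lambda>x. SUP n. ennreal (gs n x))"
  obtain fs where fsL: "\<And>n. fs n \<in> L2 M" and fs0: "\<And>n x. 0 \<le> fs n x"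
    and fs: "AE x in M. incseq (\<lambda>n. fs n x) \<and> (\<lambda>n. fs n x) \<longlonglongrightarrow> f x"
    using incseq_L2_approx[OF f nn] by blast
  have "\<forall>n. \<exists>g. is_resolvent M E \<alpha> (fs n) g" using resolvent_exists[OF \<alpha> fsL] by blast
  from choice[OF this] obtain gs where gs: "\<forall>n. is_resolvent M E \<alpha> (fs n) (gs n)" ..
  then have "?P (\<lambda>x. SUP n. ennreal (gs n x)) fs gs" using fsL fs0 fs by simp
  then have "\<exists>u fs gs. ?P u fs gs" by blast
  from someI_ex[OF this] obtain fs' gs' where "?P (ext_resolvent M E \<alpha> f) fs' gs'"
    unfolding ext_resolvent_def by blast
  then show ?thesis by (intro that[of fs' gs']) auto
qed

lemma excessiveD:
  assumes "excessive M E h"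
  shows "h \<in> borel_measurable M" "AE x in M. 0 \<le> h x"
    and "\<And>\<alpha>. \<alpha> > 0 \<Longrightarrow> AE x in M. ext_resolvent M E \<alpha> (\<lambda>y. \<alpha> * h y) x \<le> ennreal (h x)"
  using assms by (auto simp: excessive_def)

lemma excessive_resolvents_le:
  assumes h: "excessive M E h" and \<alpha>: "\<alpha> > 0"
  obtains p gs where "\<And>n. p n \<in> L2 M" "\<And>n x. 0 \<le> p n x" "AE x in M. (\<lambda>n. p n x) \<longlonglongrightarrow> h x"
    "\<And>n. is_resolvent M E \<alpha> (\<lambda>x. \<alpha> * p n x) (gs n)" "\<And>n. AE x in M. gs n x \<le> h x"
proof -
  have meas: "(\<lambda>x. \<alpha> * h x) \<in> borel_measurable M"
    using excessiveD(1)[OF h] by (intro borel_measurable_times) simp_all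
  have "AE x in M. 0 \<le> \<alpha> * h x" using excessiveD(2)[OF h] \<alpha> by auto
  then obtain fs gs where fs: "\<And>n. fs n \<in> L2 M" "\<And>n x. 0 \<le> fs n x" "AE x in M. (\<lambda>n. fs n x) \<longlonglongrightarrow> \<alpha> * h x"
    and gs: "\<And>n. is_resolvent M E \<alpha> (fs n) (gs n)"
    and ext_eq: "ext_resolvent M E \<alpha> (\<lambda>y. \<alpha> * h y) = (\<lambda>x. SUP n. ennreal (gs n x))"
    by (rule ext_resolvent_witness[OF \<alpha> meas]) blast
  have gs_le: "AE x in M. gs n x \<le> h x" for n
    using excessiveD(3)[OF h \<alpha>] excessiveD(2)[OF h]
  proof eventually_elim
    case (elim x)
    have "ennreal (gs n x) \<le> (SUP n. ennreal (gs n x))" by (rule SUP_upper) simp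
    also have "\<dots> \<le> ennreal (h x)" using elim(1) by (simp add: ext_eq)
    finally show ?case using elim(2) by simp
  qed
  show ?thesis
  proof (rule that[of "\<lambda>n x. fs n x / \<alpha>" gs])
    show "(\<lambda>x. fs n x / \<alpha>) \<in> L2 M" for n by (rule L2_divide[OF fs(1)])
    show "0 \<le> fs n x / \<alpha>" for n x using fs(2) \<alpha> by simp
    show "is_resolvent M E \<alpha> (\<lambda>x. \<alpha> * (fs n x / \<alpha>)) (gs n)" for n using gs[of n] \<alpha> by simp
    show "AE x in M. (\<lambda>n. fs n x / \<alpha>) \<longlonglongrightarrow> h x"
      using fs(3)
    proof eventually_elim
      case (elim x)
      then show ?case using tendsto_divide[OF elim tendsto_const, of \<alpha>] \<alpha> by simp
    qed
  qed (rule gs_le)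
qed

lemma resolvent_le_excessive:
  assumes h: "excessive M E h" and \<alpha>: "\<alpha> > 0" and u: "u \<in> L2 M" and u_le: "AE x in M. u x \<le> h x"
    and z: "is_resolvent M E \<alpha> (\<lambda>x. \<alpha> * u x) z"
  shows "AE x in M. z x \<le> h x"
proof -
  obtain p gs where p: "\<And>n. p n \<in> L2 M" "\<And>n x. 0 \<le> p n x" "AE x in M. (\<lambda>n. p n x) \<longlonglongrightarrow> h x"
    and gs: "\<And>n. is_resolvent M E \<alpha> (\<lambda>x. \<alpha> * p n x) (gs n)" "\<And>n. AE x in M. gs n x \<le> h x"
    by (rule excessive_resolvents_le[OF h \<alpha>]) blast
  note zL = resolvent_L2[OF z]
  let ?d = "\<lambda>x. max (z x - h x) 0"
  have "(\<lambda>x. z x - min (z x) (h x)) = ?d" by (auto simp: min_def max_def)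
  then have dL: "?d \<in> L2 M" using L2_diff[OF zL L2_min_nonneg[OF zL excessiveD(1,2)[OF h]]] by simp
  have bound: "(\<integral>x. (?d x)\<^sup>2 \<partial>M) \<le> (\<integral>x. (u x - min (u x) (p n x))\<^sup>2 \<partial>M)" for n
  proof -
    let ?v = "\<lambda>x. min (u x) (p n x)"
    have vL: "?v \<in> L2 M" by (intro L2_min u p)
    obtain y where y: "is_resolvent M E \<alpha> (\<lambda>x. \<alpha> * ?v x) y"
      using resolvent_exists[OF \<alpha> L2_scale[OF vL]] by blast
    have "AE x in M. y x \<le> gs n x"
      by (rule resolvent_mono[OF \<alpha> L2_scale[OF vL] L2_scale[OF p(1)] _ y gs(1)]) (use \<alpha> in simp)
    then have "AE x in M. y x \<le> h x" using gs(2)[of n] by eventually_elim simp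
    then have "AE x in M. (?d x)\<^sup>2 \<le> (z x - y x)\<^sup>2"
      by eventually_elim (auto simp: max_def intro!: power_mono)
    then have "(\<integral>x. (?d x)\<^sup>2 \<partial>M) \<le> (\<integral>x. (z x - y x)\<^sup>2 \<partial>M)"
      by (intro integral_mono_AE L2D(2)[OF dL] L2D(2)[OF L2_diff[OF zL resolvent_L2[OF y]]])
    moreover have "\<alpha>\<^sup>2 * (\<integral>x. (z x - y x)\<^sup>2 \<partial>M) \<le> (\<integral>x. (\<alpha> * u x - \<alpha> * ?v x)\<^sup>2 \<partial>M)"
      by (rule resolvent_contraction[OF \<alpha> L2_scale[OF u] L2_scale[OF vL] z y])
    moreover have "(\<integral>x. (\<alpha> * u x - \<alpha> * ?v x)\<^sup>2 \<partial>M) = \<alpha>\<^sup>2 * (\<integral>x. (u x - ?v x)\<^sup>2 \<partial>M)"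
      by (simp add: right_diff_distrib[symmetric] power_mult_distrib)
    ultimately show ?thesis using \<alpha> by simp
  qed
  have "(\<integral>x. (?d x)\<^sup>2 \<partial>M) \<le> 0"
    using L2_min_tendsto[OF u L2D(1)[OF p(1)] p(2,3) u_le] bound by (intro LIMSEQ_le_const) auto
  with dL show ?thesis by (rule AE_le_if_integral_pos_part_sq_nonpos)
qed

lemma resolvent_of_truncation_bound:
  assumes h: "excessive M E h" and f: "E f < \<infinity>" and \<alpha>: "0 < \<alpha>"
    and z: "is_resolvent M E \<alpha> (\<lambda>x. \<alpha> * min (f x) (h x)) z"
  shows "enn2real (E z) + \<alpha> * (\<integral>x. (z x - min (f x) (h x))\<^sup>2 \<partial>M) \<le> enn2real (E f)"
proof -
  note fL = form_finite_L2[OF f] and zL = resolvent_L2[OF z]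
  let ?y = "\<lambda>x. min (f x) (h x)"
  have yL: "?y \<in> L2 M" by (rule L2_min_nonneg[OF fL excessiveD(1,2)[OF h]])
  have int: "integrable M (\<lambda>x. (z x - ?y x)\<^sup>2)" by (intro L2D(2) L2_diff zL yL)
  have "AE x in M. z x \<le> h x" by (rule resolvent_le_excessive[OF h \<alpha> yL _ z]) simp
  then have quadratic_le: "AE x in M. (\<alpha> * z x - \<alpha> * ?y x) * (f x - z x) \<le> - \<alpha> * (z x - ?y x)\<^sup>2"
  proof eventually_elim
    case (elim x)
    have "(z x - ?y x) * (f x - ?y x) \<le> 0" using elim by (auto simp: min_def mult_le_0_iff)
    then have "\<alpha> * ((z x - ?y x) * (f x - ?y x)) \<le> 0" using \<alpha> by (simp add: mult_le_0_iff)
    then show ?case by (simp add: power2_eq_square algebra_simps)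
  qed
  have "enn2real (E z) \<le> enn2real (E f) + (\<integral>x. (\<alpha> * z x - \<alpha> * ?y x) * (f x - z x) \<partial>M)"
    by (rule resolvent_variational[OF \<alpha> L2_scale[OF yL] z f])
  also have "(\<integral>x. (\<alpha> * z x - \<alpha> * ?y x) * (f x - z x) \<partial>M) \<le> (\<integral>x. - \<alpha> * (z x - ?y x)\<^sup>2 \<partial>M)"
  proof (rule integral_mono_AE[OF _ _ quadratic_le])
    show "integrable M (\<lambda>x. (\<alpha> * z x - \<alpha> * ?y x) * (f x - z x))"
      by (intro L2_mult L2_diff L2_scale zL yL fL)
    show "integrable M (\<lambda>x. - \<alpha> * (z x - ?y x)\<^sup>2)" using int by simp
  qed
  finally show ?thesis using int by simp
qed

lemma form_min_excessive:
  assumes h: "excessive M E h"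
  shows "E (\<lambda>x. min (f x) (h x)) \<le> E f"
proof (cases "E f < \<infinity>")
  case True
  let ?y = "\<lambda>x. min (f x) (h x)"
  have yL: "?y \<in> L2 M" by (rule L2_min_nonneg[OF form_finite_L2[OF True] excessiveD(1,2)[OF h]])
  have "\<exists>z. is_resolvent M E (real (Suc n)) (\<lambda>x. real (Suc n) * ?y x) z" for n
    using resolvent_exists[OF _ L2_scale[OF yL]] by (metis of_nat_0_less_iff zero_less_Suc)
  then obtain z where z: "\<And>n. is_resolvent M E (real (Suc n)) (\<lambda>x. real (Suc n) * ?y x) (z n)" by metis
  have bound: "enn2real (E (z n)) + real (Suc n) * (\<integral>x. (z n x - ?y x)\<^sup>2 \<partial>M) \<le> enn2real (E f)" for n
    by (rule resolvent_of_truncation_bound[OF h True _ z]) simp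
  have "(\<lambda>n. \<integral>x. (z n x - ?y x)\<^sup>2 \<partial>M) \<longlonglongrightarrow> 0"
  proof (rule tendsto_sandwich[of "\<lambda>n. 0"])
    have "(\<integral>x. (z n x - ?y x)\<^sup>2 \<partial>M) \<le> enn2real (E f) * inverse (real (Suc n))" for n
    proof -
      have "real (Suc n) * (\<integral>x. (z n x - ?y x)\<^sup>2 \<partial>M) \<le> enn2real (E f)"
        using bound[of n] enn2real_nonneg[of "E (z n)"] by linarith
      then show ?thesis by (simp add: field_simps)
    qed
    then show "eventually (\<lambda>n. (\<integral>x. (z n x - ?y x)\<^sup>2 \<partial>M)
        \<le> enn2real (E f) * inverse (real (Suc n))) sequentially"
      by simp
    show "(\<lambda>n. enn2real (E f) * inverse (real (Suc n))) \<longlonglongrightarrow> 0"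
      using tendsto_mult_left[OF LIMSEQ_inverse_real_of_nat, of "enn2real (E f)"] by simp
  qed simp_all
  then have "E ?y \<le> liminf (\<lambda>n. E (z n))" by (rule form_lsc[OF yL resolvent_L2[OF z]])
  also have "\<dots> \<le> E f"
  proof (intro Liminf_le always_eventually allI)
    fix n
    have "0 \<le> real (Suc n) * (\<integral>x. (z n x - ?y x)\<^sup>2 \<partial>M)" by simp
    then have "enn2real (E (z n)) \<le> enn2real (E f)" using bound[of n] by linarith
    then have "ennreal (enn2real (E (z n))) \<le> ennreal (enn2real (E f))" by (rule ennreal_leI)
    moreover have "E (z n) < \<infinity>" by (rule resolvent_finite[OF _ z]) simp
    ultimately show "E (z n) \<le> E f" using True by (simp only: ennreal_enn2real infinity_ennreal_def)
  qed simp
  finally show ?thesis .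
qed (simp flip: less_top)

lemma Ee_min_excessive:
  assumes h: "excessive M E h"
  shows "Ee (\<lambda>x. min (f x) (h x)) \<le> Ee f"
proof -
  have "Ee (\<lambda>x. min (f x) (h x)) \<le> ennreal 1 * Ee f"
  proof (rule Ee_superposition_le)
    show "(\<lambda>x. min (g x) (h x)) \<in> borel_measurable M" if "g \<in> borel_measurable M" for g
      using that excessiveD(1)[OF h] by measurable
    show "isCont (\<lambda>y. min y (h x)) y" for x y by (intro continuous_intros)
  qed (simp_all add: form_min_excessive[OF h])
  then show ?thesis by simp
qed

lemma excessiveI:
  assumes r: "r \<in> borel_measurable M" and nn: "AE x in M. 0 \<le> r x"
    and cut: "\<And>f. Ee (\<lambda>x. min (f x) (r x)) \<le> Ee f"
  shows "excessive M E r"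
  unfolding excessive_def
proof (intro conjI r nn allI impI)
  fix \<alpha> :: real assume \<alpha>: "\<alpha> > 0"
  have meas: "(\<lambda>x. \<alpha> * r x) \<in> borel_measurable M" using r by (intro borel_measurable_times) simp_all
  have "AE x in M. 0 \<le> \<alpha> * r x" using nn \<alpha> by auto
  then obtain fs gs where fs: "\<And>n. fs n \<in> L2 M" "AE x in M. incseq (\<lambda>n. fs n x)"
    "AE x in M. (\<lambda>n. fs n x) \<longlonglongrightarrow> \<alpha> * r x" and gs: "\<And>n. is_resolvent M E \<alpha> (fs n) (gs n)"
    and ext_eq: "ext_resolvent M E \<alpha> (\<lambda>y. \<alpha> * r y) = (\<lambda>x. SUP n. ennreal (gs n x))"
    by (rule ext_resolvent_witness[OF \<alpha> meas]) blast
  have "AE x in M. gs n x \<le> r x" for n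
  proof (rule resolvent_le_if_form_min_le[OF \<alpha> fs(1) gs r nn])
    show "AE x in M. fs n x \<le> \<alpha> * r x" using fs(2,3) by eventually_elim (rule incseq_le)
    note gL = resolvent_L2[OF gs[of n]]
    show "E (\<lambda>x. min (gs n x) (r x)) \<le> E (gs n)"
      using cut[of "gs n"] by (simp add: Ee_L2 gL L2_min_nonneg[OF gL r nn])
  qed
  then have "AE x in M. \<forall>n. gs n x \<le> r x" by (simp add: AE_all_countable)
  then show "AE x in M. ext_resolvent M E \<alpha> (\<lambda>y. \<alpha> * r y) x \<le> ennreal (r x)"
    unfolding ext_eq by eventually_elim (auto intro!: SUP_least ennreal_leI)
qed

end

section \<open>Subcriticality\<close>

context extended_form
begin

lemma resolvent_pairing_le:
  assumes \<alpha>: "0 < \<alpha>" and p: "p \<in> L2 M" and z: "is_resolvent M E \<alpha> p z" and v: "E v < \<infinity>"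
  shows "(\<integral>x. v x * p x \<partial>M) \<le> (\<integral>x. z x * p x \<partial>M) + enn2real (E v) + \<alpha> / 2 * (\<integral>x. (v x)\<^sup>2 \<partial>M)"
proof -
  have expand: "resolvent_energy \<alpha> p u = enn2real (E u) + \<alpha> / 2 * (\<integral>x. (u x)\<^sup>2 \<partial>M) - (\<integral>x. u x * p x \<partial>M)
      + (\<integral>x. (p x)\<^sup>2 \<partial>M) / (2 * \<alpha>)" if u: "u \<in> L2 M" for u
  proof -
    have "\<alpha> / 2 * (a + 2 * - (1 / \<alpha>) * b + (- (1 / \<alpha>))\<^sup>2 * c) = \<alpha> / 2 * a - b + c / (2 * \<alpha>)" for a b c
      using \<alpha> by (simp add: field_simps power2_eq_square)
    then show ?thesis
      using integral_add_scaled_sq[OF u p, of "- (1 / \<alpha>)"] by (simp add: resolvent_energy_def)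
  qed
  have "0 \<le> \<alpha> / 2 * (\<integral>x. (z x)\<^sup>2 \<partial>M)" "0 \<le> enn2real (E z)" using \<alpha> by simp_all
  with resolvent_minimal[OF \<alpha> z v] show ?thesis
    unfolding expand[OF resolvent_L2[OF z]] expand[OF form_finite_L2[OF v]] by linarith
qed

lemma green_finite_imp_resolvents_bounded:
  assumes f: "f \<in> borel_measurable M" "AE x in M. 0 \<le> f x" and fin: "AE x in M. green_op M E f x < \<infinity>"
  obtains fs gs g where "\<And>n k. fs n k \<in> L2 M" "\<And>n k x. 0 \<le> fs n k x" "\<And>n. AE x in M. (\<lambda>k. fs n k x) \<longlonglongrightarrow> f x"
    "\<And>n k. is_resolvent M E (inverse (real (Suc n))) (fs n k) (gs n k)"
    "g \<in> borel_measurable M" "\<And>x. 0 \<le> g x" "\<And>n k. AE x in M. gs n k x \<le> g x"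
proof -
  let ?P = "\<lambda>n fs gs. (\<forall>k. fs k \<in> L2 M) \<and> (\<forall>k x. 0 \<le> fs k x) \<and> (AE x in M. (\<lambda>k. fs k x) \<longlonglongrightarrow> f x) \<and>
      (\<forall>k. is_resolvent M E (inverse (real (Suc n))) (fs k) (gs k)) \<and>
      ext_resolvent M E (inverse (real (Suc n))) f = (\<lambda>x. SUP k. ennreal (gs k x))"
  have "\<forall>n. \<exists>fs gs. ?P n fs gs"
  proof
    fix n
    have "0 < inverse (real (Suc n))" by simp
    then show "\<exists>fs gs. ?P n fs gs" by (rule ext_resolvent_witness[OF _ f]) blast
  qed
  from choice[OF this] obtain fs where "\<forall>n. \<exists>gs. ?P n (fs n) gs" ..
  from choice[OF this] obtain gs where P: "\<forall>n. ?P n (fs n) (gs n)" ..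
  have [measurable]: "gs n k \<in> borel_measurable M" for n k using P L2D(1)[OF resolvent_L2] by blast
  have green: "green_op M E f = (\<lambda>x. SUP n. SUP k. ennreal (gs n k x))"
    unfolding green_op_def using P by (simp add: inverse_eq_divide)
  have "AE x in M. gs n k x \<le> enn2real (green_op M E f x)" for n k
    using fin
  proof eventually_elim
    case (elim x)
    have "ennreal (gs n k x) \<le> (SUP k. ennreal (gs n k x))" by (rule SUP_upper) simp
    also have "\<dots> \<le> green_op M E f x" unfolding green by (rule SUP_upper) simp
    also have "\<dots> = ennreal (enn2real (green_op M E f x))" using elim by simp
    finally show ?case by simp
  qed
  moreover have "(\<lambda>x. enn2real (green_op M E f x)) \<in> borel_measurable M" unfolding green by measurable
  ultimately show ?thesis using P by (intro that[of fs gs "\<lambda>x. enn2real (green_op M E f x)"]) auto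
qed

lemma integral_le_if_resolvents_bounded:
  assumes \<alpha>: "0 < \<alpha>" and fs: "\<And>k. fs k \<in> L2 M" "\<And>k x. 0 \<le> fs k x" "AE x in M. (\<lambda>k. fs k x) \<longlonglongrightarrow> f x"
    and gs: "\<And>k. is_resolvent M E \<alpha> (fs k) (gs k)" "\<And>k. AE x in M. gs k x \<le> g x"
    and \<phi>: "\<phi> \<in> L2 M" "\<And>x. 0 \<le> \<phi> x" "AE x in M. \<phi> x \<le> f x"
    and g: "\<And>x. 0 \<le> g x" and w: "integrable M w" "\<And>x. g x * \<phi> x \<le> w x" and v: "E v < \<infinity>"
  shows "(\<integral>x. v x * \<phi> x \<partial>M) \<le> (\<integral>x. w x \<partial>M) + enn2real (E v) + \<alpha> / 2 * (\<integral>x. (v x)\<^sup>2 \<partial>M)"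
proof (rule LIMSEQ_le_const2)
  let ?p = "\<lambda>k x. min (\<phi> x) (fs k x)"
  have pL: "?p k \<in> L2 M" for k by (intro L2_min \<phi> fs)
  have "(\<integral>x. (?p k x - \<phi> x)\<^sup>2 \<partial>M) = (\<integral>x. (\<phi> x - ?p k x)\<^sup>2 \<partial>M)" for k by (simp add: power2_commute)
  then have "(\<lambda>k. \<integral>x. (?p k x - \<phi> x)\<^sup>2 \<partial>M) \<longlonglongrightarrow> 0"
    using L2_min_tendsto[OF \<phi>(1) L2D(1)[OF fs(1)] fs(2,3) \<phi>(3)] by simp
  then show "(\<lambda>k. \<integral>x. v x * ?p k x \<partial>M) \<longlonglongrightarrow> (\<integral>x. v x * \<phi> x \<partial>M)"
    by (rule L2_tendsto_inner[OF pL \<phi>(1) _ form_finite_L2[OF v]])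
  have "(\<integral>x. v x * ?p k x \<partial>M) \<le> (\<integral>x. w x \<partial>M) + enn2real (E v) + \<alpha> / 2 * (\<integral>x. (v x)\<^sup>2 \<partial>M)" for k
  proof -
    obtain z where z: "is_resolvent M E \<alpha> (?p k) z" using resolvent_exists[OF \<alpha> pL] by blast
    have "AE x in M. z x \<le> gs k x" by (rule resolvent_mono[OF \<alpha> pL fs(1) _ z gs(1)]) simp
    then have "AE x in M. z x * ?p k x \<le> w x"
      using gs(2)[of k]
    proof eventually_elim
      case (elim x)
      have "z x * ?p k x \<le> g x * \<phi> x" using elim g \<phi>(2) fs(2) by (intro mult_mono) auto
      then show ?case using w(2)[of x] by linarith
    qed
    then have "(\<integral>x. z x * ?p k x \<partial>M) \<le> (\<integral>x. w x \<partial>M)"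
      by (rule integral_mono_AE[OF L2_mult[OF resolvent_L2[OF z] pL] w(1)])
    with resolvent_pairing_le[OF \<alpha> pL z v] show ?thesis by linarith
  qed
  then show "\<exists>N. \<forall>k\<ge>N. (\<integral>x. v x * ?p k x \<partial>M) \<le> (\<integral>x. w x \<partial>M) + enn2real (E v) + \<alpha> / 2 * (\<integral>x. (v x)\<^sup>2 \<partial>M)"
    by blast
qed

text \<open>With \<open>g = Gf\<close> the density \<open>\<phi> \<le> f\<close> satisfies \<open>\<integral> \<phi> G\<phi> \<le> \<integral> \<phi> g \<le> \<integral> w\<close>, which bounds the convex
  conjugate of \<open>\<E>\<close> at \<open>\<phi>\<close>.\<close>

lemma subcritical_form_bound:
  assumes "subcritical M E"
  obtains \<phi> C where "\<phi> \<in> L2 M" "\<And>x. 0 \<le> \<phi> x" "AE x in M. 0 < \<phi> x" "0 \<le> C"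
    "\<And>v. E v < \<infinity> \<Longrightarrow> (\<integral>x. v x * \<phi> x \<partial>M) \<le> C + enn2real (E v)"
proof -
  obtain f where f [measurable]: "f \<in> borel_measurable M" and f_pos: "AE x in M. 0 < f x"
    and fin: "AE x in M. green_op M E f x < \<infinity>" using assms by (auto simp: subcritical_def)
  have "AE x in M. 0 \<le> f x" using f_pos by eventually_elim simp
  then obtain fs gs g where fs: "\<And>n k. fs n k \<in> L2 M" "\<And>n k x. 0 \<le> fs n k x"
      "\<And>n. AE x in M. (\<lambda>k. fs n k x) \<longlonglongrightarrow> f x"
    and gs: "\<And>n k. is_resolvent M E (inverse (real (Suc n))) (fs n k) (gs n k)"
    and g [measurable]: "g \<in> borel_measurable M" and g0: "\<And>x. 0 \<le> g x"
    and gs_le: "\<And>n k. AE x in M. gs n k x \<le> g x"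
    by (rule green_finite_imp_resolvents_bounded[OF f _ fin]) blast
  obtain \<phi> where \<phi>: "\<phi> \<in> L2 M" "\<And>x. 0 \<le> \<phi> x" and \<phi>_pos: "AE x in M. 0 < \<phi> x"
    and \<phi>_le: "AE x in M. \<phi> x \<le> f x" "\<And>x. g x * \<phi> x \<le> weight x"
    using weighted_density_exists[OF f f_pos g g0] by blast
  have "(\<integral>x. v x * \<phi> x \<partial>M) \<le> (\<integral>x. weight x \<partial>M) + enn2real (E v)" if v: "E v < \<infinity>" for v
  proof (rule LIMSEQ_le_const)
    let ?a = "(\<integral>x. weight x \<partial>M) + enn2real (E v)" and ?V = "\<integral>x. (v x)\<^sup>2 \<partial>M"
    have "(\<lambda>n. ?a + inverse (real (Suc n)) / 2 * ?V) \<longlonglongrightarrow> ?a + 0 / 2 * ?V"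
      by (intro tendsto_intros LIMSEQ_inverse_real_of_nat) simp
    then show "(\<lambda>n. ?a + inverse (real (Suc n)) / 2 * ?V) \<longlonglongrightarrow> ?a" by simp
    have "(\<integral>x. v x * \<phi> x \<partial>M) \<le> ?a + inverse (real (Suc n)) / 2 * ?V" for n
      by (rule integral_le_if_resolvents_bounded[OF _ fs gs gs_le \<phi> \<phi>_le(1) g0
            weight_integrable \<phi>_le(2) v]) simp
    then show "\<exists>N. \<forall>n\<ge>N. (\<integral>x. v x * \<phi> x \<partial>M) \<le> ?a + inverse (real (Suc n)) / 2 * ?V" by blast
  qed
  moreover have "0 \<le> (\<integral>x. weight x \<partial>M)" using weight_nonneg by simp
  ultimately show ?thesis using \<phi> \<phi>_pos by (intro that)
qed

lemma subcritical_bound: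
  assumes "subcritical M E"
  obtains \<phi> C where "\<phi> \<in> borel_measurable M" "\<And>x. 0 \<le> \<phi> x" "AE x in M. 0 < \<phi> x"
    "\<And>v. (\<integral>\<^sup>+x. ennreal (\<phi> x * \<bar>v x\<bar>) \<partial>M) \<le> ennreal C + Ee v"
proof -
  obtain \<phi> C where \<phi>: "\<phi> \<in> L2 M" "\<And>x. 0 \<le> \<phi> x" "AE x in M. 0 < \<phi> x" and C: "0 \<le> C"
    and bound: "\<And>v. E v < \<infinity> \<Longrightarrow> (\<integral>x. v x * \<phi> x \<partial>M) \<le> C + enn2real (E v)"
    using subcritical_form_bound[OF assms] by blast
  note [measurable] = L2D(1)[OF \<phi>(1)]
  have form_bound: "(\<integral>\<^sup>+x. ennreal (\<phi> x * \<bar>v x\<bar>) \<partial>M) \<le> ennreal C + E v" for v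
  proof (cases "E v < \<infinity>")
    case True
    have fin: "E (\<lambda>x. \<bar>v x\<bar>) < \<infinity>" by (rule le_less_trans[OF E.modular_abs_le True])
    have "(\<integral>\<^sup>+x. ennreal (\<phi> x * \<bar>v x\<bar>) \<partial>M) = ennreal (\<integral>x. \<phi> x * \<bar>v x\<bar> \<partial>M)"
      using L2_mult[OF \<phi>(1) L2_abs[OF form_finite_L2[OF True]]] \<phi>(2)
        by (intro nn_integral_eq_integral) auto
    also have "\<dots> \<le> ennreal (C + enn2real (E (\<lambda>x. \<bar>v x\<bar>)))"
      using bound[OF fin] by (intro ennreal_leI) (simp add: mult.commute)
    also have "\<dots> = ennreal C + E (\<lambda>x. \<bar>v x\<bar>)" using C fin by (simp add: ennreal_plus)
    also have "\<dots> \<le> ennreal C + E v" by (intro add_left_mono E.modular_abs_le)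
    finally show ?thesis .
  qed (simp flip: less_top)
  have "(\<integral>\<^sup>+x. ennreal (\<phi> x * \<bar>v x\<bar>) \<partial>M) \<le> ennreal C + Ee v" for v
  proof (cases "Ee v < \<infinity>")
    case True
    obtain gs where gs: "\<And>k. gs k \<in> L2 M" "(\<lambda>k. E (gs k)) \<longlonglongrightarrow> Ee v" "AE x in M. (\<lambda>k. gs k x) \<longlonglongrightarrow> v x"
      using recovery_sequence[OF True] by blast
    note [measurable] = L2D(1)[OF gs(1)]
    have "AE x in M. (\<lambda>k. ennreal (\<phi> x * \<bar>gs k x\<bar>)) \<longlonglongrightarrow> ennreal (\<phi> x * \<bar>v x\<bar>)"
      using gs(3) by eventually_elim (intro tendsto_intros)
    then have "(\<integral>\<^sup>+x. ennreal (\<phi> x * \<bar>v x\<bar>) \<partial>M) \<le> liminf (\<lambda>k. \<integral>\<^sup>+x. ennreal (\<phi> x * \<bar>gs k x\<bar>) \<partial>M)"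
      by (intro nn_integral_lim_le_liminf) auto
    also have "\<dots> \<le> liminf (\<lambda>k. ennreal C + E (gs k))" using form_bound by (intro Liminf_mono) simp
    also have "\<dots> = ennreal C + Ee v" by (intro lim_imp_Liminf tendsto_intros gs(2)) simp
    finally show ?thesis .
  qed (simp flip: less_top)
  with L2D(1)[OF \<phi>(1)] \<phi>(2,3) show ?thesis by (rule that)
qed

end

section \<open>Obstacle problems\<close>

lemma Min_atMost_tendsto_INF:
  fixes w :: "nat \<Rightarrow> real"
  assumes bdd: "bdd_below (range w)"
  shows "(\<lambda>p. MIN k\<in>{..p}. w k) \<longlonglongrightarrow> (INF k. w k)"
proof -
  let ?m = "\<lambda>p. MIN k\<in>{..p}. w k"
  have INF_le_Min: "(INF k. w k) \<le> ?m p" for p using bdd by (intro Min.boundedI) (auto intro: cINF_lower)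
  have bdd_m: "bdd_below (range ?m)" by (rule bdd_belowI2[where m = "INF k. w k"]) (rule INF_le_Min)
  have "decseq ?m" by (intro decseq_SucI) (simp add: atMost_Suc)
  with bdd_m have "?m \<longlonglongrightarrow> (INF p. ?m p)" by (rule LIMSEQ_decseq_INF)
  also have "(INF p. ?m p) = (INF k. w k)"
  proof (rule antisym)
    show "(INF p. ?m p) \<le> (INF k. w k)"
    proof (rule cINF_greatest)
      fix k
      have "(INF p. ?m p) \<le> ?m k" by (rule cINF_lower[OF bdd_m]) simp
      also have "\<dots> \<le> w k" by simp
      finally show "(INF p. ?m p) \<le> w k" .
    qed simp
    show "(INF k. w k) \<le> (INF p. ?m p)" by (intro cINF_greatest INF_le_Min) simp
  qed
  finally show ?thesis .
qed

lemma ennreal_le_of_add_le_add: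
  fixes a b c d :: ennreal
  assumes "a + b \<le> c + d" "d \<le> b" "d < \<infinity>"
  shows "a \<le> c"
proof -
  have "a + d \<le> c + d" using add_left_mono[OF assms(2), of a] assms(1) by (rule order_trans)
  then have "d + a \<le> d + c" by (simp add: add.commute)
  then show ?thesis using assms(3) by (subst (asm) ennreal_add_left_cancel_le) auto
qed

lemma suminf_ennreal_half_powers: "(\<Sum>k. ennreal ((1/2) ^ (n + k))) = ennreal (2 * (1/2) ^ n)"
proof (rule suminf_ennreal_eq)
  have "(\<lambda>k. (1/2) ^ n * (1/2) ^ k :: real) sums ((1/2) ^ n * (1 / (1 - 1/2)))"
    by (intro sums_mult geometric_sums) simp
  then show "(\<lambda>k. (1/2) ^ (n + k) :: real) sums (2 * (1/2) ^ n)" by (simp add: power_add mult.commute)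
qed simp

lemma half_powers_tendsto: "(\<lambda>n. ennreal (2 * (1/2) ^ n)) \<longlonglongrightarrow> 0"
proof -
  have "(\<lambda>n. ennreal (2 * (1/2) ^ n)) \<longlonglongrightarrow> ennreal (2 * 0)"
    by (intro tendsto_intros LIMSEQ_realpow_zero) simp_all
  then show ?thesis by simp
qed

lemma ennreal_eq_0_if_multiples_bounded:
  fixes a :: ennreal
  assumes multiples_le: "\<And>n. ennreal (real n) * a \<le> ennreal c"
  shows "a = 0"
proof -
  have "a \<le> ennreal c" using multiples_le[of 1] by simp
  then obtain r where r: "a = ennreal r" "0 \<le> r" by (cases a) (auto simp: top_unique)
  have "\<not> 0 < r"
  proof
    assume "0 < r"
    then obtain n where n: "max c 0 < real n * r" using ex_less_of_nat_mult by blast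
    have "ennreal (real n * r) \<le> ennreal c" using multiples_le[of n] r by (simp add: ennreal_mult)
    also have "\<dots> \<le> ennreal (max c 0)" by (intro ennreal_leI) simp
    finally show False using n by (simp add: ennreal_le_iff2)
  qed
  then show ?thesis using r by simp
qed

context extended_form
begin

text \<open>Submodularity: taking the minimum with \<open>v\<^sub>k\<close> costs at most the excess of \<open>v\<^sub>k\<close> over \<open>I\<close>.\<close>

lemma Ee_Min_le:
  fixes v :: "nat \<Rightarrow> 'a \<Rightarrow> real" and a :: "nat \<Rightarrow> ennreal"
  assumes v [measurable]: "\<And>k. v k \<in> borel_measurable M" and I: "I < \<infinity>"
    and upper: "\<And>f k. f \<in> borel_measurable M \<Longrightarrow> I \<le> Ee (\<lambda>x. max (f x) (v k x))"
    and energy_le: "\<And>k. Ee (v k) \<le> I + a k"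
  shows "Ee (\<lambda>x. MIN k\<in>{..p}. v k x) \<le> I + (\<Sum>k\<le>p. a k)"
proof (induction p)
  case 0
  show ?case using energy_le[of 0] by simp
next
  case (Suc p)
  let ?m = "\<lambda>x. MIN k\<in>{..p}. v k x"
  have m: "?m \<in> borel_measurable M" by (intro borel_measurable_Min) auto
  have "Ee (\<lambda>x. min (?m x) (v (Suc p) x)) + Ee (\<lambda>x. max (?m x) (v (Suc p) x)) \<le> Ee ?m + Ee (v (Suc p))"
    by (rule Ee_min_max)
  also have "\<dots> \<le> (I + (\<Sum>k\<le>p. a k)) + (I + a (Suc p))" by (intro add_mono Suc.IH energy_le)
  also have "\<dots> = (I + (\<Sum>k\<le>Suc p. a k)) + I" by (simp add: ac_simps)
  finally have "Ee (\<lambda>x. min (?m x) (v (Suc p) x)) \<le> I + (\<Sum>k\<le>Suc p. a k)"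
    by (rule ennreal_le_of_add_le_add[OF _ upper[OF m] I])
  then show ?case by (simp add: atMost_Suc min.commute del: sum.atMost_Suc)
qed

lemma Ee_INF_le:
  fixes v :: "nat \<Rightarrow> 'a \<Rightarrow> real" and a :: "nat \<Rightarrow> ennreal"
  assumes v [measurable]: "\<And>k. v k \<in> borel_measurable M" and bdd: "\<And>x. bdd_below (range (\<lambda>k. v k x))"
    and I: "I < \<infinity>" and upper: "\<And>f k. f \<in> borel_measurable M \<Longrightarrow> I \<le> Ee (\<lambda>x. max (f x) (v k x))"
    and energy_le: "\<And>k. Ee (v k) \<le> I + a k"
  shows "Ee (\<lambda>x. INF k. v k x) \<le> I + (\<Sum>k. a k)"
proof (rule Ee_le_if_AE_tendsto)
  show "AE x in M. (\<lambda>p. MIN k\<in>{..p}. v k x) \<longlonglongrightarrow> (INF k. v k x)"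
    using Min_atMost_tendsto_INF[OF bdd] by simp
  show "Ee (\<lambda>x. MIN k\<in>{..p}. v k x) \<le> I + (\<Sum>k. a k)" for p
  proof -
    have "Ee (\<lambda>x. MIN k\<in>{..p}. v k x) \<le> I + (\<Sum>k\<le>p. a k)" by (rule Ee_Min_le[OF v I upper energy_le])
    also have "\<dots> \<le> I + (\<Sum>k. a k)" by (intro add_left_mono sum_le_suminf) auto
    finally show ?thesis .
  qed
qed measurable

lemma Ee_SUP_le:
  fixes v :: "nat \<Rightarrow> 'a \<Rightarrow> real"
  assumes v: "\<And>k. v k \<in> borel_measurable M" and bdd: "\<And>x. bdd_above (range (\<lambda>k. v k x))"
  shows "Ee (\<lambda>x. SUP k. v k x) \<le> (\<Sum>k. Ee (v k))"
proof -
  have "(SUP k. v k x) = - (INF k. - v k x)" for x by (simp add: Inf_real_def image_image)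
  then have "Ee (\<lambda>x. SUP k. v k x) = Ee (\<lambda>x. INF k. - v k x)" by (simp add: Ee_minus)
  also have "\<dots> \<le> 0 + (\<Sum>k. Ee (v k))"
  proof (rule Ee_INF_le)
    show "bdd_below (range (\<lambda>k. - v k x))" for x
      using bdd[of x] by (auto simp: bdd_above_def bdd_below_def) (metis neg_le_iff_le)
  qed (use v in \<open>simp_all add: Ee_minus\<close>)
  finally show ?thesis by simp
qed

definition obstacle_energy :: "('a \<Rightarrow> real) \<Rightarrow> ennreal" where
  "obstacle_energy \<psi> = (INF v\<in>{v \<in> borel_measurable M. \<forall>x. \<psi> x \<le> v x}. Ee v)"

lemma obstacle_energy_le:
  "v \<in> borel_measurable M \<Longrightarrow> (\<And>x. \<psi> x \<le> v x) \<Longrightarrow> obstacle_energy \<psi> \<le> Ee v"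
  unfolding obstacle_energy_def by (intro INF_lower) simp

text \<open>The tails of a minimizing sequence have infima whose energies still tend to the infimum, and these
  infima increase.\<close>

lemma obstacle_minimizing_incseq:
  assumes fin: "obstacle_energy \<psi> < \<infinity>"
  obtains u :: "nat \<Rightarrow> 'a \<Rightarrow> real" where "\<And>n. u n \<in> borel_measurable M" "\<And>n x. \<psi> x \<le> u n x"
    "\<And>x. incseq (\<lambda>n. u n x)" "\<And>n. Ee (u n) \<le> obstacle_energy \<psi> + ennreal (2 * (1/2) ^ n)"
proof -
  have "\<exists>v\<in>{v \<in> borel_measurable M. \<forall>x. \<psi> x \<le> v x}.
      Ee v < obstacle_energy \<psi> + ennreal ((1/2) ^ k)" for k :: nat
    unfolding INF_less_iff[symmetric] obstacle_energy_def[symmetric]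
    using fin by (simp add: ennreal_add_left_cancel_less)
  then obtain v where v [measurable]: "\<And>k. v k \<in> borel_measurable M" and v\<psi>: "\<And>k x. \<psi> x \<le> v k x"
    and vE: "\<And>k. Ee (v k) < obstacle_energy \<psi> + ennreal ((1/2) ^ k)"
      by (metis (no_types, lifting) mem_Collect_eq)
  have bdd: "bdd_below (range (\<lambda>k. v (n + k) x))" for n x by (rule bdd_belowI2) (rule v\<psi>)
  define u where "u n x = (INF k. v (n + k) x)" for n x
  have u: "u n \<in> borel_measurable M" for n unfolding u_def by measurable
  have u_inc: "incseq (\<lambda>n. u n x)" for x
  proof (rule incseq_SucI)
    fix n
    have "u n x \<le> v (Suc n + k) x" for k
      unfolding u_def using cINF_lower[OF bdd[of n x], of "Suc k"] by simp
    then show "u n x \<le> u (Suc n) x" unfolding u_def[of "Suc n"] by (intro cINF_greatest) auto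
  qed
  have u\<psi>: "\<psi> x \<le> u n x" for n x unfolding u_def by (intro cINF_greatest v\<psi>) simp
  have "Ee (u n) \<le> obstacle_energy \<psi> + ennreal (2 * (1/2) ^ n)" for n
    unfolding u_def suminf_ennreal_half_powers[symmetric]
    using v\<psi>
      by (intro Ee_INF_le bdd fin obstacle_energy_le less_imp_le[OF vE]) (auto simp: le_max_iff_disj)
  with u u\<psi> u_inc show ?thesis by (rule that)
qed

end

locale delta2_form = extended_form +
  assumes d2: "delta2_condition E"
begin

sublocale E: doubling_modular E
  by unfold_locales (rule d2)

lemma Ee_delta2: "delta2_condition Ee"
proof -
  obtain K where K: "\<And>f. E (\<lambda>x. 2 * f x) \<le> ennreal K * E f" using d2 by (auto simp: delta2_condition_def)
  have "E (\<lambda>x. 2 * f x) \<le> ennreal (max K 1) * E f" for f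
    by (rule order_trans[OF K]) (intro mult_right_mono ennreal_leI, auto)
  then have "Ee (\<lambda>x. 2 * f x) \<le> ennreal (max K 1) * Ee f" for f
    by (intro Ee_superposition_le[where \<tau> = "\<lambda>x y. 2 * y"]) auto
  then show ?thesis unfolding delta2_condition_def by blast
qed

sublocale Ee: doubling_modular Ee
  by unfold_locales (rule Ee_delta2)

end

locale subcritical_form = delta2_form +
  assumes subcrit: "subcritical M E"
begin

lemma Ee_eq_0_imp_AE_zero:
  assumes u: "Ee u = 0"
  shows "AE x in M. u x = 0"
proof -
  have [measurable]: "u \<in> borel_measurable M" using u by (intro Ee_finite_measurable) simp
  obtain \<phi> C where \<phi> [measurable]: "\<phi> \<in> borel_measurable M" and \<phi>0: "\<And>x. 0 \<le> \<phi> x"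
    and \<phi>pos: "AE x in M. 0 < \<phi> x"
    and bound: "\<And>v. (\<integral>\<^sup>+x. ennreal (\<phi> x * \<bar>v x\<bar>) \<partial>M) \<le> ennreal C + Ee v"
    using subcritical_bound[OF subcrit] by blast
  have "ennreal (real n) * (\<integral>\<^sup>+x. ennreal (\<phi> x * \<bar>u x\<bar>) \<partial>M) \<le> ennreal C" for n :: nat
  proof -
    obtain B where "\<And>f. Ee (\<lambda>x. real n * f x) \<le> ennreal B * Ee f"
      using Ee.modular_scale_bound[of "real n"] by blast
    then have "Ee (\<lambda>x. real n * u x) = 0" using u by (metis le_zero_eq mult_zero_right)
    have "ennreal (real n) * (\<integral>\<^sup>+x. ennreal (\<phi> x * \<bar>u x\<bar>) \<partial>M)
        = (\<integral>\<^sup>+x. ennreal (real n) * ennreal (\<phi> x * \<bar>u x\<bar>) \<partial>M)"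
      by (rule nn_integral_cmult[symmetric]) simp
    also have "\<dots> = (\<integral>\<^sup>+x. ennreal (\<phi> x * \<bar>real n * u x\<bar>) \<partial>M)"
      using \<phi>0 by (intro nn_integral_cong) (simp add: ennreal_mult[symmetric] abs_mult mult.left_commute)
    also have "\<dots> \<le> ennreal C + Ee (\<lambda>x. real n * u x)" by (rule bound)
    finally show ?thesis using \<open>Ee (\<lambda>x. real n * u x) = 0\<close> by simp
  qed
  then have "(\<integral>\<^sup>+x. ennreal (\<phi> x * \<bar>u x\<bar>) \<partial>M) = 0" by (rule ennreal_eq_0_if_multiples_bounded)
  then have "AE x in M. ennreal (\<phi> x * \<bar>u x\<bar>) = 0" by (subst (asm) nn_integral_0_iff_AE) auto
  then show ?thesis using \<phi>pos
  proof eventually_elim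
    case (elim x)
    then have "\<phi> x * \<bar>u x\<bar> \<le> 0" by (simp add: ennreal_eq_0_iff)
    then show ?case using elim(2) by (simp add: mult_le_0_iff)
  qed
qed

lemma AE_convergent_if_Ee_bounded:
  assumes v [measurable]: "\<And>n. v n \<in> borel_measurable M" and bd: "\<And>n. Ee (v n) \<le> ennreal c"
    and inc: "\<And>x. incseq (\<lambda>n. v n x)" and nn: "AE x in M. 0 \<le> v 0 x"
  shows "AE x in M. (\<lambda>n. v n x) \<longlonglongrightarrow> lim (\<lambda>n. v n x)"
proof -
  obtain \<phi> C where \<phi> [measurable]: "\<phi> \<in> borel_measurable M" and \<phi>0: "\<And>x. 0 \<le> \<phi> x"
    and \<phi>pos: "AE x in M. 0 < \<phi> x"
    and bound: "\<And>v. (\<integral>\<^sup>+x. ennreal (\<phi> x * \<bar>v x\<bar>) \<partial>M) \<le> ennreal C + Ee v"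
    using subcritical_bound[OF subcrit] by blast
  have mono: "\<bar>v n x\<bar> \<le> \<bar>v m x\<bar>" if "0 \<le> v 0 x" "n \<le> m" for n m x
    using that incseqD[OF inc[of x], of 0 n] incseqD[OF inc[of x] that(2)] by auto
  have "(\<integral>\<^sup>+x. (SUP n. ennreal (\<phi> x * \<bar>v n x\<bar>)) \<partial>M) = (SUP n. \<integral>\<^sup>+x. ennreal (\<phi> x * \<bar>v n x\<bar>) \<partial>M)"
  proof (rule nn_integral_monotone_convergence_SUP_AE)
    show "AE x in M. ennreal (\<phi> x * \<bar>v n x\<bar>) \<le> ennreal (\<phi> x * \<bar>v (Suc n) x\<bar>)" for n
      using nn by eventually_elim (intro ennreal_leI mult_left_mono mono \<phi>0, auto)
  qed simp
  also have "\<dots> \<le> ennreal C + ennreal c"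
    by (intro SUP_least order_trans[OF bound add_left_mono[OF bd]])
  also have "\<dots> < \<infinity>" by simp
  finally have "AE x in M. (SUP n. ennreal (\<phi> x * \<bar>v n x\<bar>)) \<noteq> \<infinity>"
    by (intro nn_integral_noteq_infinite) auto
  then show ?thesis using nn \<phi>pos
  proof eventually_elim
    case (elim x)
    then obtain r where r: "(SUP n. ennreal (\<phi> x * \<bar>v n x\<bar>)) = ennreal r" "0 \<le> r"
      by (cases "SUP n. ennreal (\<phi> x * \<bar>v n x\<bar>)") auto
    have "v n x \<le> r / \<phi> x" for n
    proof -
      have "ennreal (\<phi> x * \<bar>v n x\<bar>) \<le> ennreal r" unfolding r(1)[symmetric] by (rule SUP_upper) simp
      then have "\<phi> x * \<bar>v n x\<bar> \<le> r" using r by simp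
      then have "\<bar>v n x\<bar> \<le> r / \<phi> x" using elim by (simp add: field_simps)
      then show ?thesis by simp
    qed
    then obtain L where "(\<lambda>n. v n x) \<longlonglongrightarrow> L" using incseq_convergent[OF inc] by blast
    then have "convergent (\<lambda>n. v n x)" by (rule convergentI)
    then show ?case by (simp add: convergent_LIMSEQ_iff)
  qed
qed

lemma obstacle_minimizer:
  assumes \<psi>: "\<psi> \<in> borel_measurable M" and nn: "AE x in M. 0 \<le> \<psi> x" and fin: "Ee \<psi> < \<infinity>"
  obtains r where "r \<in> borel_measurable M" "\<And>x. \<psi> x \<le> r x" "Ee r < \<infinity>"
    "\<And>f. f \<in> borel_measurable M \<Longrightarrow> (\<And>x. \<psi> x \<le> f x) \<Longrightarrow> Ee r \<le> Ee f"
proof -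
  let ?I = "obstacle_energy \<psi>"
  have I_fin: "?I < \<infinity>" by (rule le_less_trans[OF obstacle_energy_le[OF \<psi> order_refl] fin])
  obtain u where u [measurable]: "\<And>n. u n \<in> borel_measurable M" and u\<psi>: "\<And>n x. \<psi> x \<le> u n x"
    and u_inc: "\<And>x. incseq (\<lambda>n. u n x)" and uE: "\<And>n. Ee (u n) \<le> ?I + ennreal (2 * (1/2) ^ n)"
    using obstacle_minimizing_incseq[OF I_fin] by blast
  have u_bounded: "Ee (u n) \<le> ennreal (enn2real ?I + 2)" for n
  proof -
    have "Ee (u n) \<le> ?I + ennreal 2"
      by (rule order_trans[OF uE]) (intro add_left_mono ennreal_leI, simp add: power_le_one)
    also have "\<dots> = ennreal (enn2real ?I + 2)" using I_fin by (simp add: ennreal_plus)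
    finally show ?thesis .
  qed
  have "AE x in M. 0 \<le> u 0 x" using nn by eventually_elim (rule order_trans[OF _ u\<psi>])
  then have lim: "AE x in M. (\<lambda>n. u n x) \<longlonglongrightarrow> lim (\<lambda>n. u n x)"
    by (rule AE_convergent_if_Ee_bounded[OF u u_bounded u_inc])
  define r where "r x = max (\<psi> x) (lim (\<lambda>n. u n x))" for x
  have r: "r \<in> borel_measurable M" unfolding r_def using \<psi> by measurable
  from lim have "AE x in M. (\<lambda>n. u n x) \<longlonglongrightarrow> r x"
  proof eventually_elim
    case (elim x)
    have "\<psi> x \<le> lim (\<lambda>n. u n x)" using u\<psi> by (intro LIMSEQ_le_const[OF elim]) auto
    then show ?case using elim by (simp add: r_def max_def)
  qed
  then have "Ee r \<le> liminf (\<lambda>n. Ee (u n))" by (rule Ee_lsc[OF r])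
  also have "\<dots> \<le> liminf (\<lambda>n. ?I + ennreal (2 * (1/2) ^ n))" using uE by (intro Liminf_mono) simp
  also have "\<dots> = ?I"
    using tendsto_add[OF tendsto_const half_powers_tendsto, of ?I] by (intro lim_imp_Liminf) simp_all
  finally have "Ee r \<le> ?I" .
  then show ?thesis using obstacle_energy_le I_fin
    by (intro that[OF r]) (auto simp: r_def intro: order_trans le_less_trans)
qed

lemma excessive_majorant:
  assumes \<psi>: "\<psi> \<in> borel_measurable M" "AE x in M. 0 \<le> \<psi> x" "Ee \<psi> < \<infinity>"
  obtains r where "excessive M E r" "Ee r < \<infinity>" "\<And>x. \<psi> x \<le> r x"
proof -
  obtain r where r [measurable]: "r \<in> borel_measurable M" and r\<psi>: "\<And>x. \<psi> x \<le> r x" and fin: "Ee r < \<infinity>"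
    and minimal: "\<And>f. f \<in> borel_measurable M \<Longrightarrow> (\<And>x. \<psi> x \<le> f x) \<Longrightarrow> Ee r \<le> Ee f"
    using obstacle_minimizer[OF \<psi>] by blast
  have "excessive M E r"
  proof (rule excessiveI[OF r])
    show "AE x in M. 0 \<le> r x" using \<psi>(2) by eventually_elim (rule order_trans[OF _ r\<psi>])
    show "Ee (\<lambda>x. min (f x) (r x)) \<le> Ee f" for f
    proof (cases "Ee f < \<infinity>")
      case True
      then have [measurable]: "f \<in> borel_measurable M" by (rule Ee_finite_measurable)
      have "Ee r \<le> Ee (\<lambda>x. max (f x) (r x))"
        by (intro minimal) (auto simp: le_max_iff_disj r\<psi>)
      from ennreal_le_of_add_le_add[OF Ee_min_max this fin] show ?thesis .
    qed (simp flip: less_top)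
  qed
  then show ?thesis using fin r\<psi> by (rule that)
qed

lemma increasing_excessive_majorants:
  assumes h [measurable]: "h \<in> borel_measurable M" and nn: "AE x in M. 0 \<le> h x" and fin: "Ee h < \<infinity>"
  obtains H :: "nat \<Rightarrow> 'a \<Rightarrow> real" where "\<And>N. excessive M E (H N)" "\<And>N. Ee (H N) < \<infinity>"
    "\<And>N x. real N * h x \<le> H N x" "\<And>N x. H N x \<le> H (Suc N) x"
proof -
  let ?P = "\<lambda>N r. excessive M E r \<and> Ee r < \<infinity> \<and> (\<forall>x. real N * h x \<le> r x)"
  have "\<exists>H. \<forall>N. ?P N (H N) \<and> (\<forall>x. H N x \<le> H (Suc N) x)"
  proof (rule dependent_nat_choice)
    show "\<exists>r. ?P 0 r"
      by (rule excessive_majorant[of "\<lambda>x. 0"]) (auto simp: Ee.modular_zero)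
    fix r N assume r: "?P N r"
    let ?\<psi> = "\<lambda>x. max (real (Suc N) * h x) (r x)"
    have "Ee ?\<psi> \<le> Ee (\<lambda>x. real (Suc N) * h x) + Ee r" by (rule Ee.modular_max_le)
    also have "\<dots> < \<infinity>" using r Ee.modular_scale_finite[OF fin] by simp
    finally have fin_\<psi>: "Ee ?\<psi> < \<infinity>" .
    then have meas: "?\<psi> \<in> borel_measurable M" by (rule Ee_finite_measurable)
    have "AE x in M. 0 \<le> ?\<psi> x" using nn by eventually_elim (simp add: max.coboundedI1)
    then obtain r' where r': "excessive M E r'" "Ee r' < \<infinity>" "\<And>x. ?\<psi> x \<le> r' x"
      using excessive_majorant[OF meas _ fin_\<psi>] by blast
    then show "\<exists>r'. ?P (Suc N) r' \<and> (\<forall>x. r x \<le> r' x)" by (intro exI[of _ r']) auto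
  qed
  then obtain H where "\<And>N. ?P N (H N) \<and> (\<forall>x. H N x \<le> H (Suc N) x)" by blast
  then show ?thesis by (intro that[of H]) auto
qed

end

section \<open>Nests and capacities\<close>

lemma hull_tails_tendsto:
  fixes u g :: "nat \<Rightarrow> 'b \<Rightarrow> real"
  assumes g: "\<And>j. g j \<in> fun_convex hull (u ` {j..})" and lim: "(\<lambda>n. u n x) \<longlonglongrightarrow> l"
  shows "(\<lambda>j. g j x) \<longlonglongrightarrow> l"
proof (rule metric_LIMSEQ_I)
  fix e :: real assume "0 < e"
  then obtain N where N: "\<And>n. N \<le> n \<Longrightarrow> u n x \<in> ball l e"
    using metric_LIMSEQ_D[OF lim] by (force simp: dist_commute)
  have "t * a + (1 - t) * b \<in> ball l e" if "a \<in> ball l e" "b \<in> ball l e" "0 \<le> t" "t \<le> 1" for a b t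
    using convexD[OF convex_ball that(1,2), of t "1 - t"] that(3,4) by simp
  then have "fun_convex {f. f x \<in> ball l e}" by (simp add: fun_convex_def del: mem_ball)
  then have "fun_convex hull (u ` {j..}) \<subseteq> {f. f x \<in> ball l e}" if "N \<le> j" for j
    using N that by (intro hull_minimal) auto
  then have "dist (g j x) l < e" if "N \<le> j" for j using g[of j] that by (auto simp: dist_commute)
  then show "\<exists>no. \<forall>n\<ge>no. dist (g n x) l < e" by blast
qed

lemma AE_min_tendsto_if_large:
  fixes g h :: "'a \<Rightarrow> real"
  assumes h: "AE x in M. 0 < h x" and large: "\<And>N. AE x in M. real N * h x \<le> H N x"
  shows "AE x in M. (\<lambda>N. min (g x) (H N x)) \<longlonglongrightarrow> g x"
proof -
  have "AE x in M. \<forall>N. real N * h x \<le> H N x" using large by (simp add: AE_all_countable)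
  then show ?thesis using h
  proof eventually_elim
    case (elim x)
    obtain k where k: "g x < real k * h x" using ex_less_of_nat_mult[OF elim(2)] by blast
    have "min (g x) (H N x) = g x" if "k \<le> N" for N
    proof -
      have "real k * h x \<le> real N * h x" using that elim(2) by (intro mult_right_mono) auto
      also have "\<dots> \<le> H N x" using elim(1) by blast
      finally show ?thesis using k by simp
    qed
    then show ?case by (intro tendsto_eventually eventually_sequentiallyI[of k])
  qed
qed

lemma capacity_le:
  assumes "f \<in> borel_measurable M" "open U" "A \<subseteq> U" "AE x in M. x \<in> U \<longrightarrow> h x \<le> f x"
  shows "capacity M E h A \<le> E_ext M E f"
  unfolding capacity_def using assms by (intro Inf_lower) blast

lemma capacity_lessE:
  assumes "capacity M E h A < c"
  obtains f U where "f \<in> borel_measurable M" "open U" "A \<subseteq> U" "AE x in M. x \<in> U \<longrightarrow> h x \<le> f x"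
      "E_ext M E f < c"
  using assms unfolding capacity_def Inf_less_iff by blast

lemma capacities_zero_approx:
  assumes "\<And>k. capacity M E (H k) A = 0"
  obtains f U where "\<And>k. open (U k)" "\<And>k. A \<subseteq> U k" "\<And>k. AE x in M. x \<in> U k \<longrightarrow> H k x \<le> f k x"
    "\<And>k. E_ext M E (f k) \<le> ennreal ((1/2) ^ k)"
proof -
  have "\<forall>k. \<exists>f U. open U \<and> A \<subseteq> U \<and> (AE x in M. x \<in> U \<longrightarrow> H k x \<le> f x) \<and> E_ext M E f < ennreal ((1/2) ^ k)"
  proof
    fix k
    have "capacity M E (H k) A < ennreal ((1/2) ^ k)" by (simp add: assms)
    then show "\<exists>f U. open U \<and> A \<subseteq> U \<and> (AE x in M. x \<in> U \<longrightarrow> H k x \<le> f x)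
        \<and> E_ext M E f < ennreal ((1/2) ^ k)"
      by (rule capacity_lessE) blast
  qed
  then obtain f U where "\<And>k. open (U k) \<and> A \<subseteq> U k \<and> (AE x in M. x \<in> U k \<longrightarrow> H k x \<le> f k x) \<and>
      E_ext M E (f k) < ennreal ((1/2) ^ k)" unfolding choice_iff by blast
  then show ?thesis by (intro that[of U f]) (auto intro: less_imp_le)
qed

lemma (in extended_form) modular_space_imp_L2:
  assumes f: "f \<in> modular_space E"
  shows "f \<in> L2 M"
proof -
  define l where "l = lux_norm E f + 1"
  have l: "0 < l" using lux_norm_nonneg[of E f] by (simp add: l_def)
  have "E (\<lambda>x. f x / l) \<le> 1" by (rule E.modular_le_1_if_lux_norm_less[OF f]) (simp add: l_def)
  then have "E (\<lambda>x. f x / l) < \<infinity>" by (rule le_less_trans) simp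
  then have "(\<lambda>x. f x / l) \<in> L2 M" by (rule form_finite_L2)
  from L2_scale[OF this, of l] show ?thesis using l by simp
qed

lemma (in extended_form) reflexive_convex_approx:
  assumes refl: "reflexive_form E" and u: "\<And>n. E (u n) \<le> ennreal c"
    and v [measurable]: "v \<in> borel_measurable M" and lim: "AE x in M. (\<lambda>n. u n x) \<longlonglongrightarrow> v x" and \<delta>: "0 < \<delta>"
  obtains g where "g \<in> fun_convex hull (range u)" "Ee (\<lambda>x. v x - g x) \<le> ennreal \<delta>"
proof -
  define \<epsilon> where "\<epsilon> = min 1 \<delta> / 4"
  have \<epsilon>: "0 < \<epsilon>" "2 * \<epsilon> \<le> 1" "4 * \<epsilon> \<le> \<delta>" using \<delta> by (auto simp: \<epsilon>_def)
  obtain v' g where v': "v' \<in> modular_space E" and g: "\<And>j. g j \<in> fun_convex hull (u ` {j..})"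
    and less: "\<And>j. lux_norm E (\<lambda>x. g j x - v' x) < \<epsilon>"
    by (rule E.reflexive_hull_approx[of u c, OF refl u \<epsilon>(1)], rule that)
  have g_hull: "g j \<in> fun_convex hull (range u)" for j
    using g[of j] hull_mono[of "u ` {j..}" "range u" fun_convex] by blast
  have g_mod: "g j \<in> modular_space E" for j
    using E.hull_subset_modular_space[of "range u" c] g_hull u by auto
  have near_g: "Ee (\<lambda>x. 2 * (g j x - v' x)) \<le> ennreal (2 * \<epsilon>)" for j
  proof -
    have "Ee (\<lambda>x. (2 * \<epsilon>) * ((g j x - v' x) / \<epsilon>)) \<le> ennreal (2 * \<epsilon>) * Ee (\<lambda>x. (g j x - v' x) / \<epsilon>)"
      using \<epsilon> by (intro Ee.modular_scale_le) auto
    also have "\<dots> \<le> ennreal (2 * \<epsilon>) * 1"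
      by (intro mult_left_mono order_trans[OF Ee_le_form] E.modular_le_1_if_lux_norm_less less
          fun_subspace_diff[OF E.modular_space_subspace g_mod v']) simp
    finally show ?thesis using \<epsilon>(1) by simp
  qed
  have near_v: "Ee (\<lambda>x. 2 * (v x - v' x)) \<le> ennreal (2 * \<epsilon>)"
  proof (rule Ee_le_if_AE_tendsto[OF _ near_g])
    show "AE x in M. (\<lambda>j. 2 * (g j x - v' x)) \<longlonglongrightarrow> 2 * (v x - v' x)"
      using lim by eventually_elim (intro tendsto_intros hull_tails_tendsto[OF g])
    show "(\<lambda>x. 2 * (v x - v' x)) \<in> borel_measurable M"
      using L2D(1)[OF modular_space_imp_L2[OF v']] by measurable
  qed
  have "Ee (\<lambda>x. v x - g 0 x) \<le> Ee (\<lambda>x. 2 * (v x - v' x)) + Ee (\<lambda>x. 2 * (g 0 x - v' x))"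
    by (rule Ee.modular_diff_le)
  also have "\<dots> \<le> ennreal (2 * \<epsilon>) + ennreal (2 * \<epsilon>)" by (intro add_mono near_v near_g)
  also have "\<dots> = ennreal (4 * \<epsilon>)" using \<epsilon>(1) by (simp flip: ennreal_plus)
  also have "\<dots> \<le> ennreal \<delta>" by (rule ennreal_leI[OF \<epsilon>(3)])
  finally show ?thesis by (rule that[OF g_hull])
qed

text \<open>Along a subsequence on which \<open>\<E>\<^sub>e(g \<and> e\<^sub>n)\<close> tends to its upper limit, lower semicontinuity bounds the
  energy of \<open>g \<or> e\<^sub>n\<close> from below by \<open>\<E>\<^sub>e(g)\<close>, so submodularity leaves nothing for \<open>g \<and> e\<^sub>n\<close>.\<close>

lemma (in extended_form) Ee_min_tendsto_0:
  fixes e :: "nat \<Rightarrow> 'a \<Rightarrow> real"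
  assumes g: "Ee g < \<infinity>" "AE x in M. 0 \<le> g x"
    and e: "(\<lambda>n. Ee (e n)) \<longlonglongrightarrow> 0" "AE x in M. (\<lambda>n. e n x) \<longlonglongrightarrow> 0"
  shows "(\<lambda>n. Ee (\<lambda>x. min (g x) (e n x))) \<longlonglongrightarrow> 0"
proof -
  let ?a = "\<lambda>n. Ee (\<lambda>x. min (g x) (e n x))" and ?b = "\<lambda>n. Ee (\<lambda>x. max (g x) (e n x))"
  obtain r :: "nat \<Rightarrow> nat" where r: "strict_mono r" and lim: "(?a \<circ> r) \<longlonglongrightarrow> limsup ?a"
    using limsup_subseq_lim by blast
  have "AE x in M. (\<lambda>n. max (g x) (e (r n) x)) \<longlonglongrightarrow> g x"
    using e(2) g(2)
  proof eventually_elim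
    case (elim x)
    have "(\<lambda>n. max (g x) (e (r n) x)) \<longlonglongrightarrow> max (g x) 0"
      using LIMSEQ_subseq_LIMSEQ[OF elim(1) r] by (intro tendsto_max tendsto_const) (simp add: o_def)
    then show ?case using elim(2) by simp
  qed
  then have "Ee g \<le> liminf (?b \<circ> r)"
    using Ee_lsc[OF Ee_finite_measurable[OF g(1)], of "\<lambda>n x. max (g x) (e (r n) x)"] by (simp add: o_def)
  then have "limsup ?a + Ee g \<le> liminf (?a \<circ> r) + liminf (?b \<circ> r)"
    using lim by (intro add_mono) (simp_all add: lim_imp_Liminf)
  also have "\<dots> \<le> Ee g"
  proof (rule liminf_add_le_lim)
    show "(?a \<circ> r) n + (?b \<circ> r) n \<le> Ee g + Ee (e (r n))" for n using Ee_min_max by simp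
    show "(\<lambda>n. Ee g + Ee (e (r n))) \<longlonglongrightarrow> Ee g"
      using tendsto_add[OF tendsto_const LIMSEQ_subseq_LIMSEQ[OF e(1) r], of "Ee g"] by (simp add: o_def)
  qed
  finally have "limsup ?a \<le> 0"
    using ennreal_le_of_add_le_add[of "limsup ?a" "Ee g" 0 "Ee g"] g(1) by simp
  moreover have "liminf ?a \<le> limsup ?a" by (rule Liminf_le_Limsup) simp
  ultimately show ?thesis by (simp add: tendsto_iff_Liminf_eq_Limsup)
qed

definition tail_sup :: "(nat \<Rightarrow> 'b \<Rightarrow> real) \<Rightarrow> nat \<Rightarrow> 'b \<Rightarrow> real" where
  "tail_sup a n x = (SUP k. a (n + k) x)"

lemma tail_sup_upper:
  assumes "bdd_above (range (\<lambda>k. a k x))" "n \<le> k"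
  shows "a k x \<le> tail_sup a n x"
proof -
  have "bdd_above (range (\<lambda>k. a (n + k) x))" by (rule bdd_above_mono[OF assms(1)]) auto
  from cSUP_upper[OF _ this, of "k - n"] show ?thesis using assms(2) by (simp add: tail_sup_def)
qed

lemma AE_le_tail_sup:
  assumes bdd: "\<And>x. bdd_above (range (\<lambda>k. a k x))"
    and g_le: "\<And>k. n \<le> k \<Longrightarrow> AE x in M. x \<in> U k \<longrightarrow> g x \<le> a k x"
  shows "AE x in M. x \<in> (\<Union>k\<in>{n..}. U k) \<longrightarrow> g x \<le> tail_sup a n x"
proof -
  have "AE x in M. \<forall>k. n \<le> k \<longrightarrow> x \<in> U k \<longrightarrow> g x \<le> a k x" using g_le by (simp add: AE_all_countable)
  then show ?thesis
  proof eventually_elim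
    case (elim x)
    show ?case
    proof
      assume "x \<in> (\<Union>k\<in>{n..}. U k)"
      then obtain k where k: "n \<le> k" "x \<in> U k" by auto
      then have "g x \<le> a k x" using elim by simp
      also have "\<dots> \<le> tail_sup a n x" by (rule tail_sup_upper[OF bdd k(1)])
      finally show "g x \<le> tail_sup a n x" .
    qed
  qed
qed

lemma (in subcritical_form) tail_sup_tendsto_0:
  fixes a :: "nat \<Rightarrow> 'a \<Rightarrow> real"
  assumes a [measurable]: "\<And>k. a k \<in> borel_measurable M" and a0: "\<And>k x. 0 \<le> a k x"
    and bdd: "\<And>x. bdd_above (range (\<lambda>k. a k x))" and aE: "\<And>k. Ee (a k) \<le> ennreal ((1/2) ^ k)"
  shows "(\<lambda>n. Ee (tail_sup a n)) \<longlonglongrightarrow> 0" and "AE x in M. (\<lambda>n. tail_sup a n x) \<longlonglongrightarrow> 0"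
proof -
  have bdd_tail: "bdd_above (range (\<lambda>k. a (n + k) x))" for n x by (rule bdd_above_mono[OF bdd]) auto
  have "Ee (tail_sup a n) \<le> ennreal (2 * (1/2) ^ n)" for n
  proof -
    have "Ee (tail_sup a n) \<le> (\<Sum>k. Ee (a (n + k)))"
      unfolding tail_sup_def[abs_def] by (rule Ee_SUP_le[OF a bdd_tail])
    also have "\<dots> \<le> (\<Sum>k. ennreal ((1/2) ^ (n + k)))" by (intro suminf_le aE) auto
    finally show ?thesis by (simp only: suminf_ennreal_half_powers)
  qed
  then show energy: "(\<lambda>n. Ee (tail_sup a n)) \<longlonglongrightarrow> 0"
    by (intro tendsto_sandwich[OF _ _ tendsto_const half_powers_tendsto]) simp_all
  have nonneg: "0 \<le> tail_sup a n x" for n x by (rule order_trans[OF a0 tail_sup_upper[OF bdd order_refl]])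
  have "decseq (\<lambda>n. tail_sup a n x)" for x
    unfolding tail_sup_def[of _ "Suc _"] decseq_Suc_iff
    by (intro allI cSUP_least tail_sup_upper[OF bdd]) auto
  moreover have "bdd_below (range (\<lambda>n. tail_sup a n x))" for x by (rule bdd_belowI2) (rule nonneg)
  ultimately have lim: "(\<lambda>n. tail_sup a n x) \<longlonglongrightarrow> (INF n. tail_sup a n x)" for x by (intro LIMSEQ_decseq_INF)
  have [measurable]: "tail_sup a n \<in> borel_measurable M" for n
    unfolding tail_sup_def[abs_def] by (rule borel_measurable_cSUP) (use bdd_tail in auto)
  have "Ee (\<lambda>x. INF n. tail_sup a n x) \<le> liminf (\<lambda>n. Ee (tail_sup a n))" using lim by (intro Ee_lsc) auto
  also have "\<dots> = 0" using energy by (intro lim_imp_Liminf) simp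
  finally have "AE x in M. (INF n. tail_sup a n x) = 0" by (intro Ee_eq_0_imp_AE_zero) simp
  then show "AE x in M. (\<lambda>n. tail_sup a n x) \<longlonglongrightarrow> 0"
  proof eventually_elim
    case (elim x)
    show ?case using lim[of x] elim by simp
  qed
qed

locale topological_delta2_form = delta2_form M E for M :: "'a::topological_space measure" and E
begin

abbreviation local_fns :: "'a set \<Rightarrow> ('a \<Rightarrow> real) set" where
  "local_fns \<equiv> local_space M (modular_space Ee)"

lemma exceptional_imp_capacity_zero:
  assumes A: "exceptional M E A" and h: "Ee h < \<infinity>"
  shows "capacity M E h A = 0"
proof -
  obtain F where nest: "is_nest M E F" and AF: "A \<subseteq> (\<Inter>n. - F n)" using A by (auto simp: exceptional_def)
  have "capacity M E h A \<le> 0 + ennreal e" if e: "0 < e" for e :: real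
  proof -
    define l where "l = min 1 e"
    have l: "0 < l" "l \<le> 1" "l \<le> e" using e by (auto simp: l_def)
    have h_mod: "h \<in> modular_space Ee" using h by (rule Ee.modular_spaceI)
    then obtain n g where g: "g \<in> local_fns (F n)" and near: "luxemburg Ee (\<lambda>x. h x - g x) < ennreal l"
      using nest l(1) unfolding is_nest_def by metis
    obtain U where U: "open U" "- F n \<subseteq> U" "AE x in M. x \<in> U \<longrightarrow> g x = 0" and "g \<in> modular_space Ee"
      using g by (auto simp: local_space_def)
    then have "(\<lambda>x. h x - g x) \<in> modular_space Ee"
      by (intro fun_subspace_diff[OF Ee.modular_space_subspace h_mod])
    then have "(\<lambda>x. h x - g x) \<in> borel_measurable M"
      by (intro Ee_finite_measurable) (simp add: Ee.modular_space_eq)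
    moreover have "A \<subseteq> U" using AF U(2) by blast
    moreover have "AE x in M. x \<in> U \<longrightarrow> h x \<le> h x - g x" using U(3) by eventually_elim simp
    ultimately have "capacity M E h A \<le> Ee (\<lambda>x. h x - g x)" using U(1) by (intro capacity_le)
    also have "\<dots> \<le> ennreal l" by (rule Ee.modular_le_if_luxemburg_less[OF near l(2)])
    also have "\<dots> \<le> ennreal e" by (rule ennreal_leI[OF l(3)])
    finally show ?thesis by simp
  qed
  then have "capacity M E h A \<le> 0" by (rule ennreal_le_epsilon)
  then show ?thesis by simp
qed

lemma capacity_scale_zero:
  assumes cap: "capacity M E h A = 0" and a: "0 \<le> a"
  shows "capacity M E (\<lambda>x. a * h x) A = 0"
proof -
  have "capacity M E (\<lambda>x. a * h x) A \<le> 0 + ennreal e" if e: "0 < e" for e :: real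
  proof -
    obtain \<eta> where \<eta>: "0 < \<eta>"
      and small: "\<And>f g. Ee f \<le> ennreal \<eta> \<Longrightarrow> Ee g \<le> ennreal \<eta> \<Longrightarrow> Ee (\<lambda>x. a * f x + 0 * g x) \<le> ennreal e"
      using Ee.modular_lincomb_small[OF e, of a 0] by blast
    have "capacity M E h A < ennreal \<eta>" using cap \<eta> by simp
    then obtain f U where f [measurable]: "f \<in> borel_measurable M" and U: "open U" "A \<subseteq> U"
      and h_le: "AE x in M. x \<in> U \<longrightarrow> h x \<le> f x" and fE: "Ee f < ennreal \<eta>" by (rule capacity_lessE)
    have "AE x in M. x \<in> U \<longrightarrow> a * h x \<le> a * f x"
      using h_le by eventually_elim (use a in \<open>auto intro: mult_left_mono\<close>)
    then have "capacity M E (\<lambda>x. a * h x) A \<le> Ee (\<lambda>x. a * f x)" using U by (intro capacity_le) auto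
    also have "\<dots> \<le> ennreal e" using small[of f f] fE by simp
    finally show ?thesis by simp
  qed
  then have "capacity M E (\<lambda>x. a * h x) A \<le> 0" by (rule ennreal_le_epsilon)
  then show ?thesis by simp
qed

definition nest_closure :: "(nat \<Rightarrow> 'a set) \<Rightarrow> ('a \<Rightarrow> real) set" where
  "nest_closure F = {f. Ee f < \<infinity> \<and> (\<forall>\<delta>>0. \<exists>n. \<exists>g\<in>local_fns (F n).
      Ee (\<lambda>x. f x - g x) \<le> ennreal \<delta>)}"

lemma local_space_lincomb:
  assumes f: "f \<in> local_fns G" and g: "g \<in> local_fns G'" and sub: "G \<subseteq> H" "G' \<subseteq> H"
  shows "(\<lambda>x. a * f x + b * g x) \<in> local_fns H"
proof -
  obtain U where U: "open U" "- G \<subseteq> U" "AE x in M. x \<in> U \<longrightarrow> f x = 0" and fm: "f \<in> modular_space Ee"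
    using f by (auto simp: local_space_def)
  obtain V where V: "open V" "- G' \<subseteq> V" "AE x in M. x \<in> V \<longrightarrow> g x = 0" and gm: "g \<in> modular_space Ee"
    using g by (auto simp: local_space_def)
  have "AE x in M. x \<in> U \<inter> V \<longrightarrow> a * f x + b * g x = 0" using U(3) V(3) by eventually_elim simp
  moreover have "open (U \<inter> V)" "- H \<subseteq> U \<inter> V" using U V sub by auto
  ultimately show ?thesis
    unfolding local_space_def using fun_subspace_lincomb[OF Ee.modular_space_subspace fm gm] by blast
qed

lemma diff_min_in_local_fns:
  assumes V: "open V" "AE x in M. x \<in> V \<longrightarrow> g x \<le> e x" and fin: "Ee g < \<infinity>" "Ee (\<lambda>x. min (g x) (e x)) < \<infinity>"
  shows "(\<lambda>x. g x - min (g x) (e x)) \<in> local_fns (- V)"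
proof -
  have "AE x in M. x \<in> V \<longrightarrow> g x - min (g x) (e x) = 0" using V(2) by eventually_elim simp
  moreover have "(\<lambda>x. g x - min (g x) (e x)) \<in> modular_space Ee"
    using fin by (intro fun_subspace_diff[OF Ee.modular_space_subspace] Ee.modular_spaceI)
  ultimately show ?thesis using V(1) unfolding local_space_def by auto
qed

lemma nest_closure_lincomb:
  assumes F: "incseq F" and f: "f \<in> nest_closure F" and g: "g \<in> nest_closure F"
  shows "(\<lambda>x. a * f x + b * g x) \<in> nest_closure F"
  unfolding nest_closure_def mem_Collect_eq
proof (intro conjI allI impI)
  show "Ee (\<lambda>x. a * f x + b * g x) < \<infinity>"
    using fun_subspace_lincomb[OF Ee.modular_space_subspace, of f g a b] f g
    by (simp add: Ee.modular_space_eq nest_closure_def)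
  fix \<delta> :: real assume "0 < \<delta>"
  then obtain \<eta> where \<eta>: "0 < \<eta>"
    and combination_le: "\<And>f g. Ee f \<le> ennreal \<eta> \<Longrightarrow> Ee g \<le> ennreal \<eta> \<Longrightarrow> Ee (\<lambda>x. a * f x + b * g x) \<le> ennreal \<delta>"
    using Ee.modular_lincomb_small[of \<delta> a b] by blast
  obtain n p where p: "p \<in> local_fns (F n)" "Ee (\<lambda>x. f x - p x) \<le> ennreal \<eta>"
    using f \<eta> unfolding nest_closure_def by blast
  obtain m q where q: "q \<in> local_fns (F m)" "Ee (\<lambda>x. g x - q x) \<le> ennreal \<eta>"
    using g \<eta> unfolding nest_closure_def by blast
  have "(\<lambda>x. a * p x + b * q x) \<in> local_fns (F (max n m))"
    by (rule local_space_lincomb[OF p(1) q(1)]) (auto intro!: incseqD[OF F])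
  moreover have "Ee (\<lambda>x. (a * f x + b * g x) - (a * p x + b * q x)) \<le> ennreal \<delta>"
    using combination_le[OF p(2) q(2)] by (simp add: algebra_simps)
  ultimately show "\<exists>n. \<exists>r\<in>local_fns (F n). Ee (\<lambda>x. (a * f x + b * g x) - r x) \<le> ennreal \<delta>"
    by (intro exI bexI[of _ "\<lambda>x. a * p x + b * q x"])
qed

lemma fun_convex_nest_closure: "incseq F \<Longrightarrow> fun_convex (nest_closure F)"
  by (simp add: fun_convex_def nest_closure_lincomb)

lemma nest_closure_closed:
  assumes fin: "Ee f < \<infinity>" and near: "\<And>\<delta>. 0 < \<delta> \<Longrightarrow> \<exists>g\<in>nest_closure F. Ee (\<lambda>x. f x - g x) \<le> ennreal \<delta>"
  shows "f \<in> nest_closure F"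
  unfolding nest_closure_def mem_Collect_eq
proof (intro conjI allI impI fin)
  fix \<delta> :: real assume "0 < \<delta>"
  then obtain \<eta> where \<eta>: "0 < \<eta>"
    and sum_le: "\<And>f g. Ee f \<le> ennreal \<eta> \<Longrightarrow> Ee g \<le> ennreal \<eta> \<Longrightarrow> Ee (\<lambda>x. 1 * f x + 1 * g x) \<le> ennreal \<delta>"
    using Ee.modular_lincomb_small[of \<delta> 1 1] by blast
  obtain g where g: "g \<in> nest_closure F" "Ee (\<lambda>x. f x - g x) \<le> ennreal \<eta>" using near[OF \<eta>] by blast
  obtain n p where p: "p \<in> local_fns (F n)" "Ee (\<lambda>x. g x - p x) \<le> ennreal \<eta>"
    using g(1) \<eta> unfolding nest_closure_def by blast
  have "Ee (\<lambda>x. f x - p x) \<le> ennreal \<delta>" using sum_le[OF g(2) p(2)] by simp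
  then show "\<exists>n. \<exists>p\<in>local_fns (F n). Ee (\<lambda>x. f x - p x) \<le> ennreal \<delta>" using p(1) by blast
qed

lemma is_nestI:
  assumes "\<And>n. closed (F n)" "incseq F" and dense: "\<And>f. Ee f < \<infinity> \<Longrightarrow> f \<in> nest_closure F"
  shows "is_nest M E F"
  unfolding is_nest_def
proof (intro conjI allI assms(1,2) ballI impI)
  fix f and \<epsilon> :: real assume f: "f \<in> modular_space Ee" and \<epsilon>: "0 < \<epsilon>"
  obtain \<delta> where \<delta>: "0 < \<delta>" "\<And>f. Ee f \<le> ennreal \<delta> \<Longrightarrow> luxemburg Ee f < ennreal \<epsilon>"
    using Ee.luxemburg_less_if_modular_small[OF \<epsilon>] by blast
  have "f \<in> nest_closure F" using f by (intro dense) (simp add: Ee.modular_space_eq)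
  then show "\<exists>n. \<exists>g\<in>local_fns (F n). luxemburg Ee (\<lambda>x. f x - g x) < ennreal \<epsilon>"
    using \<delta> unfolding nest_closure_def by blast
qed

end

locale nest_form = topological_delta2_form M E + subcritical_form M E
  for M :: "'a::topological_space measure" and E +
  assumes refl: "reflexive_form E"
begin

lemma nest_closure_if_bounded_approx:
  assumes F: "incseq F" and fin: "Ee f < \<infinity>" and u: "\<And>n. u n \<in> nest_closure F" "\<And>n. E (u n) \<le> ennreal c"
    and lim: "AE x in M. (\<lambda>n. u n x) \<longlonglongrightarrow> f x"
  shows "f \<in> nest_closure F"
proof (rule nest_closure_closed[OF fin])
  fix \<delta> :: real assume "0 < \<delta>"
  then obtain p where p: "p \<in> fun_convex hull (range u)" "Ee (\<lambda>x. f x - p x) \<le> ennreal \<delta>"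
    using reflexive_convex_approx[OF refl u(2) Ee_finite_measurable[OF fin] lim] by blast
  have "fun_convex hull (range u) \<subseteq> nest_closure F"
    using u(1) by (intro hull_minimal fun_convex_nest_closure[OF F]) blast
  then show "\<exists>g\<in>nest_closure F. Ee (\<lambda>x. f x - g x) \<le> ennreal \<delta>" using p by blast
qed

lemma nest_closure_if_nonneg_form_domain:
  assumes F: "incseq F" and nonneg: "\<And>g. E g < \<infinity> \<Longrightarrow> (\<And>x. 0 \<le> g x) \<Longrightarrow> g \<in> nest_closure F"
    and fin: "Ee f < \<infinity>"
  shows "f \<in> nest_closure F"
proof -
  have dom: "g \<in> nest_closure F" if g: "E g < \<infinity>" for g
  proof -
    have "(\<lambda>x. max (g x) 0) \<in> nest_closure F" "(\<lambda>x. max (- g x) 0) \<in> nest_closure F"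
      using g le_less_trans[OF E.modular_pos_part_le] by (auto intro!: nonneg simp: E.modular_minus)
    from nest_closure_lincomb[OF F this, of 1 "-1"]
    have "(\<lambda>x. max (g x) 0 - max (- g x) 0) \<in> nest_closure F" by simp
    moreover have "(\<lambda>x. max (g x) 0 - max (- g x) 0) = g" by (auto simp: max_def)
    ultimately show ?thesis by simp
  qed
  define c where "c = enn2real (Ee f) + 1"
  have c: "Ee f < ennreal c" using fin by (cases "Ee f") (auto simp: c_def ennreal_less_iff)
  obtain gs where gs: "\<And>k. E (gs k) < ennreal c" "AE x in M. (\<lambda>k. gs k x) \<longlonglongrightarrow> f x"
    using Ee_less_approx[OF c] by metis
  show ?thesis
  proof (rule nest_closure_if_bounded_approx[OF F fin _ less_imp_le[OF gs(1)] gs(2)])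
    show "gs k \<in> nest_closure F" for k using gs(1)[of k] by (intro dom) (simp add: order_less_le_trans)
  qed
qed

lemma nest_closure_if_below_excessive:
  assumes H: "excessive M E H"
    and f: "\<And>k. Ee (f k) \<le> ennreal ((1/2) ^ k)" and U: "\<And>k. open (U k)"
    and fU: "\<And>k. N \<le> k \<Longrightarrow> AE x in M. x \<in> U k \<longrightarrow> H x \<le> f k x"
    and g: "Ee g < \<infinity>" "AE x in M. 0 \<le> g x" "AE x in M. g x \<le> H x"
  shows "g \<in> nest_closure (\<lambda>n. - (\<Union>k\<in>{n..}. U k))"
  unfolding nest_closure_def mem_Collect_eq
proof (intro conjI allI impI g(1))
  note [measurable] = excessiveD(1)[OF H]
  have [measurable]: "f k \<in> borel_measurable M" for k
    using le_less_trans[OF f[of k] ennreal_less_top] by (intro Ee_finite_measurable) simp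
  define a where "a k x = max (min (f k x) (H x)) 0" for k x
  let ?e = "tail_sup a"
  have bdd: "bdd_above (range (\<lambda>k. a k x))" for x
    by (rule bdd_aboveI2[where M = "max (H x) 0"]) (auto simp: a_def)
  have a_meas: "a k \<in> borel_measurable M" for k unfolding a_def by measurable
  have aE: "Ee (a k) \<le> ennreal ((1/2) ^ k)" for k
    unfolding a_def
      by (rule order_trans[OF Ee.modular_pos_part_le order_trans[OF Ee_min_excessive[OF H] f]])
  have a0: "0 \<le> a k x" for k x by (simp add: a_def)
  fix \<delta> :: real assume "0 < \<delta>"
  then have "eventually (\<lambda>n. Ee (\<lambda>x. min (g x) (?e n x)) < ennreal \<delta>) sequentially"
    using order_tendstoD(2)[OF Ee_min_tendsto_0[OF g(1,2) tail_sup_tendsto_0[OF a_meas a0 bdd aE]]]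
      by simp
  then obtain m where m: "\<And>n. m \<le> n \<Longrightarrow> Ee (\<lambda>x. min (g x) (?e n x)) < ennreal \<delta>"
    by (auto simp: eventually_sequentially)
  define n where "n = max N m"
  have n: "N \<le> n" and small: "Ee (\<lambda>x. min (g x) (?e n x)) < ennreal \<delta>" using m by (simp_all add: n_def)
  have "AE x in M. x \<in> U k \<longrightarrow> g x \<le> a k x" if "n \<le> k" for k
    using fU[OF order_trans[OF n that]] g(3) by eventually_elim (auto simp: a_def)
  then have "AE x in M. x \<in> (\<Union>k\<in>{n..}. U k) \<longrightarrow> g x \<le> ?e n x" by (rule AE_le_tail_sup[OF bdd])
  then have "(\<lambda>x. g x - min (g x) (?e n x)) \<in> local_fns (- (\<Union>k\<in>{n..}. U k))"
    using U g(1) order_less_le_trans[OF small top_greatest] by (intro diff_min_in_local_fns) auto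
  moreover have "Ee (\<lambda>x. g x - (g x - min (g x) (?e n x))) \<le> ennreal \<delta>"
    using small by (simp add: less_imp_le)
  ultimately show "\<exists>n. \<exists>l\<in>local_fns (- (\<Union>k\<in>{n..}. U k)). Ee (\<lambda>x. g x - l x) \<le> ennreal \<delta>"
    by - (rule exI, rule bexI)
qed

lemma exceptional_if_capacities_zero:
  assumes H: "\<And>N. excessive M E (H N)" and H_mono: "\<And>N. AE x in M. H N x \<le> H (Suc N) x"
    and H_large: "\<And>N. AE x in M. real N * h x \<le> H N x" and h: "AE x in M. 0 < h x"
    and cap: "\<And>N. capacity M E (H N) A = 0"
  shows "exceptional M E A"
proof -
  obtain f U where U: "\<And>k. open (U k)" "\<And>k. A \<subseteq> U k" and fU: "\<And>k. AE x in M. x \<in> U k \<longrightarrow> H k x \<le> f k x"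
    and f: "\<And>k. Ee (f k) \<le> ennreal ((1/2) ^ k)"
    by (rule capacities_zero_approx[of M E H A, OF cap]) (rule that)
  define F where "F n = - (\<Union>k\<in>{n..}. U k)" for n
  have F: "incseq F" unfolding F_def incseq_def by fastforce
  have H_inc: "AE x in M. incseq (\<lambda>N. H N x)"
    using H_mono by (simp add: incseq_Suc_iff AE_all_countable)
  have HU: "AE x in M. x \<in> U k \<longrightarrow> H N x \<le> f k x" if "N \<le> k" for N k
    using fU[of k] H_inc by eventually_elim (use that in \<open>auto dest: incseqD intro: order_trans\<close>)
  have nonneg: "g \<in> nest_closure F" if g: "E g < \<infinity>" "\<And>x. 0 \<le> g x" for g
  proof (rule nest_closure_if_bounded_approx[OF F])
    let ?u = "\<lambda>N x. min (g x) (H N x)"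
    show g_fin: "Ee g < \<infinity>" by (rule le_less_trans[OF Ee_le_form g(1)])
    show "AE x in M. (\<lambda>N. ?u N x) \<longlonglongrightarrow> g x" by (rule AE_min_tendsto_if_large[OF h H_large])
    show "E (?u N) \<le> ennreal (enn2real (E g))" for N using form_min_excessive[OF H] g(1) by simp
    show "?u N \<in> nest_closure F" for N
      unfolding F_def
    proof (rule nest_closure_if_below_excessive[OF H[of N] f U(1) HU])
      show "Ee (?u N) < \<infinity>" by (rule le_less_trans[OF Ee_min_excessive[OF H] g_fin])
      show "AE x in M. 0 \<le> ?u N x" using excessiveD(2)[OF H[of N]] by eventually_elim (simp add: g(2))
    qed simp_all
  qed
  have "is_nest M E F"
  proof (rule is_nestI[OF _ F])
    show "closed (F n)" for n using U(1) by (auto simp: F_def)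
    show "g \<in> nest_closure F" if "Ee g < \<infinity>" for g
      by (rule nest_closure_if_nonneg_form_domain[OF F nonneg that])
  qed
  moreover have "A \<subseteq> (\<Inter>n. - F n)" using U(2) by (auto simp: F_def)
  ultimately show ?thesis unfolding exceptional_def by blast
qed

lemma exceptional_if_excessive_capacities_zero:
  assumes h: "h \<in> borel_measurable M" "Ee h < \<infinity>" "AE x in M. 0 < h x"
    and cap: "\<And>h'. excessive M E h' \<Longrightarrow> h' \<in> dom_ext M E \<Longrightarrow> AE x in M. 0 < h' x \<Longrightarrow> capacity M E h' A = 0"
  shows "exceptional M E A"
proof -
  have "AE x in M. 0 \<le> h x" using h(3) by eventually_elim simp
  then obtain H where H: "\<And>N. excessive M E (H N)" "\<And>N. Ee (H N) < \<infinity>"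
    and large: "\<And>N x. real N * h x \<le> H N x" and mono: "\<And>N x. H N x \<le> H (Suc N) x"
    using increasing_excessive_majorants[OF h(1) _ h(2)] by blast
  have pos: "AE x in M. 0 < H (Suc N) x" for N
    using h(3)
  proof eventually_elim
    case (elim x)
    then have "0 < real (Suc N) * h x" by simp
    then show ?case using large by (rule less_le_trans)
  qed
  have "capacity M E (H (Suc N)) A = 0" for N
    using H excessiveD(1)[OF H(1)] by (intro cap pos) (auto simp: dom_ext_def)
  moreover have "real N * h x \<le> H (Suc N) x" for N x by (rule order_trans[OF large mono])
  ultimately show ?thesis
    using mono by (intro exceptional_if_capacities_zero[of "\<lambda>N. H (Suc N)" h] H h(3)) auto
qed

lemma exceptional_if_multiples_excessive:
  assumes "\<And>N::nat. excessive M E (\<lambda>x. real N * h x)" "AE x in M. 0 < h x" "capacity M E h A = 0"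
  shows "exceptional M E A"
proof (rule exceptional_if_capacities_zero[of "\<lambda>N x. real N * h x" h])
  show "AE x in M. real N * h x \<le> real (Suc N) * h x" for N
    using assms(2) by eventually_elim (simp add: distrib_right)
  show "capacity M E (\<lambda>x. real N * h x) A = 0" for N by (rule capacity_scale_zero[OF assms(3)]) simp
qed (use assms in simp_all)

end

theorem theorem5p7:
  fixes M :: "'a::t2_space measure"
    and E :: "('a \<Rightarrow> real) \<Rightarrow> ennreal"
    and h :: "'a \<Rightarrow> real"
    and A :: "'a set"
  assumes borel: "sets M = sets borel"
    and sfin: "sigma_finite_measure M"
    and form: "nonlinear_order_preserving_form M E"
    and ext: "extended_form_exists M E"
    and refl: "reflexive_form E"
    and subcrit: "subcritical M E"
    and d2: "delta2_condition E"
    and h_exc: "excessive M E h"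
    and h_dom: "h \<in> dom_ext M E"
    and h_pos: "AE x in M. 0 < h x"
  shows "(exceptional M E A \<longleftrightarrow>
            (\<forall>h'. excessive M E h' \<and> h' \<in> dom_ext M E \<and> (AE x in M. 0 < h' x)
                   \<longrightarrow> capacity M E h' A = 0))
       \<and> ((\<forall>N::nat. excessive M E (\<lambda>x. real N * h x)) \<longrightarrow>
            (exceptional M E A \<longleftrightarrow> capacity M E h A = 0))"
proof -
  interpret sigma_finite_measure M by (rule sfin)
  interpret nest_form M E by unfold_locales (fact form ext d2 subcrit refl)+
  have "capacity M E h' A = 0" if "exceptional M E A" "h' \<in> dom_ext M E" for h'
    using exceptional_imp_capacity_zero[OF that(1)] that(2) by (simp add: dom_ext_def)
  moreover have "exceptional M E A"
    if "\<forall>h'. excessive M E h' \<and> h' \<in> dom_ext M E \<and> (AE x in M. 0 < h' x) \<longrightarrow> capacity M E h' A = 0"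
    using exceptional_if_excessive_capacities_zero[of h A] h_dom h_pos that by (auto simp: dom_ext_def)
  moreover have "exceptional M E A"
    if "\<forall>N::nat. excessive M E (\<lambda>x. real N * h x)" "capacity M E h A = 0"
    using exceptional_if_multiples_excessive[OF _ h_pos] that by blast
  ultimately show ?thesis using h_dom by blast
qed

end
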